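(* Let $G$ be a compact abelian group and $(A,G,\alpha)$ a $C^*$-dynamical system (with $A$ unital) such that each isotypic component $A_\varphi$, $\varphi\in\widehat{G}$, contains an invertible element, and let $B:=A^G$ be the fixed point algebra. Choose in each $A_\varphi$ a unitary element $u_\varphi$ (with $u_{\mathbf{0}}=1_A$ for the trivial character $\mathbf{0}$), and let $(S,\omega)$ be the factor system for $(\widehat{G},B)$ given by \[S(\varphi).b:=u_\varphi b u_\varphi^*,\qquad\omega(\varphi,\varphi'):=u_\varphi u_{\varphi'}u_{\varphi\cdot\varphi'}^*.\] Then $A$ is isomorphic (as a $C^*$-algebra) to $C^*(A_{(S,\omega)})$.
   Context: $\widehat{G}$ is the dual (character) group of $G$; for $\varphi\in\widehat{G}$, $A_\varphi:=\{a\in A:\alpha(g,a)=\varphi(g)\cdot a\ \forall g\in G\}$; in particular $B=A_{\mathbf{0}}$. Under the hypothesis, each isotypic component also contains a unitary element. Algebra $A_{(S,\omega)}$: the vector space $\bigoplus_{\varphi\in\widehat{G}}Bv_\varphi$ (free left $B$-module with basis $(v_\varphi)_{\varphi\in\widehat{G}}$) with multiplication $(bv_\varphi)(b'v_{\varphi'}):=b\,(S(\varphi).b')\,\omega(\varphi,\varphi')\,v_{\varphi\cdot\varphi'}$ and involution $(bv_\varphi)^*:=\omega(-\varphi,\varphi)^{-1}\,(S(-\varphi).b^* )\,v_{-\varphi}$, where $-\varphi$ denotes the inverse of $\varphi$ in $\widehat{G}$. Multiplication and involution are continuous for the $\ell^1$-norm $\|(b_\varphi v_\varphi)_{\varphi}\|_1:=\sum_{\varphi\in\widehat{G}}\|b_\varphi\|$.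 $\ell^1(A_{(S,\omega)})$ denotes the corresponding involutive Banach algebra (the completion), and $C^*(A_{(S,\omega)})$ is the enveloping $C^*$-algebra of $\ell^1(A_{(S,\omega)})$. *)

theory Defs
  imports "HOL-Analysis.Analysis" "HOL-Algebra.QuotRing"
begin

section \<open>Unital C*-algebras\<close>

class unital_cstar_algebra = real_normed_algebra_1 + banach +
  fixes scaleC :: "complex \<Rightarrow> 'a \<Rightarrow> 'a"  (infixr \<open>*\<^sub>C\<close> 75)
    and star :: "'a \<Rightarrow> 'a"
  assumes scaleC_add_right: "c *\<^sub>C (x + y) = c *\<^sub>C x + c *\<^sub>C y"
    and scaleC_add_left: "(c + d) *\<^sub>C x = c *\<^sub>C x + d *\<^sub>C x"
    and scaleC_scaleC: "c *\<^sub>C d *\<^sub>C x = (c * d) *\<^sub>C x"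
    and scaleC_complex_of_real: "complex_of_real r *\<^sub>C x = r *\<^sub>R x"
    and mult_scaleC_left: "(c *\<^sub>C x) * y = c *\<^sub>C (x * y)"
    and mult_scaleC_right: "x * (c *\<^sub>C y) = c *\<^sub>C (x * y)"
    and norm_scaleC: "norm (c *\<^sub>C x) = cmod c * norm x"
    and star_star: "star (star x) = x"
    and star_add: "star (x + y) = star x + star y"
    and star_scaleC: "star (c *\<^sub>C x) = cnj c *\<^sub>C star x"
    and star_mult: "star (x * y) = star y * star x"
    and norm_star_mult_self: "norm (star x * x) = (norm x)\<^sup>2"

definition is_inverse :: "'a::unital_cstar_algebra \<Rightarrow> 'a \<Rightarrow> bool" where
  "is_inverse a b \<longleftrightarrow> a * b = 1 \<and> b * a = 1"

definition alg_invertible :: "'a::unital_cstar_algebra \<Rightarrow> bool" where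
  "alg_invertible a \<longleftrightarrow> (\<exists>b. is_inverse a b)"

definition alg_inverse :: "'a::unital_cstar_algebra \<Rightarrow> 'a" where
  "alg_inverse a = (THE b. is_inverse a b)"

definition unitary_element :: "'a::unital_cstar_algebra \<Rightarrow> bool" where
  "unitary_element a \<longleftrightarrow> is_inverse a (star a)"

definition star_automorphism :: "('a::unital_cstar_algebra \<Rightarrow> 'a) \<Rightarrow> bool" where
  "star_automorphism h \<longleftrightarrow>
     bij h \<and>
     (\<forall>x y. h (x + y) = h x + h y) \<and>
     (\<forall>c x. h (c *\<^sub>C x) = c *\<^sub>C h x) \<and>
     (\<forall>x y. h (x * y) = h x * h y) \<and>
     (\<forall>x. h (star x) = star (h x))"


section \<open>Dynamical systems and isotypic components\<close>

definition cstar_dynamical_system ::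
    "('g::topological_ab_group_add \<Rightarrow> 'a::unital_cstar_algebra \<Rightarrow> 'a) \<Rightarrow> bool" where
  "cstar_dynamical_system \<alpha> \<longleftrightarrow>
     (\<forall>g. star_automorphism (\<alpha> g)) \<and>
     (\<forall>g h. \<alpha> (g + h) = \<alpha> g \<circ> \<alpha> h) \<and>
     (\<forall>a. continuous_on UNIV (\<lambda>g. \<alpha> g a))"

definition dual_group :: "('g::topological_ab_group_add \<Rightarrow> complex) monoid" where
  "dual_group =
     \<lparr>carrier = {\<phi>. continuous_on UNIV \<phi> \<and> (\<forall>g. cmod (\<phi> g) = 1) \<and>
                    (\<forall>g h. \<phi> (g + h) = \<phi> g * \<phi> h)},
      mult = (\<lambda>\<phi> \<psi> g. \<phi> g * \<psi> g),
      one = (\<lambda>g. 1)\<rparr>"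

definition isotypic_component ::
    "('g \<Rightarrow> 'a::unital_cstar_algebra \<Rightarrow> 'a) \<Rightarrow> ('g \<Rightarrow> complex) \<Rightarrow> 'a set" where
  "isotypic_component \<alpha> \<phi> = {a. \<forall>g. \<alpha> g a = \<phi> g *\<^sub>C a}"

definition fixed_point_algebra :: "('g \<Rightarrow> 'a::unital_cstar_algebra \<Rightarrow> 'a) \<Rightarrow> 'a set" where
  "fixed_point_algebra \<alpha> = {a. \<forall>g. \<alpha> g a = a}"


section \<open>Seminormed involutive algebras on a carrier set\<close>

record 'x seminormed_star_algebra = "'x ring" +
  cscale :: "complex \<Rightarrow> 'x \<Rightarrow> 'x"
  involution :: "'x \<Rightarrow> 'x"
  seminorm :: "'x \<Rightarrow> real"

definition algebra_of_type :: "'a::unital_cstar_algebra seminormed_star_algebra" where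
  "algebra_of_type =
     \<lparr>carrier = UNIV, mult = (*), one = 1, zero = 0, add = (+),
      cscale = scaleC, involution = star, seminorm = norm\<rparr>"

text \<open>
  A bijective *-homomorphism between C*-algebras is automatically isometric; isometry is
  demanded here so that the relation transports the whole C*-structure.
\<close>

definition cstar_isomorphic ::
    "'x seminormed_star_algebra \<Rightarrow> 'y seminormed_star_algebra \<Rightarrow> bool" where
  "cstar_isomorphic X Y \<longleftrightarrow>
     (\<exists>h \<in> ring_iso X Y.
        (\<forall>c. \<forall>x\<in>carrier X. h (cscale X c x) = cscale Y c (h x)) \<and>
        (\<forall>x\<in>carrier X. h (involution X x) = involution Y (h x)) \<and>
        (\<forall>x\<in>carrier X. seminorm Y (h x) = seminorm X x))"

text \<open>
  Hausdorff completion: Cauchy sequences modulo sequences that differ by a null sequence.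
  This divides out the kernel of the seminorm and completes the quotient in one step. The
  operations take the union of the classes obtained from all representatives, which is a single
  class as soon as they are compatible with the seminorm.
\<close>

definition cauchy_sequences :: "'x seminormed_star_algebra \<Rightarrow> (nat \<Rightarrow> 'x) set" where
  "cauchy_sequences X =
     {x. (\<forall>n. x n \<in> carrier X) \<and>
         (\<forall>e>0. \<exists>N. \<forall>m\<ge>N. \<forall>n\<ge>N. seminorm X (x m \<ominus>\<^bsub>X\<^esub> x n) < e)}"

definition cauchy_equiv ::
    "'x seminormed_star_algebra \<Rightarrow> ((nat \<Rightarrow> 'x) \<times> (nat \<Rightarrow> 'x)) set" where
  "cauchy_equiv X =
     {(x, y). x \<in> cauchy_sequences X \<and> y \<in> cauchy_sequences X \<and>
              (\<lambda>n. seminorm X (x n \<ominus>\<^bsub>X\<^esub> y n)) \<longlonglongrightarrow> 0}"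

definition completion ::
    "'x seminormed_star_algebra \<Rightarrow> (nat \<Rightarrow> 'x) set seminormed_star_algebra" where
  "completion X =
     \<lparr>carrier = cauchy_sequences X // cauchy_equiv X,
      mult = (\<lambda>P Q. \<Union>x\<in>P. \<Union>y\<in>Q. cauchy_equiv X `` {\<lambda>n. x n \<otimes>\<^bsub>X\<^esub> y n}),
      one = cauchy_equiv X `` {\<lambda>n. \<one>\<^bsub>X\<^esub>},
      zero = cauchy_equiv X `` {\<lambda>n. \<zero>\<^bsub>X\<^esub>},
      add = (\<lambda>P Q. \<Union>x\<in>P. \<Union>y\<in>Q. cauchy_equiv X `` {\<lambda>n. x n \<oplus>\<^bsub>X\<^esub> y n}),
      cscale = (\<lambda>c P. \<Union>x\<in>P. cauchy_equiv X `` {\<lambda>n. cscale X c (x n)}),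
      involution = (\<lambda>P. \<Union>x\<in>P. cauchy_equiv X `` {\<lambda>n. involution X (x n)}),
      seminorm = (\<lambda>P. THE r. \<forall>x\<in>P. (\<lambda>n. seminorm X (x n)) \<longlonglongrightarrow> r)\<rparr>"

text \<open>
  The enveloping C*-algebra of an involutive Banach algebra is its Hausdorff completion with
  respect to the largest C*-seminorm. No continuity is demanded of the C*-seminorms: on an
  involutive Banach algebra with isometric involution they are automatically dominated by the
  norm, so that the supremum below is finite.
\<close>

definition cstar_seminorm :: "'x seminormed_star_algebra \<Rightarrow> ('x \<Rightarrow> real) \<Rightarrow> bool" where
  "cstar_seminorm X p \<longleftrightarrow>
     (\<forall>x\<in>carrier X. 0 \<le> p x) \<and>
     (\<forall>c. \<forall>x\<in>carrier X. p (cscale X c x) = cmod c * p x) \<and>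
     (\<forall>x\<in>carrier X. \<forall>y\<in>carrier X. p (x \<oplus>\<^bsub>X\<^esub> y) \<le> p x + p y) \<and>
     (\<forall>x\<in>carrier X. \<forall>y\<in>carrier X. p (x \<otimes>\<^bsub>X\<^esub> y) \<le> p x * p y) \<and>
     (\<forall>x\<in>carrier X. p (involution X x \<otimes>\<^bsub>X\<^esub> x) = (p x)\<^sup>2)"

definition greatest_cstar_seminorm :: "'x seminormed_star_algebra \<Rightarrow> 'x \<Rightarrow> real" where
  "greatest_cstar_seminorm X x = (SUP p \<in> {p. cstar_seminorm X p}. p x)"

definition enveloping_cstar_algebra ::
    "'x seminormed_star_algebra \<Rightarrow> (nat \<Rightarrow> 'x) set seminormed_star_algebra" where
  "enveloping_cstar_algebra X = completion (X\<lparr>seminorm := greatest_cstar_seminorm X\<rparr>)"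


section \<open>The algebra of a factor system\<close>

text \<open>
  For a group \<open>H\<close>, a subalgebra \<open>B\<close> and maps \<open>S\<close>, \<open>\<omega>\<close>, a finite sum of elements
  \<open>b\<^sub>\<phi> v\<^sub>\<phi>\<close> is represented by its coefficient function, so \<open>single \<phi> b\<close> is \<open>b v\<^sub>\<phi>\<close>.
  Multiplication and involution are the biadditive and additive extensions of the
  formulas on the elements \<open>b v\<^sub>\<phi>\<close>.
\<close>

definition supp :: "('k \<Rightarrow> 'a::zero) \<Rightarrow> 'k set" where
  "supp f = {\<phi>. f \<phi> \<noteq> 0}"

definition single :: "'k \<Rightarrow> 'a::zero \<Rightarrow> 'k \<Rightarrow> 'a" where
  "single \<phi> b = (\<lambda>\<psi>. if \<psi> = \<phi> then b else 0)"

definition factor_system_algebra ::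
    "'k monoid \<Rightarrow> 'a::unital_cstar_algebra set \<Rightarrow> ('k \<Rightarrow> 'a \<Rightarrow> 'a) \<Rightarrow> ('k \<Rightarrow> 'k \<Rightarrow> 'a)
      \<Rightarrow> ('k \<Rightarrow> 'a) seminormed_star_algebra" where
  "factor_system_algebra H B S \<omega> =
     \<lparr>carrier = {f. finite (supp f) \<and> supp f \<subseteq> carrier H \<and> (\<forall>\<phi>\<in>carrier H. f \<phi> \<in> B)},
      mult = (\<lambda>f f' \<psi>. \<Sum>\<phi>\<in>supp f. \<Sum>\<phi>'\<in>supp f'.
                single (\<phi> \<otimes>\<^bsub>H\<^esub> \<phi>') (f \<phi> * S \<phi> (f' \<phi>') * \<omega> \<phi> \<phi>') \<psi>),
      one = single \<one>\<^bsub>H\<^esub> 1,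
      zero = (\<lambda>\<psi>. 0),
      add = (\<lambda>f f' \<psi>. f \<psi> + f' \<psi>),
      cscale = (\<lambda>c f \<psi>. c *\<^sub>C f \<psi>),
      involution = (\<lambda>f \<psi>. \<Sum>\<phi>\<in>supp f.
                single (inv\<^bsub>H\<^esub> \<phi>)
                  (alg_inverse (\<omega> (inv\<^bsub>H\<^esub> \<phi>) \<phi>) * S (inv\<^bsub>H\<^esub> \<phi>) (star (f \<phi>))) \<psi>),
      seminorm = (\<lambda>f. \<Sum>\<phi>\<in>supp f. norm (f \<phi>))\<rparr>"

definition ell1_algebra ::
    "'k monoid \<Rightarrow> 'a::unital_cstar_algebra set \<Rightarrow> ('k \<Rightarrow> 'a \<Rightarrow> 'a) \<Rightarrow> ('k \<Rightarrow> 'k \<Rightarrow> 'a)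
      \<Rightarrow> (nat \<Rightarrow> 'k \<Rightarrow> 'a) set seminormed_star_algebra" where
  "ell1_algebra H B S \<omega> = completion (factor_system_algebra H B S \<omega>)"

definition factor_system_cstar_algebra ::
    "'k monoid \<Rightarrow> 'a::unital_cstar_algebra set \<Rightarrow> ('k \<Rightarrow> 'a \<Rightarrow> 'a) \<Rightarrow> ('k \<Rightarrow> 'k \<Rightarrow> 'a)
      \<Rightarrow> (nat \<Rightarrow> (nat \<Rightarrow> 'k \<Rightarrow> 'a) set) set seminormed_star_algebra" where
  "factor_system_cstar_algebra H B S \<omega> = enveloping_cstar_algebra (ell1_algebra H B S \<omega>)"

end

theory Submission
  imports Defs
begin

text \<open>
  The linear span \<open>D\<close> of the isotypic components is the image of \<open>A\<^bsub>(S,\<omega>)\<^esub>\<close> under the injective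
  *-homomorphism sending \<open>b v\<^sub>\<phi>\<close> to \<open>b u\<^sub>\<phi>\<close>, which extends to the \<open>\<ell>\<^sup>1\<close>-completion. Two facts
  identify the enveloping C*-algebra with \<open>A\<close>.

  \<^item> \<open>D\<close> is dense in \<open>A\<close>. This amounts to the completeness of the characters of a compact abelian group.
    Averages over finite sets of translates give an invariant mean, hence a commutative convolution
    algebra of continuous functions. For hermitian \<open>R \<noteq> 0\<close> the normalised powers of \<open>R * R\<close> converge
    uniformly to a nonzero idempotent, and an idempotent of almost minimal norm is a multiple of a
    character. Thus only \<open>R = 0\<close> has vanishing Fourier coefficients, and Parseval's identity follows.

  \<^item> Every C*-seminorm \<open>p\<close> on the \<open>\<ell>\<^sup>1\<close>-algebra is dominated by the norm of \<open>A\<close>. First, \<open>p\<close> is dominated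
    by the \<open>\<ell>\<^sup>1\<close>-norm. Since the dual group is abelian, the powers of \<open>y = x\<^sup>* x\<close> are supported on sets
    of polynomial growth, and each coefficient of \<open>y\<^sup>k\<close> is bounded by the norm of \<open>y\<^sup>k\<close> in \<open>A\<close>. So
    \<open>p x\<^bsup>2k\<^esup> \<le> (k + 1)\<^sup>d \<parallel>x\<parallel>\<^bsup>2k\<^esup>\<close> for all powers \<open>k\<close> of two.
\<close>


section \<open>Averages over finite lists of translates, and means as their constant limits\<close>

section \<open>The invariant mean\<close>

text \<open>The supremum that defines the enveloping norm runs over all C*-seminorms of the
  l1-completion; neither continuity nor a Hilbert space representation is given. Every bound on such
  a seminorm is therefore drawn from the C*-identity: a self-adjoint Cauchy sequence of norm below 1
  is completed to a unitary by an explicit square root iteration, and this yields domination by the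
  l1-norm. In general the l1-norm exceeds the norm of A; its subexponential growth on powers closes
  the gap and is the concrete form that amenability of the dual group takes. Conversely the norm of
  A, pulled back along the extension of \<open>\<pi>\<close> to the l1-completion, is itself a
  C*-seminorm, so the supremum is attained there. For density, approximation in L2 replaces the
  classical uniform approximation by trigonometric polynomials: when \<open>a\<close> is averaged
  along its orbit against a kernel, a change of the kernel costs no more than its L1-norm times the
  norm of \<open>a\<close>. The mean takes values in Banach spaces, so one construction provides
  both scalar Fourier coefficients and the projections onto the components.\<close>

definition avg :: "'g::ab_group_add list \<Rightarrow> ('g \<Rightarrow> 'e::real_normed_vector) \<Rightarrow> 'g \<Rightarrow> 'e" where
  "avg L F x = (\<Sum>g\<leftarrow>L. F (x + g)) /\<^sub>R real (length L)"

lemma sum_list_scaleR: "(\<Sum>x\<leftarrow>L. c *\<^sub>R f x) = c *\<^sub>R (\<Sum>x\<leftarrow>L. f x)"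
  for f :: "'b \<Rightarrow> 'e::real_vector"
  by (induction L) (auto simp: scaleR_add_right)

lemma sum_list_const: "(\<Sum>x\<leftarrow>L. c) = real (length L) *\<^sub>R c"
  for c :: "'e::real_vector"
  by (induction L) (auto simp: algebra_simps)

lemma norm_sum_list_le:
  fixes F :: "'b \<Rightarrow> 'e::real_normed_vector"
  assumes "\<And>x. x \<in> set L \<Longrightarrow> norm (F x) \<le> C"
  shows "norm (\<Sum>x\<leftarrow>L. F x) \<le> real (length L) * C"
  using assms
proof (induction L)
  case (Cons a L)
  have "norm (\<Sum>x\<leftarrow>a # L. F x) \<le> norm (F a) + norm (\<Sum>x\<leftarrow>L. F x)"
    by (simp add: norm_triangle_ineq)
  also have "\<dots> \<le> C + real (length L) * C"
    using Cons by (intro add_mono) auto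
  finally show ?case by (simp add: algebra_simps)
qed simp

lemma norm_avg_le:
  assumes "\<And>x. norm (F x) \<le> C" "L \<noteq> []"
  shows "norm (avg L F x) \<le> C"
proof -
  have "norm (\<Sum>g\<leftarrow>L. F (x + g)) \<le> real (length L) * C"
    by (rule norm_sum_list_le) (use assms in auto)
  then show ?thesis
    using assms(2) by (simp add: avg_def field_simps)
qed

lemma avg_linear:
  assumes "linear T"
  shows "avg L (\<lambda>x. T (F x)) x = T (avg L F x)"
proof -
  interpret linear T by fact
  have "(\<Sum>g\<leftarrow>L. T (F (x + g))) = T (\<Sum>g\<leftarrow>L. F (x + g))"
    by (induction L) (auto simp: add zero)
  then show ?thesis by (simp add: avg_def scale)
qed

lemma avg_add: "avg L (\<lambda>x. F x + F' x) x = avg L F x + avg L F' x"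
  by (simp add: avg_def sum_list_addf scaleR_add_right)

lemma avg_diff: "avg L (\<lambda>x. F x - F' x) x = avg L F x - avg L F' x"
  by (simp add: avg_def sum_list_subtractf scaleR_diff_right)

lemma avg_const: "L \<noteq> [] \<Longrightarrow> avg L (\<lambda>x. c) x = c"
  by (simp add: avg_def sum_list_const)

lemma avg_translate: "avg L (\<lambda>x. F (x + h)) x = avg L F (x + h)"
  by (simp add: avg_def algebra_simps)

lemma avg_mono:
  fixes F F' :: "'g::ab_group_add \<Rightarrow> real"
  assumes "\<And>x. F x \<le> F' x"
  shows "avg L F x \<le> avg L F' x"
  unfolding avg_def using assms by (intro scaleR_left_mono sum_list_mono) auto

lemma norm_avg_le_avg_norm: "norm (avg L F x) \<le> avg L (\<lambda>x. norm (F x)) x"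
proof -
  have "norm (\<Sum>g\<leftarrow>L. F (x + g)) \<le> (\<Sum>g\<leftarrow>L. norm (F (x + g)))"
    by (induction L) (auto intro: order_trans[OF norm_triangle_ineq])
  then show ?thesis by (simp add: avg_def divide_right_mono mult_left_mono)
qed

text \<open>Lists rather than sets keep repeated translates with their multiplicity, so that a
  composition of two averages is exactly one average.\<close>

definition sum_all :: "'g::ab_group_add list \<Rightarrow> 'g list \<Rightarrow> 'g list" where
  "sum_all L L' = concat (map (\<lambda>a. map (\<lambda>b. a + b) L') L)"

lemma sum_all_eq_Nil [simp]: "sum_all L L' = [] \<longleftrightarrow> L = [] \<or> L' = []"
  by (cases L; cases L') (auto simp: sum_all_def)

lemma avg_sum_all: "avg L (avg L' F) x = avg (sum_all L L') F x"
proof -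
  have len: "length (sum_all L L') = length L * length L'"
    by (simp add: sum_all_def length_concat comp_def sum_list_triv)
  have "(\<Sum>g\<leftarrow>sum_all L L'. F (x + g)) = (\<Sum>a\<leftarrow>L. \<Sum>b\<leftarrow>L'. F (x + a + b))"
    unfolding sum_all_def by (induction L) (simp_all add: comp_def add.assoc)
  then show ?thesis by (simp add: avg_def len sum_list_scaleR)
qed

text \<open>Commutativity of the group makes averages along different lists comparable. Uniqueness
  of the mean, the Cauchy property of approximate means and Fubini's theorem rest on this
  exchange.\<close>

lemma avg_commute: "avg L (avg L' F) x = avg L' (avg L F) x"
proof -
  have "(\<Sum>a\<leftarrow>L. \<Sum>b\<leftarrow>L'. F (x + a + b)) = (\<Sum>b\<leftarrow>L'. \<Sum>a\<leftarrow>L. F (x + b + a))"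
    by (induction L) (simp_all add: sum_list_addf algebra_simps)
  then show ?thesis by (simp add: avg_def sum_list_scaleR mult.commute)
qed

lemma avg_close:
  assumes "\<And>x. norm (F x - c) \<le> e" "L \<noteq> []"
  shows "norm (avg L F x - c) \<le> e"
  using norm_avg_le[of "\<lambda>x. F x - c" e L x] assms by (simp add: avg_diff avg_const)

text \<open>Von Neumann's description of the mean: \<open>c\<close> is a constant function in the
  uniform closure of the averages of translates. No measure occurs, values in any normed space are
  allowed, and uniqueness follows from commuting averages alone.\<close>

definition is_mean :: "('g::ab_group_add \<Rightarrow> 'e::real_normed_vector) \<Rightarrow> 'e \<Rightarrow> bool" where
  "is_mean F c \<longleftrightarrow> (\<forall>e>0. \<exists>L. L \<noteq> [] \<and> (\<forall>x. norm (avg L F x - c) \<le> e))"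

definition mean :: "('g::ab_group_add \<Rightarrow> 'e::real_normed_vector) \<Rightarrow> 'e" where
  "mean F = (THE c. is_mean F c)"

text \<open>Averaging an almost constant average once more keeps it within \<open>e\<close>, and by
  \<open>avg_commute\<close> either of the two lists may be regarded as the inner one.\<close>

lemma is_mean_common:
  assumes "is_mean F c" "is_mean F' c'" "e > 0"
  obtains L where "L \<noteq> []" "\<And>x. norm (avg L F x - c) \<le> e" "\<And>x. norm (avg L F' x - c') \<le> e"
proof -
  obtain L L' where L: "L \<noteq> []" "\<And>x. norm (avg L F x - c) \<le> e"
    and L': "L' \<noteq> []" "\<And>x. norm (avg L' F' x - c') \<le> e"
    using assms unfolding is_mean_def by metis
  show ?thesis
  proof
    show "sum_all L L' \<noteq> []" using L L' by simp
    show "norm (avg (sum_all L L') F x - c) \<le> e" for x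
      unfolding avg_sum_all[symmetric] avg_commute[of L L']
      by (rule avg_close) (use L L' in auto)
    show "norm (avg (sum_all L L') F' x - c') \<le> e" for x
      unfolding avg_sum_all[symmetric] by (rule avg_close) (use L L' in auto)
  qed
qed

lemma is_mean_unique:
  assumes "is_mean F c" "is_mean F c'"
  shows "c = c'"
proof (rule ccontr)
  assume "c \<noteq> c'"
  \<comment> \<open>A third rather than a half, since the approximations are non-strict: two errors
    of \<open>e\<close> stay below \<open>3 * e\<close>.\<close>
  define e where "e = norm (c - c') / 3"
  have "e > 0" using \<open>c \<noteq> c'\<close> by (simp add: e_def)
  obtain L where "\<And>x. norm (avg L F x - c) \<le> e" "\<And>x. norm (avg L F x - c') \<le> e"
    using is_mean_common[OF assms \<open>e > 0\<close>] by metis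
  then have "norm (avg L F 0 - c) \<le> e" "norm (avg L F 0 - c') \<le> e" by auto
  then have "norm (c - c') \<le> e + e"
    using norm_triangle_ineq4[of "avg L F 0 - c'" "avg L F 0 - c"] by (simp add: algebra_simps)
  then show False using \<open>e > 0\<close> by (simp add: e_def)
qed

lemma mean_eqI: "is_mean F c \<Longrightarrow> mean F = c"
  unfolding mean_def by (rule the_equality) (auto intro: is_mean_unique)

lemma is_mean_add:
  assumes "is_mean F c" "is_mean F' c'"
  shows "is_mean (\<lambda>x. F x + F' x) (c + c')"
  unfolding is_mean_def
proof (intro allI impI)
  fix e :: real assume "e > 0"
  then obtain L where L: "L \<noteq> []" "\<And>x. norm (avg L F x - c) \<le> e/2" "\<And>x. norm (avg L F' x - c') \<le> e/2"
    using is_mean_common[OF assms, of "e/2"] by auto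
  have "norm (avg L (\<lambda>x. F x + F' x) x - (c + c')) \<le> e/2 + e/2" for x
    unfolding avg_add add_diff_add by (rule norm_triangle_le) (intro add_mono L)
  then show "\<exists>L. L \<noteq> [] \<and> (\<forall>x. norm (avg L (\<lambda>x. F x + F' x) x - (c + c')) \<le> e)"
    using L(1) by auto
qed

lemma is_mean_bounded_linear:
  assumes "bounded_linear T" "is_mean F c"
  shows "is_mean (\<lambda>x. T (F x)) (T c)"
  unfolding is_mean_def
proof (intro allI impI)
  fix e :: real assume "e > 0"
  interpret bounded_linear T by fact
  obtain K where K: "K > 0" "\<And>x. norm (T x) \<le> norm x * K" using pos_bounded by auto
  obtain L where L: "L \<noteq> []" "\<And>x. norm (avg L F x - c) \<le> e / K"
    using assms(2) K(1) \<open>e > 0\<close> unfolding is_mean_def by (metis divide_pos_pos)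
  have "norm (avg L (\<lambda>x. T (F x)) x - T c) \<le> e" for x
  proof -
    have "norm (avg L (\<lambda>x. T (F x)) x - T c) = norm (T (avg L F x - c))"
      by (simp add: avg_linear[OF linear_axioms] diff)
    also have "\<dots> \<le> norm (avg L F x - c) * K" by (rule K)
    also have "\<dots> \<le> e" using L(2)[of x] K(1) by (simp add: field_simps)
    finally show ?thesis .
  qed
  then show "\<exists>L. L \<noteq> [] \<and> (\<forall>x. norm (avg L (\<lambda>x. T (F x)) x - T c) \<le> e)"
    using L(1) by auto
qed

lemma is_mean_const: "is_mean (\<lambda>x. c) c"
  unfolding is_mean_def by (intro allI impI exI[of _ "[0]"]) (simp add: avg_const)

lemma is_mean_translate: "is_mean F c \<Longrightarrow> is_mean (\<lambda>x. F (x + h)) c"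
  unfolding is_mean_def avg_translate by blast

lemma is_mean_uminus:
  assumes "is_mean F c"
  shows "is_mean (\<lambda>x. F (- x)) c"
proof -
  have "avg (map uminus L) (\<lambda>x. F (- x)) x = avg L F (- x)" for L x
    by (simp add: avg_def comp_def)
  then show ?thesis
    using assms unfolding is_mean_def by (metis map_is_Nil_conv)
qed

lemma norm_is_mean_le:
  assumes "is_mean F c" "is_mean (\<lambda>x. norm (F x)) d"
  shows "norm c \<le> d"
proof (rule field_le_epsilon)
  fix e :: real assume "e > 0"
  then obtain L where L: "L \<noteq> []" "\<And>x. norm (avg L F x - c) \<le> e/2"
      "\<And>x. norm (avg L (\<lambda>x. norm (F x)) x - d) \<le> e/2"
    using is_mean_common[OF assms, of "e/2"] by auto
  have "norm c \<le> norm (avg L F 0) + e/2"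
    using L(2)[of 0] norm_triangle_ineq4[of "avg L F 0" "avg L F 0 - c"] by simp
  also have "\<dots> \<le> avg L (\<lambda>x. norm (F x)) 0 + e/2" using norm_avg_le_avg_norm[of L F 0] by simp
  also have "\<dots> \<le> d + e" using L(3)[of 0] unfolding real_norm_def by linarith
  finally show "norm c \<le> d + e" .
qed

lemma is_mean_mono:
  fixes F F' :: "'g::ab_group_add \<Rightarrow> real"
  assumes "is_mean F c" "is_mean F' c'" "\<And>x. F x \<le> F' x"
  shows "c \<le> c'"
proof (rule field_le_epsilon)
  fix e :: real assume "e > 0"
  then obtain L where L: "L \<noteq> []" "\<And>x. norm (avg L F x - c) \<le> e/2" "\<And>x. norm (avg L F' x - c') \<le> e/2"
    using is_mean_common[OF assms(1,2), of "e/2"] by auto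
  have "avg L F 0 \<le> avg L F' 0" by (rule avg_mono[OF assms(3)])
  then show "c \<le> c' + e"
    using L(2)[of 0] L(3)[of 0] unfolding real_norm_def by linarith
qed

text \<open>Averaging over the first \<open>n\<close> multiples of \<open>k\<close> makes a bounded function nearly invariant
  under translation by \<open>k\<close>, and further averaging does not destroy this.\<close>

lemma avg_nearly_invariant:
  fixes F :: "'g::ab_group_add \<Rightarrow> 'y \<Rightarrow> 'e::real_normed_vector"
  assumes "finite K" "\<And>x y. norm (F x y) \<le> C" "e > 0"
  shows "\<exists>L. L \<noteq> [] \<and> (\<forall>k\<in>K. \<forall>x y. norm (avg L (\<lambda>x. F x y) (x + k) - avg L (\<lambda>x. F x y) x) \<le> e)"
  using assms(1)
proof (induction K)
  case empty
  show ?case by (intro exI[of _ "[0]"]) simp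
next
  case (insert k K)
  then obtain L where L: "L \<noteq> []"
    and LK: "\<And>k x y. k \<in> K \<Longrightarrow> norm (avg L (\<lambda>x. F x y) (x + k) - avg L (\<lambda>x. F x y) x) \<le> e"
    by auto
  \<comment> \<open>The average over \<open>n\<close> multiples of \<open>k\<close> telescopes to
    two values bounded by \<open>C\<close>, divided by \<open>n\<close>; hence the quantity
    \<open>2 * C / n\<close>.\<close>
  obtain n where n: "n > 0" "2 * C / real n \<le> e"
  proof -
    obtain n where "real n > max 1 (2 * C / e)" using reals_Archimedean2 by blast
    then show ?thesis using that[of n] assms(3) by (auto simp: field_simps)
  qed
  define s where "s i = (\<Sum>_<i. k)" for i :: nat
  define M where "M = map s [0..<n]"
  have M: "M \<noteq> []" using n by (simp add: M_def)
  have bnd: "norm (avg L (\<lambda>x. F x y) x) \<le> C" for x y by (rule norm_avg_le) (use assms L in auto)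
  have "norm (avg M (avg L (\<lambda>x. F x y)) (x + k') - avg M (avg L (\<lambda>x. F x y)) x) \<le> e"
    if "k' \<in> insert k K" for k' x y
  proof (cases "k' = k")
    case True
    let ?H = "avg L (\<lambda>x. F x y)"
    have "avg M ?H (x + k) - avg M ?H x = (\<Sum>i<n. ?H (x + s (Suc i)) - ?H (x + s i)) /\<^sub>R n"
      by (simp add: avg_def M_def comp_def interv_sum_list_conv_sum_set_nat s_def sum_subtractf
          atLeast0LessThan scaleR_diff_right algebra_simps)
    also have "\<dots> = (?H (x + s n) - ?H (x + s 0)) /\<^sub>R n"
      by (subst sum_lessThan_telescope[of "\<lambda>i. ?H (x + s i)"]) simp
    finally have "norm (avg M ?H (x + k) - avg M ?H x) = norm (?H (x + s n) - ?H (x + s 0)) / n"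
      by (simp add: divide_inverse mult.commute)
    also have "\<dots> \<le> (C + C) / n"
      by (intro divide_right_mono norm_triangle_le_diff add_mono bnd) auto
    also have "\<dots> \<le> e" using n by simp
    finally show ?thesis using True by simp
  next
    case False
    then have "k' \<in> K" using that by simp
    have "avg M (avg L (\<lambda>x. F x y)) (x + k') - avg M (avg L (\<lambda>x. F x y)) x
        = avg M (\<lambda>x. avg L (\<lambda>x. F x y) (x + k') - avg L (\<lambda>x. F x y) x) x"
      by (simp add: avg_diff avg_translate)
    then show ?thesis using norm_avg_le[of _ e M, OF LK[OF \<open>k' \<in> K\<close>] M] by simp
  qed
  then show ?case
    using L M unfolding avg_sum_all by (intro exI[of _ "sum_all M L"]) auto
qed

section \<open>Existence, continuity, Fubini's theorem and positivity of the mean on a compact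
  group\<close>

locale compact_group =
  fixes ty :: "'g::topological_ab_group_add itself"
  assumes compact_UNIV: "compact (UNIV :: 'g set)"
begin

lemma bounded_continuous:
  fixes F :: "'g \<Rightarrow> 'e::real_normed_vector"
  assumes "continuous_on UNIV F"
  obtains C where "C \<ge> 0" "\<And>x. norm (F x) \<le> C"
proof -
  have "bounded (range F)" by (intro compact_imp_bounded compact_continuous_image compact_UNIV assms)
  then obtain C where "\<And>x. norm (F x) \<le> C" unfolding bounded_iff by auto
  moreover from this[of 0] have "C \<ge> 0" using norm_ge_zero order_trans by blast
  ultimately show ?thesis using that by blast
qed

lemma tube:
  fixes F :: "'g \<Rightarrow> 'g \<Rightarrow> 'e::real_normed_vector"
  assumes "continuous_on UNIV (\<lambda>(x, y). F x y)" "e > 0"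
  obtains U where "open U" "x0 \<in> U" "\<And>x y. x \<in> U \<Longrightarrow> norm (F x y - F x0 y) \<le> e"
proof -
  have "continuous_on (UNIV \<times> UNIV) (\<lambda>(x, y). F x y)" using assms by simp
  from continuous_on_prod_compactE[OF this compact_UNIV UNIV_I assms(2), of x0]
  obtain U where U: "x0 \<in> U" "open U"
    "\<forall>x\<in>U \<inter> UNIV. \<forall>y\<in>UNIV. dist ((\<lambda>(x, y). F x y) (x, y)) ((\<lambda>(x, y). F x y) (x0, y)) \<le> e"
    by blast
  show ?thesis by (rule that[OF U(2,1)]) (use U(3) in \<open>simp add: dist_norm\<close>)
qed

text \<open>The second argument is a parameter in which the choice of translates is uniform; this
  uniformity gives Fubini's theorem for the mean.\<close>

lemma avg_nearly_constant:
  fixes F :: "'g \<Rightarrow> 'g \<Rightarrow> 'e::real_normed_vector"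
  assumes F: "continuous_on UNIV (\<lambda>(x, y). F x y)" and "e > 0"
  obtains L where "L \<noteq> []" "\<And>x x' y. norm (avg L (\<lambda>x. F x y) x - avg L (\<lambda>x. F x y) x') \<le> e"
proof -
  have "bounded ((\<lambda>(x, y). F x y) ` (UNIV \<times> UNIV))"
    by (intro compact_imp_bounded compact_continuous_image compact_Times compact_UNIV)
      (use F in auto)
  then obtain C where C: "\<And>x y. norm (F x y) \<le> C" unfolding bounded_iff by force
  \<comment> \<open>Translation is uniformly continuous: compactness in \<open>(x, y)\<close> yields
    a neighbourhood of \<open>g\<close> that works for all arguments at once.\<close>
  have net: "\<exists>U. open U \<and> g \<in> U \<and> (\<forall>h\<in>U. \<forall>x y. norm (F (x + h) y - F (x + g) y) \<le> e/2)" for g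
  proof -
    have cont: "continuous_on (UNIV \<times> (UNIV \<times> UNIV)) (\<lambda>(h, x, y). F (x + h) y)"
    proof -
      have "continuous_on UNIV (\<lambda>p :: 'g \<times> 'g \<times> 'g. (fst (snd p) + fst p, snd (snd p)))"
        by (intro continuous_intros)
      from continuous_on_compose2[OF F this] show ?thesis by (simp add: case_prod_beta)
    qed
    have "e/2 > 0" using assms(2) by simp
    from continuous_on_prod_compactE[OF cont compact_Times[OF compact_UNIV compact_UNIV] UNIV_I this, of g]
    obtain U where U: "g \<in> U" "open U"
      "\<forall>h\<in>U \<inter> UNIV. \<forall>p\<in>UNIV \<times> UNIV. dist ((\<lambda>(h, x, y). F (x + h) y) (h, p)) ((\<lambda>(h, x, y). F (x + h) y) (g, p)) \<le> e/2"
      by blast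
    then have "norm (F (x + h) y - F (x + g) y) \<le> e/2" if "h \<in> U" for h x y
      using that by (auto simp: dist_norm)
    then show ?thesis using U(1,2) by (intro exI[of _ U]) auto
  qed
  then obtain U where U: "\<And>g. open (U g)" "\<And>g. g \<in> U g"
      "\<And>g h x y. h \<in> U g \<Longrightarrow> norm (F (x + h) y - F (x + g) y) \<le> e/2"
    by metis
  have "UNIV \<subseteq> (\<Union>g\<in>UNIV. U g)" using U(2) by auto
  then obtain K where K: "finite K" "UNIV \<subseteq> (\<Union>g\<in>K. U g)"
    by (rule compactE_image[OF compact_UNIV U(1)])
  obtain L where L: "L \<noteq> []"
      "\<And>k x y. k \<in> K \<Longrightarrow> norm (avg L (\<lambda>x. F x y) (x + k) - avg L (\<lambda>x. F x y) x) \<le> e/2"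
    using avg_nearly_invariant[where F = F, OF K(1) C half_gt_zero[OF assms(2)]] by blast
  have "norm (avg L (\<lambda>x. F x y) x' - avg L (\<lambda>x. F x y) x) \<le> e" for x x' y
  proof -
    \<comment> \<open>Translation by \<open>x' - x\<close> differs by at most \<open>e/2\<close>
      from translation by some \<open>k\<close> in the finite net, and the average over
      \<open>L\<close> is nearly invariant under that \<open>k\<close>.\<close>
    obtain k where k: "k \<in> K" "x' - x \<in> U k" using K by blast
    have eq: "avg L (\<lambda>x. F x y) (x + h) - avg L (\<lambda>x. F x y) (x + k)
         = avg L (\<lambda>x. F (x + h) y - F (x + k) y) x" for h
      unfolding avg_diff by (simp only: avg_translate[of _ "\<lambda>x. F x y"])
    have "norm (avg L (\<lambda>x. F x y) (x + (x' - x)) - avg L (\<lambda>x. F x y) (x + k)) \<le> e/2"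
      unfolding eq by (rule norm_avg_le) (use U(3)[OF k(2)] L in auto)
    moreover have "norm (avg L (\<lambda>x. F x y) (x + k) - avg L (\<lambda>x. F x y) x) \<le> e/2" using L k by blast
    ultimately show ?thesis
      using norm_triangle_ineq[of "avg L (\<lambda>x. F x y) (x + (x' - x)) - avg L (\<lambda>x. F x y) (x + k)"
          "avg L (\<lambda>x. F x y) (x + k) - avg L (\<lambda>x. F x y) x"] by simp
  qed
  then show ?thesis using that L(1) by blast
qed

text \<open>Averages that vary by at most \<open>1 / Suc n\<close> have values at \<open>0\<close>
  forming a Cauchy sequence; completeness of the target space supplies the limit.\<close>

lemma is_mean_mean:
  fixes F :: "'g \<Rightarrow> 'e::banach"
  assumes F: "continuous_on UNIV F"
  shows "is_mean F (mean F)"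
proof -
  have cont: "continuous_on UNIV (\<lambda>(x, y::'g). F x)"
    unfolding case_prod_beta by (rule continuous_on_compose2[OF F]) (auto intro: continuous_intros)
  have "\<exists>L. L \<noteq> [] \<and> (\<forall>x x'. norm (avg L F x - avg L F x') \<le> 1 / real (Suc n))" for n
    by (rule avg_nearly_constant[OF cont, of "1 / real (Suc n)"]) auto
  then obtain L where L: "\<And>n. L n \<noteq> []"
      "\<And>n x x'. norm (avg (L n) F x - avg (L n) F x') \<le> 1 / real (Suc n)" by metis
  define c where "c n = avg (L n) F 0" for n
  have close: "norm (avg (L n) F x - c n) \<le> 1 / real (Suc n)" for n x using L(2) by (simp add: c_def)
  \<comment> \<open>Both constants are close to the same vector, the double average over
    \<open>L m\<close> and \<open>L n\<close> evaluated at \<open>0\<close>.\<close>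
  have cc: "norm (c m - c n) \<le> 1 / real (Suc m) + 1 / real (Suc n)" for m n
  proof -
    have 1: "norm (avg (L n) (avg (L m) F) 0 - c m) \<le> 1 / real (Suc m)"
      by (rule avg_close) (use close L in auto)
    have "norm (avg (L m) (avg (L n) F) 0 - c n) \<le> 1 / real (Suc n)"
      by (rule avg_close) (use close L in auto)
    with 1 show ?thesis unfolding avg_commute[of "L m"]
      using norm_triangle_ineq4[of "avg (L n) (avg (L m) F) 0 - c n" "avg (L n) (avg (L m) F) 0 - c m"]
      by simp
  qed
  have "Cauchy c"
  proof (rule metric_CauchyI)
    fix e :: real assume "e > 0"
    then obtain N where N: "1 / real (Suc N) < e / 2"
      by (metis half_gt_zero nat_approx_posE)
    show "\<exists>M. \<forall>m\<ge>M. \<forall>n\<ge>M. dist (c m) (c n) < e"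
    proof (intro exI[of _ N] allI impI)
      fix m n assume "N \<le> m" "N \<le> n"
      then have "1 / real (Suc m) \<le> 1 / real (Suc N)" "1 / real (Suc n) \<le> 1 / real (Suc N)"
        by (auto simp: field_simps)
      then show "dist (c m) (c n) < e" using cc[of m n] N by (simp add: dist_norm)
    qed
  qed
  then obtain l where l: "c \<longlonglongrightarrow> l" using Cauchy_convergent convergent_def by blast
  have "is_mean F l" unfolding is_mean_def
  proof (intro allI impI)
    fix e :: real assume "e > 0"
    obtain N where N: "1 / real (Suc N) < e / 2" by (metis \<open>e > 0\<close> half_gt_zero nat_approx_posE)
    obtain N' where N': "\<And>n. n \<ge> N' \<Longrightarrow> norm (c n - l) < e/2" using LIMSEQ_D[OF l] \<open>e > 0\<close> by (meson half_gt_zero)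
    define n where "n = max N N'"
    have "1 / real (Suc n) \<le> 1 / real (Suc N)" by (auto simp: field_simps n_def)
    then have "norm (avg (L n) F x - l) \<le> e" for x
      using N close[of n x] N'[of n] norm_triangle_ineq[of "avg (L n) F x - c n" "c n - l"]
      by (simp add: n_def)
    then show "\<exists>L. L \<noteq> [] \<and> (\<forall>x. norm (avg L F x - l) \<le> e)" using L by blast
  qed
  then show ?thesis using mean_eqI by metis
qed

lemma mean_add:
  fixes F F' :: "'g \<Rightarrow> 'e::banach"
  assumes "continuous_on UNIV F" "continuous_on UNIV F'"
  shows "mean (\<lambda>x. F x + F' x) = mean F + mean F'"
  using assms by (intro mean_eqI is_mean_add) (auto intro: is_mean_mean)

lemma mean_bounded_linear:
  fixes F :: "'g \<Rightarrow> 'e::banach"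
  assumes "bounded_linear T" "continuous_on UNIV F"
  shows "mean (\<lambda>x. T (F x)) = T (mean F)"
  by (rule mean_eqI[OF is_mean_bounded_linear[OF assms(1) is_mean_mean[OF assms(2)]]])

lemma mean_diff:
  fixes F F' :: "'g \<Rightarrow> 'e::banach"
  assumes "continuous_on UNIV F" "continuous_on UNIV F'"
  shows "mean (\<lambda>x. F x - F' x) = mean F - mean F'"
proof -
  have "mean (\<lambda>x. - F' x) = - mean F'"
    by (rule mean_bounded_linear[OF bounded_linear_minus[OF bounded_linear_ident] assms(2)])
  moreover have "mean (\<lambda>x. F x + - F' x) = mean F + mean (\<lambda>x. - F' x)"
    by (intro mean_add continuous_intros assms)
  ultimately show ?thesis by simp
qed

lemma mean_sum:
  fixes F :: "'i \<Rightarrow> 'g \<Rightarrow> 'e::banach"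
  assumes "\<And>i. i \<in> I \<Longrightarrow> continuous_on UNIV (F i)"
  shows "mean (\<lambda>x. \<Sum>i\<in>I. F i x) = (\<Sum>i\<in>I. mean (F i))"
  using assms
proof (induction I rule: infinite_finite_induct)
  case (insert i I)
  have "continuous_on UNIV (\<lambda>x. \<Sum>i\<in>I. F i x)" by (intro continuous_on_sum) (use insert in auto)
  with insert show ?case by (simp add: mean_add)
qed (auto intro!: mean_eqI is_mean_const)

lemma mean_const: "mean (\<lambda>x::'g. c) = c"
  by (rule mean_eqI[OF is_mean_const])

lemma mean_translate:
  fixes F :: "'g \<Rightarrow> 'e::banach"
  assumes "continuous_on UNIV F"
  shows "mean (\<lambda>x. F (x + h)) = mean F"
  by (rule mean_eqI[OF is_mean_translate[OF is_mean_mean[OF assms]]])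

lemma mean_uminus:
  fixes F :: "'g \<Rightarrow> 'e::banach"
  assumes "continuous_on UNIV F"
  shows "mean (\<lambda>x. F (- x)) = mean F"
  by (rule mean_eqI[OF is_mean_uminus[OF is_mean_mean[OF assms]]])

lemma mean_reflect:
  fixes F :: "'g \<Rightarrow> 'e::banach"
  assumes "continuous_on UNIV F"
  shows "mean (\<lambda>x. F (h - x)) = mean F"
proof -
  have "continuous_on UNIV (\<lambda>x. F (- x))"
    by (rule continuous_on_compose2[OF assms]) (auto intro!: continuous_intros)
  from mean_translate[OF this, of "- h"] show ?thesis using mean_uminus[OF assms] by simp
qed

lemma norm_mean_le_mean_norm:
  fixes F :: "'g \<Rightarrow> 'e::banach"
  assumes "continuous_on UNIV F"
  shows "norm (mean F) \<le> mean (\<lambda>x. norm (F x))"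
  by (rule norm_is_mean_le[OF is_mean_mean[OF assms] is_mean_mean[OF continuous_on_norm[OF assms]]])

lemma mean_mono:
  fixes F F' :: "'g \<Rightarrow> real"
  assumes "continuous_on UNIV F" "continuous_on UNIV F'" "\<And>x. F x \<le> F' x"
  shows "mean F \<le> mean F'"
  by (rule is_mean_mono[OF is_mean_mean[OF assms(1)] is_mean_mean[OF assms(2)] assms(3)])

lemma norm_mean_le:
  fixes F :: "'g \<Rightarrow> 'e::banach"
  assumes "continuous_on UNIV F" "\<And>x. norm (F x) \<le> C"
  shows "norm (mean F) \<le> C"
proof -
  have "mean (\<lambda>x. norm (F x)) \<le> mean (\<lambda>x::'g. C)"
    by (intro mean_mono continuous_intros assms)
  then show ?thesis using norm_mean_le_mean_norm[OF assms(1)] by (simp add: mean_const)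
qed

lemma continuous_on_param:
  fixes F :: "'g \<Rightarrow> 'g \<Rightarrow> 'e::real_normed_vector"
  assumes "continuous_on UNIV (\<lambda>(x, y). F x y)"
  shows "continuous_on UNIV (F x)" "continuous_on UNIV (\<lambda>x. F x y)"
proof -
  have "continuous_on UNIV (\<lambda>y. (x, y))" "continuous_on UNIV (\<lambda>x. (x, y))"
    by (intro continuous_intros)+
  from this[THEN continuous_on_compose2[OF assms]]
  show "continuous_on UNIV (F x)" "continuous_on UNIV (\<lambda>x. F x y)" by simp_all
qed

lemma continuous_on_mean:
  fixes F :: "'g \<Rightarrow> 'g \<Rightarrow> 'e::banach"
  assumes F: "continuous_on UNIV (\<lambda>(x, y). F x y)"
  shows "continuous_on UNIV (\<lambda>x. mean (F x))"
proof -
  have "((\<lambda>x. mean (F x)) \<longlongrightarrow> mean (F x0)) (at x0)" for x0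
  proof (rule tendstoI)
    fix e :: real assume "e > 0"
    obtain U where U: "open U" "x0 \<in> U" "\<And>x y. x \<in> U \<Longrightarrow> norm (F x y - F x0 y) \<le> e/2"
      by (rule tube[OF F half_gt_zero[OF \<open>e > 0\<close>], of x0]) blast
    have "dist (mean (F x)) (mean (F x0)) < e" if "x \<in> U" for x
    proof -
      have "norm (mean (F x) - mean (F x0)) \<le> e/2"
        unfolding mean_diff[OF continuous_on_param(1)[OF F] continuous_on_param(1)[OF F], symmetric]
        by (intro norm_mean_le continuous_intros continuous_on_param[OF F] U(3) that)
      then show ?thesis using \<open>e > 0\<close> by (simp add: dist_norm)
    qed
    then show "\<forall>\<^sub>F x in at x0. dist (mean (F x)) (mean (F x0)) < e"
      using U unfolding eventually_at_topological by blast
  qed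
  then show ?thesis by (simp add: continuous_on_def)
qed

text \<open>A list that makes \<open>F\<close> nearly constant in \<open>x\<close> for all
  \<open>y\<close> simultaneously approximates every inner mean within the same \<open>e\<close>.
  Finite averages commute with the mean in \<open>y\<close>, so that list also witnesses
  \<open>is_mean\<close> for the iterated mean.\<close>

lemma mean_Fubini:
  fixes F :: "'g \<Rightarrow> 'g \<Rightarrow> 'e::banach"
  assumes F: "continuous_on UNIV (\<lambda>(x, y). F x y)"
  shows "mean (\<lambda>x. mean (\<lambda>y. F x y)) = mean (\<lambda>y. mean (\<lambda>x. F x y))"
proof (rule mean_eqI)
  have F': "continuous_on UNIV (\<lambda>(y, x). F x y)"
    using continuous_on_compose2[OF F continuous_on_swap[of UNIV]]
    by (simp add: case_prod_beta)
  note c1 = continuous_on_param[OF F]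
  have m: "continuous_on UNIV (\<lambda>y. mean (\<lambda>x. F x y))" by (rule continuous_on_mean[OF F'])
  show "is_mean (\<lambda>x. mean (F x)) (mean (\<lambda>y. mean (\<lambda>x. F x y)))"
    unfolding is_mean_def
  proof (intro allI impI)
    fix e :: real assume "e > 0"
    obtain L where L: "L \<noteq> []" "\<And>x x' y. norm (avg L (\<lambda>x. F x y) x - avg L (\<lambda>x. F x y) x') \<le> e"
      using avg_nearly_constant[OF F \<open>e > 0\<close>] by blast
    \<comment> \<open>Near constancy names no value yet. Averaging over a second list
      \<open>L'\<close> moves the \<open>L\<close>-average by at most \<open>e\<close>, while in the
      other order the result is within \<open>d\<close> of the mean.\<close>
    have close: "norm (avg L (\<lambda>x. F x y) x - mean (\<lambda>x. F x y)) \<le> e" for x y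
    proof (rule field_le_epsilon)
      fix d :: real assume "d > 0"
      then obtain L' where L': "L' \<noteq> []" "\<And>x. norm (avg L' (\<lambda>x. F x y) x - mean (\<lambda>x. F x y)) \<le> d"
        using is_mean_mean[OF c1(2), of y] unfolding is_mean_def by blast
      have "norm (avg L' (avg L (\<lambda>x. F x y)) x - avg L (\<lambda>x. F x y) x) \<le> e"
        by (rule avg_close) (use L L' in auto)
      moreover have "norm (avg L (avg L' (\<lambda>x. F x y)) x - mean (\<lambda>x. F x y)) \<le> d"
        by (rule avg_close) (use L L' in auto)
      ultimately show "norm (avg L (\<lambda>x. F x y) x - mean (\<lambda>x. F x y)) \<le> e + d"
        unfolding avg_commute[of L']
        using norm_triangle_ineq4[of "avg L (avg L' (\<lambda>x. F x y)) x - mean (\<lambda>x. F x y)" "avg L (avg L' (\<lambda>x. F x y)) x - avg L (\<lambda>x. F x y) x"]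
        by simp
    qed
    have cavg: "continuous_on UNIV (\<lambda>y. avg M (\<lambda>x. F x y) x)"
        and mavg: "mean (\<lambda>y. avg M (\<lambda>x. F x y) x) = avg M (\<lambda>x. mean (F x)) x" for x M
    proof -
      have *: "continuous_on UNIV (\<lambda>y. \<Sum>g\<leftarrow>M. F (x + g) y)
        \<and> mean (\<lambda>y. \<Sum>g\<leftarrow>M. F (x + g) y) = (\<Sum>g\<leftarrow>M. mean (F (x + g)))"
        by (induction M) (auto simp: mean_add mean_const c1 intro!: continuous_intros)
      then show "continuous_on UNIV (\<lambda>y. avg M (\<lambda>x. F x y) x)"
        unfolding avg_def by (auto intro!: continuous_intros)
      show "mean (\<lambda>y. avg M (\<lambda>x. F x y) x) = avg M (\<lambda>x. mean (F x)) x"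
        unfolding avg_def using mean_bounded_linear[OF bounded_linear_scaleR_right] * by metis
    qed
    have "norm (avg L (\<lambda>x. mean (F x)) x - mean (\<lambda>y. mean (\<lambda>x. F x y))) \<le> e" for x
      unfolding mavg[symmetric] mean_diff[OF cavg m, symmetric]
      by (intro norm_mean_le continuous_intros cavg m close)
    then show "\<exists>L. L \<noteq> [] \<and> (\<forall>x. norm (avg L (\<lambda>x. mean (F x)) x - mean (\<lambda>y. mean (\<lambda>x. F x y))) \<le> e)"
      using L(1) by blast
  qed
qed

text \<open>Finitely many translates of the open set where \<open>F\<close> exceeds
  \<open>F x0 / 2\<close> cover the group, so the corresponding sum of translates of
  \<open>F\<close>, whose mean is a multiple of \<open>mean F\<close>, is bounded below by a
  positive constant.\<close>

lemma mean_pos: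
  fixes F :: "'g \<Rightarrow> real"
  assumes F: "continuous_on UNIV F" and "\<And>x. F x \<ge> 0" "F x0 > 0"
  shows "mean F > 0"
proof -
  define V where "V = {x. F x > F x0 / 2}"
  have V: "open V" unfolding V_def by (intro open_Collect_less continuous_on_const F)
  define W where "W g = (\<lambda>x. x + g) -` V" for g
  have W: "open (W g)" for g unfolding W_def
    by (rule open_vimage[OF V]) (auto intro!: continuous_intros)
  have "x \<in> W (x0 - x)" for x using assms(3) by (simp add: W_def V_def)
  then have "UNIV \<subseteq> (\<Union>g\<in>UNIV. W g)" by auto
  then obtain K where K: "finite K" "UNIV \<subseteq> (\<Union>g\<in>K. W g)"
    by (rule compactE_image[OF compact_UNIV W])
  have tr: "continuous_on UNIV (\<lambda>x. F (x + g))" for g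
    by (rule continuous_on_compose2[OF F]) (auto intro!: continuous_intros)
  have "F x0 / 2 \<le> (\<Sum>g\<in>K. F (x + g))" for x
  proof -
    obtain g where g: "g \<in> K" "x \<in> W g" using K by blast
    have "F x0 / 2 \<le> F (x + g)" using g by (simp add: W_def V_def)
    also have "\<dots> \<le> (\<Sum>g\<in>K. F (x + g))" by (rule member_le_sum) (use g K assms in auto)
    finally show ?thesis .
  qed
  then have "mean (\<lambda>x::'g. F x0 / 2) \<le> mean (\<lambda>x. \<Sum>g\<in>K. F (x + g))"
    by (intro mean_mono continuous_intros tr)
  also have "\<dots> = real (card K) * mean F" by (subst mean_sum) (auto simp: tr mean_translate[OF F])
  finally have "0 < real (card K) * mean F" using assms(3) by (simp add: mean_const)
  then show ?thesis by (simp add: zero_less_mult_iff)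
qed

end

section \<open>Convolution and its L2-estimates\<close>

section \<open>Characters of compact abelian groups\<close>

abbreviation cont :: "('g::topological_space \<Rightarrow> 'e::topological_space) \<Rightarrow> bool" where
  "cont f \<equiv> continuous_on UNIV f"

lemma cont_comp: "cont f \<Longrightarrow> continuous_on S k \<Longrightarrow> continuous_on S (\<lambda>x. f (k x))"
  by (rule continuous_on_compose2) auto

definition conv :: "('g::ab_group_add \<Rightarrow> complex) \<Rightarrow> ('g \<Rightarrow> complex) \<Rightarrow> 'g \<Rightarrow> complex" where
  "conv f h x = mean (\<lambda>y. f y * h (x - y))"

text \<open>Under this condition the kernel \<open>f (x - y)\<close> is hermitian, so convolution by
  \<open>f\<close> is a self-adjoint operator.\<close>

definition hermitian :: "('g::ab_group_add \<Rightarrow> complex) \<Rightarrow> bool" where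
  "hermitian f \<longleftrightarrow> (\<forall>x. f (- x) = cnj (f x))"

text \<open>The square of the L2-norm. Without the root it is the value \<open>conv f f 0\<close>
  for hermitian \<open>f\<close>, hence additive when an idempotent is split into two.\<close>

definition nrm2 :: "('g::ab_group_add \<Rightarrow> complex) \<Rightarrow> real" where
  "nrm2 f = mean (\<lambda>x. (cmod (f x))\<^sup>2)"

context compact_group
begin

lemma mean_cmult: "cont F \<Longrightarrow> mean (\<lambda>x. c * F x) = c * mean F" for F :: "'g \<Rightarrow> complex"
  by (rule mean_bounded_linear[OF bounded_linear_mult_right])

lemma mean_multc: "cont F \<Longrightarrow> mean (\<lambda>x. F x * c) = mean F * c" for F :: "'g \<Rightarrow> complex"
  by (rule mean_bounded_linear[OF bounded_linear_mult_left])

lemma mean_cnj: "cont F \<Longrightarrow> mean (\<lambda>x. cnj (F x)) = cnj (mean F)" for F :: "'g \<Rightarrow> complex"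
  by (rule mean_bounded_linear[OF bounded_linear_cnj])

lemma mean_of_real: "cont F \<Longrightarrow> mean (\<lambda>x. complex_of_real (F x)) = of_real (mean F)"
  for F :: "'g \<Rightarrow> real"
  by (rule mean_bounded_linear[OF bounded_linear_of_real])

lemma mean_mult_real: "cont F \<Longrightarrow> mean (\<lambda>x. c * F x) = c * mean F" for F :: "'g \<Rightarrow> real"
  by (rule mean_bounded_linear[OF bounded_linear_mult_right])

lemma mean_tendsto:
  fixes F :: "'i \<Rightarrow> 'g \<Rightarrow> 'e::banach"
  assumes u: "uniform_limit UNIV F P net" and F: "\<And>i. cont (F i)" and P: "cont P"
  shows "((\<lambda>i. mean (F i)) \<longlongrightarrow> mean P) net"
proof (rule tendstoI)
  fix e :: real assume e: "e > 0"
  from uniform_limitD[OF u half_gt_zero[OF e]]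
  show "\<forall>\<^sub>F i in net. dist (mean (F i)) (mean P) < e"
  proof eventually_elim
    case (elim i)
    have "norm (mean (F i) - mean P) \<le> e/2"
      unfolding mean_diff[OF F P, symmetric]
      by (intro norm_mean_le continuous_on_diff F P) (use elim in \<open>auto simp: dist_norm less_imp_le\<close>)
    then show ?case using e by (simp add: dist_norm)
  qed
qed

lemma cont_conv_integrand:
  fixes f h :: "'g \<Rightarrow> complex"
  assumes "cont f" "cont h"
  shows "cont (\<lambda>y. f y * h (x - y))"
  by (intro continuous_intros cont_comp[OF assms(1)] cont_comp[OF assms(2)])

lemma cont_conv:
  fixes f h :: "'g \<Rightarrow> complex"
  assumes "cont f" "cont h"
  shows "cont (conv f h)"
proof -
  have "cont (\<lambda>(x, y). f y * h (x - y))"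
    unfolding case_prod_beta
    by (intro continuous_intros cont_comp[OF assms(1)] cont_comp[OF assms(2)])
  from continuous_on_mean[OF this] show ?thesis by (simp add: conv_def[abs_def])
qed

lemma conv_commute:
  fixes f h :: "'g \<Rightarrow> complex"
  assumes "cont f" "cont h"
  shows "conv f h = conv h f"
proof
  fix x
  show "conv f h x = conv h f x"
    unfolding conv_def
    using mean_reflect[OF cont_conv_integrand[OF assms, of x], of x] by (simp add: mult.commute)
qed

lemma conv_assoc:
  fixes f g h :: "'g \<Rightarrow> complex"
  assumes f: "cont f" and g: "cont g" and h: "cont h"
  shows "conv (conv f g) h = conv f (conv g h)"
proof
  fix x
  have c2: "cont (\<lambda>(y, z). f z * g (y - z) * h (x - y))"
    unfolding case_prod_beta
    by (intro continuous_intros cont_comp[OF f] cont_comp[OF g] cont_comp[OF h])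
  have c3: "cont (\<lambda>y. g (y - z) * h (x - y))" for z
    by (intro continuous_intros cont_comp[OF g] cont_comp[OF h])
  have "conv (conv f g) h x = mean (\<lambda>y. mean (\<lambda>z. f z * g (y - z) * h (x - y)))"
    unfolding conv_def by (simp add: mean_multc cont_conv_integrand f g)
  also have "\<dots> = mean (\<lambda>z. mean (\<lambda>y. f z * g (y - z) * h (x - y)))"
    by (rule mean_Fubini[OF c2])
  also have "\<dots> = mean (\<lambda>z. f z * mean (\<lambda>y. g (y - z) * h (x - y)))"
    by (simp add: mult.assoc mean_cmult c3)
  also have "\<dots> = mean (\<lambda>z. f z * mean (\<lambda>y. g y * h (x - z - y)))"
  proof -
    have "mean (\<lambda>y. g (y - z) * h (x - y)) = mean (\<lambda>y. g y * h (x - z - y))" for z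
      using mean_translate[OF c3[of z], of z] by (simp add: algebra_simps)
    then show ?thesis by simp
  qed
  finally show "conv (conv f g) h x = conv f (conv g h) x" by (simp add: conv_def)
qed

lemma conv_add_right:
  fixes f h h' :: "'g \<Rightarrow> complex"
  assumes "cont f" "cont h" "cont h'"
  shows "conv f (\<lambda>x. h x + h' x) = (\<lambda>x. conv f h x + conv f h' x)"
  unfolding conv_def using mean_add[OF cont_conv_integrand cont_conv_integrand] assms
  by (simp add: distrib_left)

lemma conv_diff_right:
  fixes f h h' :: "'g \<Rightarrow> complex"
  assumes "cont f" "cont h" "cont h'"
  shows "conv f (\<lambda>x. h x - h' x) = (\<lambda>x. conv f h x - conv f h' x)"
  unfolding conv_def using mean_diff[OF cont_conv_integrand cont_conv_integrand] assms
  by (simp add: right_diff_distrib)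

lemma conv_zero_right: "conv f (\<lambda>x::'g. 0) = (\<lambda>x. 0)"
  by (simp add: conv_def mean_const fun_eq_iff)

lemma conv_cmult_right:
  fixes f h :: "'g \<Rightarrow> complex"
  assumes "cont f" "cont h"
  shows "conv f (\<lambda>x. c * h x) = (\<lambda>x. c * conv f h x)"
  unfolding conv_def using mean_cmult[OF cont_conv_integrand] assms
  by (simp add: mult.left_commute)

lemma conv_diff_left:
  fixes f h h' :: "'g \<Rightarrow> complex"
  assumes "cont f" "cont h" "cont h'"
  shows "conv (\<lambda>x. h x - h' x) f = (\<lambda>x. conv h f x - conv h' f x)"
  using conv_diff_right[OF assms] conv_commute assms by (metis continuous_on_diff)

lemma conv_cmult_left:
  fixes f h :: "'g \<Rightarrow> complex"
  assumes "cont f" "cont h"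
  shows "conv (\<lambda>x. c * h x) f = (\<lambda>x. c * conv h f x)"
  using conv_cmult_right[OF assms] conv_commute assms by (metis continuous_on_mult_left)

lemma hermitian_conv:
  fixes f h :: "'g \<Rightarrow> complex"
  assumes "cont f" "cont h" "hermitian f" "hermitian h"
  shows "hermitian (conv f h)"
  unfolding hermitian_def
proof
  fix x
  have "conv f h (- x) = mean (\<lambda>y. f (- y) * h (- (x - y)))"
    unfolding conv_def using mean_uminus[OF cont_conv_integrand[OF assms(1,2), of "- x"]] by simp
  also have "\<dots> = mean (\<lambda>y. cnj (f y * h (x - y)))"
    using assms(3,4) unfolding hermitian_def by (simp del: minus_diff_eq)
  also have "\<dots> = cnj (conv f h x)"
    unfolding conv_def by (rule mean_cnj[OF cont_conv_integrand[OF assms(1,2)]])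
  finally show "conv f h (- x) = cnj (conv f h x)" .
qed

lemma hermitian_diff: "hermitian f \<Longrightarrow> hermitian h \<Longrightarrow> hermitian (\<lambda>x. f x - h x)"
  by (simp add: hermitian_def)

lemma hermitian_real_mult: "hermitian f \<Longrightarrow> hermitian (\<lambda>x. complex_of_real c * f x)"
  by (simp add: hermitian_def)

lemma conv_self_0:
  fixes f :: "'g \<Rightarrow> complex"
  assumes "cont f" "hermitian f"
  shows "conv f f 0 = of_real (nrm2 f)"
proof -
  have "conv f f 0 = mean (\<lambda>y. complex_of_real ((cmod (f y))\<^sup>2))"
    using assms(2) unfolding conv_def hermitian_def by (simp add: complex_norm_square del: of_real_power)
  also have "\<dots> = of_real (nrm2 f)"
    unfolding nrm2_def by (intro mean_of_real continuous_intros assms)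
  finally show ?thesis .
qed

lemma nrm2_nonneg: "cont f \<Longrightarrow> nrm2 f \<ge> 0" for f :: "'g \<Rightarrow> complex"
  using mean_mono[of "\<lambda>x. 0" "\<lambda>x. (cmod (f x))\<^sup>2"] unfolding nrm2_def
  by (simp add: mean_const continuous_on_power continuous_on_norm)

lemma nrm2_pos:
  fixes f :: "'g \<Rightarrow> complex"
  assumes "cont f" "f x \<noteq> 0"
  shows "nrm2 f > 0"
  unfolding nrm2_def by (rule mean_pos[of _ x]) (use assms in \<open>auto intro!: continuous_intros\<close>)

lemma nrm2_translate: "cont f \<Longrightarrow> nrm2 (\<lambda>x. f (x + g)) = nrm2 f" for f :: "'g \<Rightarrow> complex"
  unfolding nrm2_def using mean_translate[of "\<lambda>x. (cmod (f x))\<^sup>2" g]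
  by (simp add: continuous_on_power continuous_on_norm)

lemma nrm2_cmult: "cont f \<Longrightarrow> nrm2 (\<lambda>x. c * f x) = (cmod c)\<^sup>2 * nrm2 f" for f :: "'g \<Rightarrow> complex"
  unfolding nrm2_def norm_mult power_mult_distrib
  by (intro mean_mult_real continuous_intros)

lemma mean_Cauchy_Schwarz:
  fixes f h :: "'g \<Rightarrow> complex"
  assumes f: "cont f" and h: "cont h"
  shows "mean (\<lambda>x. cmod (f x) * cmod (h x)) \<le> sqrt (nrm2 f * nrm2 h)"
proof -
  define m where "m = mean (\<lambda>x. cmod (f x) * cmod (h x))"
  have c: "cont (\<lambda>x. (cmod (f x))\<^sup>2)" "cont (\<lambda>x. (cmod (h x))\<^sup>2)" "cont (\<lambda>x. cmod (f x) * cmod (h x))"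
    by (intro continuous_intros f h)+
  have quad: "0 \<le> nrm2 f - 2 * t * m + t\<^sup>2 * nrm2 h" for t
  proof -
    have "mean (\<lambda>x::'g. 0::real) \<le> mean (\<lambda>x. (cmod (f x) - t * cmod (h x))\<^sup>2)"
      by (intro mean_mono continuous_intros f h) auto
    also have "(\<lambda>x. (cmod (f x) - t * cmod (h x))\<^sup>2)
        = (\<lambda>x. (cmod (f x))\<^sup>2 - (2 * t) * (cmod (f x) * cmod (h x)) + t\<^sup>2 * (cmod (h x))\<^sup>2)"
      by (auto simp: power2_eq_square algebra_simps)
    also have "mean \<dots> = nrm2 f - 2 * t * m + t\<^sup>2 * nrm2 h"
      using c unfolding nrm2_def m_def
      by (simp add: mean_add mean_diff mean_mult_real continuous_on_diff continuous_on_mult_left)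
    finally show ?thesis by (simp add: mean_const)
  qed
  have "m\<^sup>2 \<le> nrm2 f * nrm2 h"
  proof (cases "nrm2 h = 0")
    \<comment> \<open>The minimising \<open>t\<close> of the quadratic does not exist here; strict
      positivity of the mean forces \<open>h = 0\<close> instead.\<close>
    case True
    then have "h x = 0" for x using nrm2_pos[OF h, of x] by auto
    then have "m = 0" by (simp add: m_def mean_const)
    then show ?thesis using True by simp
  next
    case False
    then have pos: "nrm2 h > 0" using nrm2_nonneg[OF h] by simp
    \<comment> \<open>The quadratic in \<open>t\<close> is minimal at
      \<open>t = m / nrm2 h\<close>.\<close>
    have "0 \<le> (nrm2 f - 2 * (m / nrm2 h) * m + (m / nrm2 h)\<^sup>2 * nrm2 h) * nrm2 h"
      using quad[of "m / nrm2 h"] pos by (intro mult_nonneg_nonneg) auto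
    also have "\<dots> = nrm2 f * nrm2 h - m\<^sup>2" using pos by (simp add: field_simps power2_eq_square)
    finally show ?thesis by simp
  qed
  then show ?thesis unfolding m_def by (rule real_le_rsqrt)
qed

text \<open>Cauchy-Schwarz, as reflection and translation preserve \<open>nrm2\<close>. Convolution
  with a fixed function thereby turns L2-convergence into uniform convergence.\<close>

lemma norm_conv_le:
  fixes f h :: "'g \<Rightarrow> complex"
  assumes f: "cont f" and h: "cont h"
  shows "cmod (conv f h x) \<le> sqrt (nrm2 f * nrm2 h)"
proof -
  have h': "cont (\<lambda>y. h (x - y))" by (intro cont_comp[OF h] continuous_intros)
  have n: "nrm2 (\<lambda>y. h (x - y)) = nrm2 h"
    unfolding nrm2_def using mean_reflect[of "\<lambda>x. (cmod (h x))\<^sup>2" x]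
    by (simp add: continuous_on_power continuous_on_norm h)
  have "cmod (conv f h x) \<le> mean (\<lambda>y. cmod (f y) * cmod (h (x - y)))"
    unfolding conv_def using norm_mean_le_mean_norm[OF cont_conv_integrand[OF f h, of x]]
    by (simp add: norm_mult)
  also have "\<dots> \<le> sqrt (nrm2 f * nrm2 h)" using mean_Cauchy_Schwarz[OF f h'] n by simp
  finally show ?thesis .
qed

lemma conv_tendsto:
  fixes h P :: "'g \<Rightarrow> complex"
  assumes u: "uniform_limit UNIV F P net" and F: "\<And>i. cont (F i)" and P: "cont P" and h: "cont h"
  shows "((\<lambda>i. conv h (F i) x) \<longlongrightarrow> conv h P x) net"
  unfolding conv_def
proof (rule mean_tendsto)
  obtain C where C: "C \<ge> 0" "\<And>y. cmod (h y) \<le> C" using bounded_continuous[OF h] by blast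
  show "uniform_limit UNIV (\<lambda>i y. h y * F i (x - y)) (\<lambda>y. h y * P (x - y)) net"
  proof (rule uniform_limitI)
    fix e :: real assume e: "e > 0"
    \<comment> \<open>\<open>C\<close> may be \<open>0\<close>, hence \<open>C + 1\<close> in the
      denominator.\<close>
    then have "e / (C + 1) > 0" using C by simp
    from uniform_limitD[OF u this]
    show "\<forall>\<^sub>F i in net. \<forall>y\<in>UNIV. dist (h y * F i (x - y)) (h y * P (x - y)) < e"
    proof eventually_elim
      case (elim i)
      show ?case
      proof
        fix y
        have "dist (h y * F i (x - y)) (h y * P (x - y)) = cmod (h y) * dist (F i (x - y)) (P (x - y))"
          by (simp add: dist_norm norm_mult right_diff_distrib[symmetric])
        also have "\<dots> \<le> C * (e / (C + 1))"
          using C elim by (intro mult_mono) (auto simp: less_imp_le)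
        also have "\<dots> < e" using C e by (simp add: field_simps)
        finally show "dist (h y * F i (x - y)) (h y * P (x - y)) < e" .
      qed
    qed
  qed
qed (intro cont_conv_integrand F P h)+

section \<open>Convolution powers and the top spectral projection\<close>

fun cpow :: "('g \<Rightarrow> complex) \<Rightarrow> nat \<Rightarrow> 'g \<Rightarrow> complex" where
  "cpow R 0 = R"
| "cpow R (Suc n) = conv R (cpow R n)"

lemma cont_cpow: "cont R \<Longrightarrow> cont (cpow R n)"
  by (induction n) (auto intro: cont_conv)

lemma hermitian_cpow: "cont R \<Longrightarrow> hermitian R \<Longrightarrow> hermitian (cpow R n)"
  by (induction n) (auto intro!: hermitian_conv cont_cpow)

lemma conv_cpow: "cont R \<Longrightarrow> conv (cpow R m) (cpow R n) = cpow R (m + n + 1)"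
  by (induction m) (simp_all add: conv_assoc cont_cpow)

text \<open>The convolution operator of \<open>R\<close> is Hilbert--Schmidt, so \<open>\<parallel>R\<^sup>n\<parallel>\<^sup>2\<close> is the sum of the
  \<open>2n\<close>-th powers of its eigenvalues. The limit of the ratios \<open>\<parallel>R\<^sup>n\<^sup>+\<^sup>1\<parallel>\<^sup>2 / \<parallel>R\<^sup>n\<parallel>\<^sup>2\<close> is
  the top eigenvalue \<open>\<lambda>\<close> of \<open>R\<^sup>2\<close>, and \<open>R\<^sup>2\<^sup>n / \<lambda>\<^sup>n\<close> converges to the corresponding
  spectral projection. Note that \<open>cpow R n\<close> is the convolution power with exponent \<open>n + 1\<close>.\<close>

lemma top_idempotent:
  fixes R :: "'g \<Rightarrow> complex"
  assumes R: "cont R" "hermitian R" "R x0 \<noteq> 0"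
  obtains P lam where "lam > 0" "cont P" "hermitian P" "conv P P = P" "P 0 \<noteq> 0"
    "conv (conv R R) P = (\<lambda>x. complex_of_real lam * P x)"
proof -
  define p where "p = cpow R"
  have cp: "cont (p n)" and hp: "hermitian (p n)" and pp: "conv (p m) (p n) = p (m + n + 1)" for m n
    unfolding p_def using R by (auto intro: cont_cpow hermitian_cpow simp: conv_cpow)
  define t where "t n = nrm2 (p n)" for n
  \<comment> \<open>Exponents are shifted by one: \<open>p n\<close> is the power with exponent
    \<open>n + 1\<close>, so its convolution square is \<open>p (2 * n + 1)\<close>.\<close>
  have t: "p (2 * n + 1) 0 = of_real (t n)" for n
    using conv_self_0[OF cp hp, of n] pp[of n n] by (simp add: t_def mult_2)
  have t_nonneg: "t n \<ge> 0" for n unfolding t_def by (rule nrm2_nonneg[OF cp])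
  \<comment> \<open>Cauchy-Schwarz makes \<open>t\<close> log-convex; therefore its successive
    ratios increase, and a zero of \<open>t\<close> would propagate backwards.\<close>
  have logconv: "t (n + 1) \<le> sqrt (t n * t (n + 2))" for n
  proof -
    have "conv (p n) (p (n + 2)) 0 = of_real (t (n + 1))"
      using t[of "n + 1"] pp[of n "n + 2"] by (simp add: mult_2)
    then show ?thesis
      using norm_conv_le[OF cp cp, of n "n + 2" 0] t_nonneg by (simp add: t_def)
  qed
  have sup: "cmod (p (2 * n + 1) x) \<le> t n" for n x
    using norm_conv_le[OF cp cp, of n n x] t_nonneg[of n] pp[of n n]
    by (simp add: t_def mult_2)
  \<comment> \<open>The supremum bound for even powers gives submultiplicativity, which bounds the
    ratios by \<open>t 0\<close> and later keeps \<open>t n / lam ^ (n + 1)\<close> at least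
    1.\<close>
  have submult: "t (n + m + 1) \<le> t n * t m" for n m
  proof -
    have "conv (p (2 * n + 1)) (p (2 * m + 1)) 0 = of_real (t (n + m + 1))"
      using t[of "n + m + 1"] pp[of "2 * n + 1" "2 * m + 1"] by (simp add: algebra_simps)
    moreover have "cmod (conv (p (2 * n + 1)) (p (2 * m + 1)) 0) \<le> t n * t m"
      unfolding conv_def
      by (intro norm_mean_le cont_conv_integrand cp)
        (unfold norm_mult, intro mult_mono sup t_nonneg norm_ge_zero)
    ultimately show ?thesis using t_nonneg by simp
  qed
  have t_pos: "t n > 0 \<and> t (n + 1) > 0" for n
  proof (induction n)
    case 0
    have 1: "t 0 > 0" using nrm2_pos[OF R(1,3)] by (simp add: t_def p_def)
    then have "p 1 0 \<noteq> 0" using t[of 0] by simp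
    from nrm2_pos[OF cp this] 1 show ?case by (simp add: t_def)
  next
    case (Suc n)
    have "t (n + 2) \<noteq> 0" using logconv[of n] Suc by (intro notI) simp
    then show ?case using Suc t_nonneg[of "n + 2"] by simp
  qed
  define r where "r n = t (n + 1) / t n" for n
  have r_pos: "r n > 0" for n using t_pos[of n] by (simp add: r_def)
  have "incseq r"
  proof (rule incseq_SucI)
    fix n
    have "(t (n + 1))\<^sup>2 \<le> t n * t (n + 2)"
      using logconv[of n] t_nonneg by (metis mult_nonneg_nonneg power_mono real_sqrt_pow2)
    then show "r n \<le> r (Suc n)"
      using t_pos[of n] t_pos[of "n + 1"] by (simp add: r_def field_simps power2_eq_square)
  qed
  have r_bound: "r n \<le> t 0" for n
    using submult[of n 0] t_pos[of n] by (simp add: r_def field_simps)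
  obtain lam where lam: "r \<longlonglongrightarrow> lam" "\<And>n. r n \<le> lam"
    using incseq_convergent[OF \<open>incseq r\<close>, of "t 0"] r_bound by blast
  have lam_pos: "lam > 0" using r_pos[of 0] lam(2)[of 0] by simp
  have geom: "t N * r N ^ k \<le> t (N + k)" for N k
  proof (induction k)
    case (Suc k)
    have "t N * r N ^ Suc k = (t N * r N ^ k) * r N" by simp
    also have "\<dots> \<le> t (N + k) * r (N + k)"
      using Suc incseqD[OF \<open>incseq r\<close>, of N "N + k"] r_pos[of N] t_nonneg by (intro mult_mono) auto
    also have "\<dots> = t (N + Suc k)" using t_pos[of "N + k"] by (simp add: r_def)
    finally show ?case .
  qed simp
  \<comment> \<open>From index \<open>N\<close> on, \<open>t\<close> grows at least geometrically
    with ratio \<open>r N\<close>, whereas \<open>submult\<close> allows a factor of at most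
    \<open>t n\<close> over \<open>n + 1\<close> steps; then \<open>N\<close> tends to
    infinity.\<close>
  have t_ge: "lam ^ (n + 1) \<le> t n" for n
  proof (rule LIMSEQ_le_const2)
    show "(\<lambda>N. r N ^ (n + 1)) \<longlonglongrightarrow> lam ^ (n + 1)" by (intro tendsto_intros lam)
    have "r N ^ (n + 1) \<le> t n" for N
    proof -
      have "t N * r N ^ (n + 1) \<le> t N * t n"
        using geom[of N "n + 1"] submult[of N n] by simp
      then show ?thesis using t_pos[of N] by simp
    qed
    then show "\<exists>N. \<forall>k\<ge>N. r k ^ (n + 1) \<le> t n" by blast
  qed
  \<comment> \<open>The value at \<open>0\<close> of the normalised power \<open>Q n\<close>. Being
    at least 1 and decreasing, it has a nonzero limit, which becomes \<open>P 0\<close>.\<close>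
  define v where "v n = t n / lam ^ (n + 1)" for n
  have v_ge: "v n \<ge> 1" for n using t_ge[of n] lam_pos by (simp add: v_def)
  have "decseq v"
  proof (rule decseq_SucI)
    fix n
    have "t (n + 1) \<le> lam * t n" using lam(2)[of n] t_pos[of n] by (simp add: r_def field_simps)
    then show "v (Suc n) \<le> v n" using lam_pos by (simp add: v_def field_simps)
  qed
  obtain v0 where v0: "v \<longlonglongrightarrow> v0" using decseq_convergent[OF \<open>decseq v\<close>, of 1] v_ge by blast
  have v0_ge: "v0 \<ge> 1" by (rule LIMSEQ_le_const[OF v0]) (use v_ge in auto)
  \<comment> \<open>Only even powers of \<open>R\<close> occur: they are powers of the positive
    kernel \<open>conv R R\<close>, so negative eigenvalues of \<open>R\<close> cause no
    oscillation.\<close>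
  define Q where "Q n x = complex_of_real (1 / lam ^ (n + 1)) * p (2 * n + 1) x" for n x
  have cQ: "cont (Q n)" for n unfolding Q_def[abs_def] by (intro continuous_intros cp)
  have hQ: "hermitian (Q n)" for n unfolding Q_def[abs_def] by (intro hermitian_real_mult hp)
  have QQ: "conv (Q n) (Q m) = Q (n + m + 1)" for n m
  proof -
    have e: "2 * n + 1 + (2 * m + 1) + 1 = 2 * (n + m + 1) + 1" by simp
    have "conv (Q n) (Q m) = (\<lambda>x. complex_of_real (1 / lam ^ (m + 1)) *
        (complex_of_real (1 / lam ^ (n + 1)) * p (2 * (n + m + 1) + 1) x))"
      unfolding Q_def[abs_def]
      by (simp only: conv_cmult_right conv_cmult_left continuous_on_mult_left cp pp e)
    then show ?thesis by (simp add: fun_eq_iff Q_def power_add)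
  qed
  have Q0: "Q n 0 = of_real (v n)" for n by (simp add: Q_def t[simplified] v_def)
  \<comment> \<open>The squared distance is a kind of second difference of \<open>v\<close>, so
    convergence of \<open>v\<close> makes \<open>Q\<close> Cauchy in L2.\<close>
  have nrmQ: "nrm2 (\<lambda>x. Q n x - Q m x) = v (2 * n + 1) - 2 * v (n + m + 1) + v (2 * m + 1)" for n m
  proof -
    have "complex_of_real (nrm2 (\<lambda>x. Q n x - Q m x)) = conv (\<lambda>x. Q n x - Q m x) (\<lambda>x. Q n x - Q m x) 0"
      by (intro conv_self_0[symmetric] continuous_intros hermitian_diff cQ hQ)
    also have "\<dots> = of_real (v (2 * n + 1)) - 2 * of_real (v (n + m + 1)) + of_real (v (2 * m + 1))"
    proof -
      have e: "n + n + 1 = 2 * n + 1" "m + n + 1 = n + m + 1" "m + m + 1 = 2 * m + 1" by auto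
      show ?thesis
        unfolding conv_diff_left[OF continuous_on_diff[OF cQ cQ] cQ cQ] conv_diff_right[OF cQ cQ cQ] QQ Q0 e
        by (simp only: mult_2) (simp only: algebra_simps)
    qed
    also have "\<dots> = of_real (v (2 * n + 1) - 2 * v (n + m + 1) + v (2 * m + 1))" by simp
    finally show ?thesis using of_real_eq_iff by blast
  qed
  \<comment> \<open>One more convolution with \<open>Q 0\<close> upgrades the L2-estimate to a
    uniform one.\<close>
  have key: "cmod (Q (n + 1) x - Q (m + 1) x)
      \<le> sqrt (nrm2 (Q 0) * (v (2 * n + 1) - 2 * v (n + m + 1) + v (2 * m + 1)))" for n m x
  proof -
    have "conv (Q 0) (\<lambda>x. Q n x - Q m x) x = Q (n + 1) x - Q (m + 1) x"
      using QQ[of 0] by (simp add: conv_diff_right cQ)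
    then show ?thesis
      using norm_conv_le[OF cQ[of 0] continuous_on_diff[OF cQ[of n] cQ[of m]], of x] by (simp add: nrmQ)
  qed
  have "uniformly_convergent_on UNIV (\<lambda>n. Q (n + 1))"
  proof (rule Cauchy_uniformly_convergent, rule uniformly_Cauchy_onI)
    fix e :: real assume e: "e > 0"
    define d where "d = e\<^sup>2 / (nrm2 (Q 0) + 1)"
    have nq: "nrm2 (Q 0) \<ge> 0" by (rule nrm2_nonneg[OF cQ])
    have d: "d > 0" using e nq by (simp add: d_def)
    obtain N where N: "\<And>n. n \<ge> N \<Longrightarrow> \<bar>v n - v0\<bar> < d / 4"
      using LIMSEQ_D[OF v0, of "d / 4"] d by auto
    show "\<exists>M. \<forall>x\<in>UNIV. \<forall>m\<ge>M. \<forall>n\<ge>M. dist (Q (m + 1) x) (Q (n + 1) x) < e"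
    proof (intro exI[of _ N] ballI allI impI)
      fix x m n assume mn: "N \<le> m" "N \<le> n"
      have "v (2 * m + 1) - 2 * v (m + n + 1) + v (2 * n + 1) < d"
        using N[of "2 * m + 1"] N[of "m + n + 1"] N[of "2 * n + 1"] mn by linarith
      then have "nrm2 (Q 0) * (v (2 * m + 1) - 2 * v (m + n + 1) + v (2 * n + 1)) \<le> nrm2 (Q 0) * d"
        using nq by (intro mult_left_mono) auto
      also have "\<dots> < e\<^sup>2" using e nq by (simp add: d_def field_simps)
      finally have "sqrt (nrm2 (Q 0) * (v (2 * m + 1) - 2 * v (m + n + 1) + v (2 * n + 1))) < e"
        using e real_less_lsqrt by (metis less_imp_le real_sqrt_less_mono real_sqrt_pow2_iff real_sqrt_power)
      then show "dist (Q (m + 1) x) (Q (n + 1) x) < e" using key[of m x n] by (simp add: dist_norm)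
    qed
  qed
  then obtain P where P: "uniform_limit UNIV (\<lambda>n. Q (n + 1)) P sequentially"
    unfolding uniformly_convergent_on_def by blast
  have cP: "cont P"
    by (rule uniform_limit_theorem[OF _ P]) (auto intro: always_eventually cQ)
  have lim: "(\<lambda>n. Q (n + 1) x) \<longlonglongrightarrow> P x" for x
    by (rule tendsto_uniform_limitI[OF P]) simp
  have hP: "hermitian P"
    unfolding hermitian_def
  proof
    fix x
    have "(\<lambda>n. cnj (Q (n + 1) x)) \<longlonglongrightarrow> cnj (P x)" by (intro tendsto_intros lim)
    moreover have "(\<lambda>n. cnj (Q (n + 1) x)) = (\<lambda>n. Q (n + 1) (- x))"
      using hQ by (auto simp: hermitian_def)
    ultimately show "P (- x) = cnj (P x)" using lim[of "- x"] LIMSEQ_unique by metis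
  qed
  have QP: "conv (Q m) P = P" for m
  proof
    fix x
    have "(\<lambda>n. conv (Q m) (Q (n + 1)) x) \<longlonglongrightarrow> conv (Q m) P x"
      by (intro conv_tendsto P cQ cP)
    moreover have "(\<lambda>n. conv (Q m) (Q (n + 1)) x) = (\<lambda>n. Q (n + (m + 1) + 1) x)"
      by (simp add: QQ algebra_simps)
    moreover have "(\<lambda>n. Q (n + (m + 1) + 1) x) \<longlonglongrightarrow> P x"
      using LIMSEQ_ignore_initial_segment[OF lim[of x], of "m + 1"] by simp
    ultimately show "conv (Q m) P x = P x" using LIMSEQ_unique by metis
  qed
  have PP: "conv P P = P"
  proof
    fix x
    have "(\<lambda>n. conv P (Q (n + 1)) x) \<longlonglongrightarrow> conv P P x"
      by (intro conv_tendsto P cQ cP)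
    moreover have "(\<lambda>n. conv P (Q (n + 1)) x) = (\<lambda>n. P x)"
      by (simp add: conv_commute[OF cP cQ] QP)
    ultimately show "conv P P x = P x" using LIMSEQ_unique[OF _ tendsto_const] by metis
  qed
  have "P 0 = of_real v0"
  proof -
    have "(\<lambda>n. Q (n + 1) 0) \<longlonglongrightarrow> of_real v0"
      unfolding Q0 by (intro tendsto_of_real LIMSEQ_ignore_initial_segment v0)
    then show ?thesis using lim[of 0] LIMSEQ_unique by metis
  qed
  then have P0: "P 0 \<noteq> 0" using v0_ge by simp
  have p1: "p 1 = conv R R" by (simp add: p_def)
  have "conv (conv R R) P = (\<lambda>x. complex_of_real lam * P x)"
  proof -
    have "P = (\<lambda>x. complex_of_real (1 / lam) * conv (conv R R) P x)"
      using QP[of 0] conv_cmult_left[OF cP cp[of 1], of "complex_of_real (1 / lam)"] p1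
      by (simp add: Q_def[abs_def])
    then show ?thesis using lam_pos by (auto simp: fun_eq_iff field_simps)
  qed
  then show ?thesis using that lam_pos cP hP PP P0 by blast
qed

section \<open>Minimal idempotents of the convolution algebra\<close>

definition idem :: "('g \<Rightarrow> complex) \<Rightarrow> bool" where
  "idem P \<longleftrightarrow> cont P \<and> hermitian P \<and> conv P P = P"

lemma idem_0: "idem P \<Longrightarrow> P 0 = of_real (nrm2 P)"
  using conv_self_0[of P] by (simp add: idem_def)

text \<open>Idempotence and Cauchy-Schwarz bound \<open>P\<close> pointwise by
  \<open>nrm2 P\<close>; taking means, \<open>nrm2 P\<close> is at most its own square. In operator
  terms \<open>nrm2 P\<close> is the rank of a projection.\<close>

lemma idem_nrm2_ge_1:
  assumes P: "idem P" and "P x \<noteq> 0"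
  shows "nrm2 P \<ge> 1"
proof -
  have c: "cont P" using P by (simp add: idem_def)
  have pos: "nrm2 P > 0" by (rule nrm2_pos[OF c assms(2)])
  have "cmod (P x) \<le> nrm2 P" for x
    using norm_conv_le[OF c c, of x] P pos by (simp add: idem_def)
  then have "nrm2 P \<le> mean (\<lambda>x::'g. (nrm2 P)\<^sup>2)"
    unfolding nrm2_def[of P]
    by (intro mean_mono continuous_intros c power_mono) (auto simp: nrm2_def)
  then show ?thesis using pos by (simp add: mean_const power2_eq_square)
qed

text \<open>An idempotent whose norm is within \<open>1\<close> of the infimum cannot be decomposed, because every
  nonzero idempotent has norm at least \<open>1\<close>.\<close>

lemma minimal_idempotent:
  assumes P0: "idem P0" "P0 0 \<noteq> 0"
  obtains P where "idem P" "P 0 \<noteq> 0" "conv P0 P = P"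
    "\<And>P'. idem P' \<Longrightarrow> P' 0 \<noteq> 0 \<Longrightarrow> conv P P' = P' \<Longrightarrow> P' = P"
proof -
  \<comment> \<open>Only idempotents below \<open>P0\<close> compete, so that the one chosen
    inherits any eigenvalue equation satisfied by \<open>P0\<close>.\<close>
  define S where "S = {nrm2 P | P. idem P \<and> P 0 \<noteq> 0 \<and> conv P0 P = P}"
  have ne: "S \<noteq> {}" using P0 by (auto simp: S_def idem_def)
  have ge: "s \<ge> 1" if "s \<in> S" for s using that idem_nrm2_ge_1 by (auto simp: S_def)
  have bdd: "bdd_below S" using ge by (auto simp: bdd_below_def)
  obtain s where s: "s \<in> S" "s < Inf S + 1"
    using cInf_lessD[OF ne, of "Inf S + 1"] by auto
  then obtain P where P: "s = nrm2 P" "idem P" "P 0 \<noteq> 0" "conv P0 P = P" by (auto simp: S_def)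
  show ?thesis
  proof (rule that[OF P(2-4)])
    fix P' assume P': "idem P'" "P' 0 \<noteq> 0" "conv P P' = P'"
    have c: "cont P" "cont P'" "cont P0" using P P' P0 by (auto simp: idem_def)
    define P'' where "P'' = (\<lambda>x. P x - P' x)"
    have "conv P'' P'' = P''"
      using P(2) P'(1,3) c unfolding P''_def idem_def
      by (simp add: conv_diff_left conv_diff_right continuous_on_diff conv_commute[OF c(2,1)])
    then have i: "idem P''"
      using P(2) P'(1) c by (auto simp: idem_def P''_def intro!: continuous_intros hermitian_diff)
    have "P'' x = 0" for x
    proof (rule ccontr)
      assume "P'' x \<noteq> 0"
      then have "nrm2 P'' \<ge> 1" by (rule idem_nrm2_ge_1[OF i])
      moreover have "nrm2 P' \<ge> Inf S"
      proof (rule cInf_lower[OF _ bdd])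
        have "conv P0 P' = P'" using conv_assoc[OF c(3,1,2)] P(4) P'(3) by simp
        then show "nrm2 P' \<in> S" using P' by (auto simp: S_def)
      qed
      moreover have "complex_of_real (nrm2 P) = of_real (nrm2 P'' + nrm2 P')"
        using idem_0[OF P(2)] idem_0[OF P'(1)] idem_0[OF i] by (simp add: P''_def algebra_simps)
      then have "nrm2 P = nrm2 P'' + nrm2 P'" using of_real_eq_iff by blast
      ultimately show False using s P(1) by simp
    qed
    then show "P' = P" by (auto simp: P''_def fun_eq_iff)
  qed
qed

text \<open>Every nonzero hermitian \<open>K\<close> below \<open>P\<close> has
  \<open>conv K K = lam P\<close> with \<open>lam > 0\<close>, because the top idempotent of
  \<open>K\<close> lies below \<open>P\<close> and hence equals it. For \<open>H\<close> this gives
  a convolution product \<open>(H - mu P) (H + mu P) = 0\<close>. If the first factor is nonzero,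
  its own square is a positive multiple of \<open>P\<close>, and so the second factor
  vanishes.\<close>

lemma minimal_idempotent_scalar:
  assumes P: "idem P" "P 0 \<noteq> 0" "\<And>P'. idem P' \<Longrightarrow> P' 0 \<noteq> 0 \<Longrightarrow> conv P P' = P' \<Longrightarrow> P' = P"
    and H: "cont H" "hermitian H" "conv P H = H"
  obtains c :: real where "H = (\<lambda>x. complex_of_real c * P x)"
proof -
  have cP: "cont P" and hP: "hermitian P" and PP: "conv P P = P" using P by (auto simp: idem_def)
  have sq: "\<exists>lam>0. conv K K = (\<lambda>x. complex_of_real lam * P x)"
    if K: "cont K" "hermitian K" "conv P K = K" and K0: "K x \<noteq> 0" for K x
  proof -
    obtain P1 lam where P1: "lam > 0" "cont P1" "hermitian P1" "conv P1 P1 = P1" "P1 0 \<noteq> 0"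
        "conv (conv K K) P1 = (\<lambda>x. complex_of_real lam * P1 x)"
      using top_idempotent[OF K(1,2) K0] by blast
    have cKK: "cont (conv K K)" by (intro cont_conv K)
    have PKK: "conv P (conv K K) = conv K K" using conv_assoc[OF cP K(1) K(1)] K(3) by simp
    have "(\<lambda>x. complex_of_real lam * conv P P1 x) = conv P (conv (conv K K) P1)"
      unfolding P1(6) by (rule conv_cmult_right[OF cP P1(2), symmetric])
    also have "\<dots> = (\<lambda>x. complex_of_real lam * P1 x)"
      using conv_assoc[OF cP cKK P1(2)] PKK P1(6) by simp
    finally have "conv P P1 = P1" using P1(1) by (auto simp: fun_eq_iff)
    then have "P1 = P" using P(3)[of P1] P1 by (auto simp: idem_def)
    then have "conv K K = (\<lambda>x. complex_of_real lam * P x)"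
      using P1(6) PKK conv_commute[OF cP cKK] by simp
    then show ?thesis using P1(1) by blast
  qed
  show ?thesis
  proof (cases "\<exists>x. H x \<noteq> 0")
    case False
    then have "H = (\<lambda>x. complex_of_real 0 * P x)" by auto
    then show ?thesis using that by blast
  next
    case True
    then obtain lam where lam: "lam > 0" "conv H H = (\<lambda>x. complex_of_real lam * P x)" using sq H by blast
    define mu where "mu = sqrt lam"
    have mu: "complex_of_real mu * complex_of_real mu = of_real lam"
      using lam by (simp add: mu_def flip: of_real_mult)
    have HP: "conv H P = H" using conv_commute[OF H(1) cP] H(3) by simp
    define D where "D = (\<lambda>x. H x - complex_of_real mu * P x)"
    define E where "E = (\<lambda>x. H x + complex_of_real mu * P x)"
    have cD: "cont D" and cE: "cont E" unfolding D_def E_def by (intro continuous_intros H cP)+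
    have hD: "hermitian D" unfolding D_def by (intro hermitian_diff hermitian_real_mult H hP)
    have cm: "cont (\<lambda>x. complex_of_real mu * P x)" by (intro continuous_intros cP)
    have PD: "conv P D = D" unfolding D_def
      by (simp add: conv_diff_right conv_cmult_right cP H cm PP)
    have PE: "conv P E = E" unfolding E_def
      by (simp add: conv_add_right conv_cmult_right cP H cm PP)
    have "conv H E = (\<lambda>x. of_real mu * E x)"
      unfolding E_def
      by (simp add: conv_add_right conv_cmult_right cP H cm HP lam(2) fun_eq_iff distrib_left mult.assoc[symmetric] mu add.commute)
    then have DE: "conv D E = (\<lambda>x. 0)"
      using cE cP H(1) cm unfolding D_def
      by (simp add: conv_diff_left conv_cmult_left PE)
    show ?thesis
    proof (cases "\<exists>x. D x \<noteq> 0")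
      case False
      then show ?thesis using that[of mu] by (auto simp: D_def fun_eq_iff)
    next
      case True
      then obtain l where l: "l > 0" "conv D D = (\<lambda>x. complex_of_real l * P x)" using sq cD hD PD by blast
      have "(\<lambda>x. complex_of_real l * E x) = conv (conv D D) E"
        unfolding l(2) by (simp add: conv_cmult_left cE cP PE)
      also have "\<dots> = conv D (\<lambda>x. 0)" by (simp add: conv_assoc cD cE DE)
      also have "\<dots> = (\<lambda>x. 0)" by (rule conv_zero_right)
      finally have "E x = 0" for x using l(1) by (auto simp: fun_eq_iff)
      then have "H = (\<lambda>x. complex_of_real (- mu) * P x)"
        by (auto simp: E_def fun_eq_iff add_eq_0_iff2)
      then show ?thesis using that by blast
    qed
  qed
qed

section \<open>Characters, their orthogonality and Parseval's identity\<close>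

lemma characterD:
  assumes "\<phi> \<in> carrier (dual_group :: ('g \<Rightarrow> complex) monoid)"
  shows "cont \<phi>" "\<And>g. cmod (\<phi> g) = 1" "\<And>g h. \<phi> (g + h) = \<phi> g * \<phi> h" "\<phi> 0 = 1"
    "\<And>g. \<phi> (- g) = cnj (\<phi> g)" "\<And>g. \<phi> g * cnj (\<phi> g) = 1"
proof -
  show c: "cont \<phi>" and n: "\<And>g. cmod (\<phi> g) = 1" and m: "\<And>g h. \<phi> (g + h) = \<phi> g * \<phi> h"
    using assms by (auto simp: dual_group_def)
  have "\<phi> 0 \<noteq> 0" using n[of 0] by auto
  then show 0: "\<phi> 0 = 1" using m[of 0 0] by simp
  show u: "\<phi> g * cnj (\<phi> g) = 1" for g using n[of g] by (simp add: complex_norm_square[symmetric])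
  show "\<phi> (- g) = cnj (\<phi> g)" for g
    using m[of g "- g"] u[of g] 0 n[of g] by (metis add.right_inverse mult_cancel_left mult_zero_left zero_neq_one)
qed

definition fourier :: "('g \<Rightarrow> complex) \<Rightarrow> ('g \<Rightarrow> complex) \<Rightarrow> complex" where
  "fourier f \<phi> = mean (\<lambda>y. f y * cnj (\<phi> y))"

lemma conv_character:
  assumes "cont f" "\<phi> \<in> carrier dual_group"
  shows "conv f \<phi> = (\<lambda>x. fourier f \<phi> * \<phi> x)"
proof
  fix x
  note \<phi> = characterD[OF assms(2)]
  have "f y * \<phi> (x - y) = f y * cnj (\<phi> y) * \<phi> x" for y
    using \<phi>(3)[of x "- y"] \<phi>(5)[of y] by simp
  then have "conv f \<phi> x = mean (\<lambda>y. f y * cnj (\<phi> y) * \<phi> x)" unfolding conv_def by presburger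
  also have "\<dots> = fourier f \<phi> * \<phi> x"
    unfolding fourier_def by (intro mean_multc continuous_intros assms \<phi>)
  finally show "conv f \<phi> x = fourier f \<phi> * \<phi> x" .
qed

text \<open>Translates of a minimal idempotent \<open>P\<close> are still fixed by convolution with
  \<open>P\<close>, hence are multiples of \<open>P\<close>, and the factors form a character. Lying
  below the top idempotent, \<open>P\<close> keeps the eigenvalue \<open>lam\<close> of
  \<open>conv R R\<close>, which prevents the Fourier coefficient from vanishing.\<close>

lemma exists_character:
  assumes R: "cont R" "hermitian R" "R x0 \<noteq> 0"
  obtains \<phi> where "\<phi> \<in> carrier dual_group" "fourier R \<phi> \<noteq> 0"
proof -
  obtain P0 lam where P0: "lam > 0" "cont P0" "hermitian P0" "conv P0 P0 = P0" "P0 0 \<noteq> 0"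
      "conv (conv R R) P0 = (\<lambda>x. complex_of_real lam * P0 x)"
    using top_idempotent[OF R] by blast
  then have "idem P0" by (simp add: idem_def)
  from minimal_idempotent[OF this P0(5)] obtain P where P: "idem P" "P 0 \<noteq> 0" "conv P0 P = P"
    "\<And>P'. idem P' \<Longrightarrow> P' 0 \<noteq> 0 \<Longrightarrow> conv P P' = P' \<Longrightarrow> P' = P" by blast
  have cP: "cont P" and hP: "hermitian P" and PP: "conv P P = P" using P by (auto simp: idem_def)
  have "\<exists>c. \<forall>x. P (x + g) = c * P x" for g
  proof -
    define T where "T h = (\<lambda>x. P (x + h))" for h
    have cT: "cont (T h)" for h unfolding T_def by (intro cont_comp[OF cP] continuous_intros)
    have PT: "conv P (T h) = T h" for h
    proof -
      have "conv P (T h) x = conv P P (x + h)" for x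
        unfolding conv_def T_def by (simp add: algebra_simps)
      then show ?thesis by (simp add: PP fun_eq_iff T_def)
    qed
    have hT: "T h (- x) = cnj (T (- h) x)" for x h
      using hP unfolding hermitian_def T_def by (metis minus_add minus_minus add.commute)
    \<comment> \<open>A translate need not be hermitian; \<open>H1\<close> and \<open>H2\<close> are
      twice its hermitian parts, to which the scalar lemma applies with real factors.\<close>
    define H1 where "H1 = (\<lambda>x. T g x + T (- g) x)"
    define H2 where "H2 = (\<lambda>x. (- \<i>) * (T g x - T (- g) x))"
    have 1: "cont H1" "hermitian H1" "conv P H1 = H1"
      unfolding H1_def by (auto intro!: continuous_on_add cT simp: conv_add_right cP cT PT hermitian_def hT)
    have 2: "cont H2" "hermitian H2" "conv P H2 = H2"
    proof -
      have c: "cont (\<lambda>x. T g x - T (- g) x)" by (intro continuous_on_diff cT)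
      show "cont H2" unfolding H2_def by (intro continuous_on_mult_left c)
      show "hermitian H2" unfolding H2_def hermitian_def by (simp add: hT algebra_simps)
      show "conv P H2 = H2" unfolding H2_def conv_cmult_right[OF cP c] conv_diff_right[OF cP cT cT] PT ..
    qed
    obtain c1 where c1: "H1 = (\<lambda>x. complex_of_real c1 * P x)"
      using minimal_idempotent_scalar[OF P(1,2,4) 1] by blast
    obtain c2 where c2: "H2 = (\<lambda>x. complex_of_real c2 * P x)"
      using minimal_idempotent_scalar[OF P(1,2,4) 2] by blast
    have T2: "T g x = (H1 x + \<i> * H2 x) / 2" for x
      by (simp add: H1_def H2_def algebra_simps)
    have "T g x = ((complex_of_real c1 + \<i> * complex_of_real c2) / 2) * P x" for x
      unfolding T2 c1 c2 by (simp add: field_simps)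
    then have "P (x + g) = ((complex_of_real c1 + \<i> * complex_of_real c2) / 2) * P x" for x
      by (simp add: T_def)
    then show ?thesis by blast
  qed
  then obtain c where c: "\<And>g x. P (x + g) = c g * P x" by metis
  have c': "c g = P g / P 0" for g using c[of 0 g] P(2) by simp
  have "c \<in> carrier dual_group"
    unfolding dual_group_def
  proof (simp, intro conjI allI)
    show "cont c" unfolding c'[abs_def] by (intro continuous_intros cP) (use P in auto)
    fix g h
    show "c (g + h) = c g * c h" using c[of g h] P(2) by (simp add: c')
    \<comment> \<open>Translation invariance of \<open>nrm2\<close> forces modulus 1.\<close>
    have "nrm2 P = (cmod (c g))\<^sup>2 * nrm2 P"
      using nrm2_translate[OF cP, of g] nrm2_cmult[OF cP, of "c g"] by (simp add: c)
    moreover have "nrm2 P > 0" by (rule nrm2_pos[OF cP P(2)])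
    ultimately have "(cmod (c g))\<^sup>2 = 1" by simp
    then show "cmod (c g) = 1" by (simp add: power2_eq_1_iff) (metis norm_ge_zero neg_0_le_iff_le not_one_le_zero)
  qed
  moreover have "fourier R c \<noteq> 0"
  proof
    assume z: "fourier R c = 0"
    have Pc: "P = (\<lambda>x. P 0 * c x)" using P(2) by (simp add: c')
    have cc: "cont c" using characterD(1)[OF \<open>c \<in> carrier dual_group\<close>] .
    have "conv R P = (\<lambda>x. 0)"
      by (subst Pc, subst conv_cmult_right[OF R(1) cc]) (simp add: conv_character[OF R(1) \<open>c \<in> _\<close>] z)
    then have "conv (conv R R) P = (\<lambda>x. 0)"
      using conv_assoc[OF R(1) R(1) cP] by (simp add: conv_zero_right)
    moreover have "conv (conv R R) P = (\<lambda>x. complex_of_real lam * P x)"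
    proof -
      have "conv (conv R R) P = conv (conv (conv R R) P0) P"
        using conv_assoc[OF cont_conv[OF R(1) R(1)] P0(2) cP] P(3) by simp
      then show ?thesis unfolding P0(6) using conv_cmult_left[OF cP P0(2)] P(3) by simp
    qed
    ultimately show False using P0(1) P(2) by (auto simp: fun_eq_iff)
  qed
  ultimately show ?thesis using that by blast
qed

lemma character_orthogonal:
  fixes \<phi> \<psi> :: "'g \<Rightarrow> complex"
  assumes "\<phi> \<in> carrier dual_group" "\<psi> \<in> carrier dual_group"
  shows "fourier \<phi> \<psi> = (if \<phi> = \<psi> then 1 else 0)"
proof (cases "\<phi> = \<psi>")
  case True
  then show ?thesis using characterD(6)[OF assms(2)] by (simp add: fourier_def mean_const)
next
  case False
  then obtain g where g: "\<phi> g \<noteq> \<psi> g" by auto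
  note \<phi> = characterD[OF assms(1)] and \<psi> = characterD[OF assms(2)]
  let ?\<chi> = "\<lambda>x. \<phi> x * cnj (\<psi> x)"
  have c: "cont ?\<chi>" by (intro continuous_intros \<phi> \<psi>)
  have "?\<chi> (x + g) = ?\<chi> x * ?\<chi> g" for x by (simp add: \<phi> \<psi>)
  then have "mean ?\<chi> = mean ?\<chi> * ?\<chi> g"
    using mean_translate[OF c, of g] mean_multc[OF c, of "?\<chi> g"] by simp
  moreover have "?\<chi> g \<noteq> 1"
  proof
    assume "?\<chi> g = 1"
    then have "\<phi> g * (\<psi> g * cnj (\<psi> g)) = \<psi> g" by (simp add: mult.left_commute)
    then show False using \<psi>(6)[of g] g by simp
  qed
  ultimately show ?thesis using False by (simp add: fourier_def)
qed

lemma fourier_hermitian: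
  assumes f: "cont f" "hermitian f" and \<phi>: "\<phi> \<in> carrier dual_group"
  shows "fourier f \<phi> = of_real (Re (fourier f \<phi>))"
proof -
  have c: "cont (\<lambda>y. f y * cnj (\<phi> y))" by (intro continuous_intros f characterD[OF \<phi>])
  have "cnj (fourier f \<phi>) = mean (\<lambda>y. f (- y) * cnj (\<phi> (- y)))"
    unfolding fourier_def using mean_cnj[OF c] f(2) characterD(5)[OF \<phi>] by (simp add: hermitian_def)
  also have "\<dots> = fourier f \<phi>" unfolding fourier_def by (rule mean_uminus[OF c])
  finally have "fourier f \<phi> \<in> \<real>" by (simp add: Reals_cnj_iff)
  then show ?thesis by (simp add: complex_is_Real_iff complex_eq_iff)
qed

text \<open>Bessel's inequality as an identity. It gives summability of the squared coefficients
  and, once their sum is known, the L2-approximation.\<close>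

lemma nrm2_diff_trig:
  assumes f: "cont f" and S: "finite S" "S \<subseteq> carrier dual_group"
  shows "nrm2 (\<lambda>x. f x - (\<Sum>\<phi>\<in>S. fourier f \<phi> * \<phi> x)) = nrm2 f - (\<Sum>\<phi>\<in>S. (cmod (fourier f \<phi>))\<^sup>2)"
proof -
  define k where "k x = (\<Sum>\<phi>\<in>S. fourier f \<phi> * \<phi> x)" for x
  have c\<phi>: "cont \<phi>" if "\<phi> \<in> S" for \<phi> using that S characterD(1) by blast
  have ck: "cont k" unfolding k_def by (intro continuous_intros c\<phi>)
  define s where "s = (\<Sum>\<phi>\<in>S. complex_of_real ((cmod (fourier f \<phi>))\<^sup>2))"
  have mk: "mean (\<lambda>x. h x * cnj (k x)) = (\<Sum>\<phi>\<in>S. cnj (fourier f \<phi>) * fourier h \<phi>)" if h: "cont h" for h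
  proof -
    have "(\<lambda>x. h x * cnj (k x)) = (\<lambda>x. \<Sum>\<phi>\<in>S. cnj (fourier f \<phi>) * (h x * cnj (\<phi> x)))"
      by (simp add: k_def sum_distrib_left mult_ac fun_eq_iff)
    then have "mean (\<lambda>x. h x * cnj (k x)) = (\<Sum>\<phi>\<in>S. mean (\<lambda>x. cnj (fourier f \<phi>) * (h x * cnj (\<phi> x))))"
      by (simp only:) (intro mean_sum continuous_intros h c\<phi>)
    also have "\<dots> = (\<Sum>\<phi>\<in>S. cnj (fourier f \<phi>) * fourier h \<phi>)"
      unfolding fourier_def[of h] by (intro sum.cong refl mean_cmult continuous_intros h c\<phi>)
    finally show ?thesis .
  qed
  have fk: "mean (\<lambda>x. f x * cnj (k x)) = s"
    unfolding mk[OF f] s_def complex_norm_square by (simp add: mult.commute)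
  have four_k: "fourier k \<phi> = fourier f \<phi>" if "\<phi> \<in> S" for \<phi>
  proof -
    have "(\<lambda>x. k x * cnj (\<phi> x)) = (\<lambda>x. \<Sum>\<psi>\<in>S. fourier f \<psi> * (\<psi> x * cnj (\<phi> x)))"
      unfolding k_def sum_distrib_right by (simp add: mult.assoc)
    then have "fourier k \<phi> = (\<Sum>\<psi>\<in>S. mean (\<lambda>x. fourier f \<psi> * (\<psi> x * cnj (\<phi> x))))"
      unfolding fourier_def[of k] by (simp only:) (intro mean_sum continuous_intros that c\<phi>)
    also have "\<dots> = (\<Sum>\<psi>\<in>S. fourier f \<psi> * fourier \<psi> \<phi>)"
      unfolding fourier_def[of _ \<phi>] by (intro sum.cong refl mean_cmult continuous_intros that c\<phi>)
    also have "\<dots> = (\<Sum>\<psi>\<in>S. if \<psi> = \<phi> then fourier f \<psi> else 0)"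
    proof (intro sum.cong refl)
      fix \<psi> assume "\<psi> \<in> S"
      then have "\<psi> \<in> carrier dual_group" "\<phi> \<in> carrier dual_group" using that S by auto
      then show "fourier f \<psi> * fourier \<psi> \<phi> = (if \<psi> = \<phi> then fourier f \<psi> else 0)"
        by (simp add: character_orthogonal)
    qed
    also have "\<dots> = fourier f \<phi>" using S(1) that by simp
    finally show ?thesis .
  qed
  have kk: "mean (\<lambda>x. k x * cnj (k x)) = s"
    unfolding mk[OF ck] s_def complex_norm_square using four_k by (simp add: mult.commute)
  have kf: "mean (\<lambda>x. k x * cnj (f x)) = s"
  proof -
    have "mean (\<lambda>x. k x * cnj (f x)) = cnj (mean (\<lambda>x. f x * cnj (k x)))"
      by (subst mean_cnj[symmetric]) (auto intro!: continuous_intros f ck simp: mult.commute)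
    then show ?thesis unfolding fk by (simp add: s_def)
  qed
  have nr: "complex_of_real (nrm2 h) = mean (\<lambda>x. h x * cnj (h x))" if "cont h" for h :: "'g \<Rightarrow> complex"
    unfolding nrm2_def complex_norm_square[symmetric]
    by (rule mean_of_real[symmetric]) (intro continuous_intros that)
  have "complex_of_real (nrm2 (\<lambda>x. f x - k x)) = mean (\<lambda>x. (f x - k x) * cnj (f x - k x))"
    by (rule nr) (intro continuous_intros f ck)
  also have "(\<lambda>x. (f x - k x) * cnj (f x - k x))
      = (\<lambda>x. f x * cnj (f x) - f x * cnj (k x) - (k x * cnj (f x) - k x * cnj (k x)))"
    by (simp add: algebra_simps)
  also have "mean \<dots> = mean (\<lambda>x. f x * cnj (f x)) - s - (s - s)"
    unfolding fk[symmetric]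
    by (subst mean_diff, (intro continuous_intros f ck)+)+ (simp add: fk kf kk)
  also have "\<dots> = of_real (nrm2 f - (\<Sum>\<phi>\<in>S. (cmod (fourier f \<phi>))\<^sup>2))"
    using nr[OF f] by (simp add: s_def)
  finally show ?thesis unfolding k_def using of_real_eq_iff by blast
qed

text \<open>The series \<open>W\<close> with the squared coefficients converges uniformly and has
  the same Fourier coefficients as \<open>conv f f\<close>. By \<open>exists_character\<close> their
  difference vanishes, and equality at \<open>0\<close> is Parseval's identity.\<close>

theorem L2_approx:
  fixes f :: "'g \<Rightarrow> complex"
  assumes f: "cont f" "hermitian f" and e: "e > 0"
  obtains S where "finite S" "S \<subseteq> carrier dual_group"
    "nrm2 (\<lambda>x. f x - (\<Sum>\<phi>\<in>S. fourier f \<phi> * \<phi> x)) < e"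
proof -
  define a where "a \<phi> = (cmod (fourier f \<phi>))\<^sup>2" for \<phi>
  let ?C = "carrier (dual_group :: ('g \<Rightarrow> complex) monoid)"
  have bessel: "sum a S \<le> nrm2 f" if "finite S" "S \<subseteq> ?C" for S
  proof -
    have "cont (\<lambda>x. f x - (\<Sum>\<phi>\<in>S. fourier f \<phi> * \<phi> x))"
      using that characterD(1) by (intro continuous_intros f) auto
    from nrm2_nonneg[OF this] show ?thesis using nrm2_diff_trig[OF f(1) that] by (simp add: a_def)
  qed
  have summ: "a summable_on ?C"
    by (rule nonneg_bdd_above_summable_on) (auto simp: a_def bdd_above_def intro!: exI[of _ "nrm2 f"] bessel[unfolded a_def])
  define W where "W x = (\<Sum>\<^sub>\<infinity>\<phi>\<in>?C. of_real (a \<phi>) * \<phi> x)" for x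
  have un: "uniform_limit UNIV (\<lambda>S x. \<Sum>\<phi>\<in>S. of_real (a \<phi>) * \<phi> x) W (finite_subsets_at_top ?C)"
    unfolding W_def
    by (rule Weierstrass_m_test_general[OF _ summ]) (auto simp: norm_mult norm_power characterD a_def)
  have ev: "\<forall>\<^sub>F S in finite_subsets_at_top ?C. finite S \<and> S \<subseteq> ?C"
    by (rule eventually_finite_subsets_at_top_weakI) auto
  have cS: "cont (\<lambda>x. \<Sum>\<phi>\<in>S. of_real (a \<phi>) * \<phi> x)" if "S \<subseteq> ?C" for S
    using that characterD(1) by (intro continuous_intros) auto
  have cW: "cont W"
    by (rule uniform_limit_theorem[OF _ un]) (use ev cS in \<open>auto elim: eventually_mono\<close>)
  have hW: "hermitian W" unfolding hermitian_def W_def infsum_cnj[symmetric]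
    by (intro allI infsum_cong) (simp add: characterD)
  have fW: "fourier W \<psi> = of_real (a \<psi>)" if \<psi>: "\<psi> \<in> ?C" for \<psi>
  proof -
    \<comment> \<open>\<open>conv_tendsto\<close> wants every member of the net continuous, so
      \<open>W\<close> serves as a default for index sets that are not finite subsets of the
      dual.\<close>
    define F where "F S = (if finite S \<and> S \<subseteq> ?C then (\<lambda>x. \<Sum>\<phi>\<in>S. of_real (a \<phi>) * \<phi> x) else W)" for S
    have cF: "cont (F S)" for S using cS cW by (auto simp: F_def)
    have unF: "uniform_limit UNIV F W (finite_subsets_at_top ?C)"
      by (rule uniform_limit_cong[THEN iffD1, OF _ _ un]) (use ev in \<open>auto elim!: eventually_mono simp: F_def\<close>)
    have lim1: "((\<lambda>S. conv \<psi> (F S) 0) \<longlongrightarrow> conv \<psi> W 0) (finite_subsets_at_top ?C)"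
      by (rule conv_tendsto[OF unF cF cW characterD(1)[OF \<psi>]])
    have cc: "conv \<psi> h 0 = fourier h \<psi>" if "cont h" for h
      unfolding conv_commute[OF characterD(1)[OF \<psi>] that] conv_character[OF that \<psi>]
      by (simp add: characterD[OF \<psi>])
    have "\<forall>\<^sub>F S in finite_subsets_at_top ?C. fourier (F S) \<psi> = of_real (a \<psi>)"
    proof (rule eventually_mono[of "\<lambda>S. finite S \<and> S \<subseteq> ?C \<and> \<psi> \<in> S"])
      show "\<forall>\<^sub>F S in finite_subsets_at_top ?C. finite S \<and> S \<subseteq> ?C \<and> \<psi> \<in> S"
        unfolding eventually_finite_subsets_at_top using \<psi> by (intro exI[of _ "{\<psi>}"]) auto
      fix S assume S: "finite S \<and> S \<subseteq> ?C \<and> \<psi> \<in> S"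
      have c\<phi>: "cont \<phi>" if "\<phi> \<in> S" for \<phi> using that S characterD(1) by blast
      have "fourier (F S) \<psi> = mean (\<lambda>x. \<Sum>\<phi>\<in>S. of_real (a \<phi>) * (\<phi> x * cnj (\<psi> x)))"
        using S by (simp add: F_def fourier_def sum_distrib_right mult.assoc)
      also have "\<dots> = (\<Sum>\<phi>\<in>S. of_real (a \<phi>) * fourier \<phi> \<psi>)"
      proof -
        have c: "cont (\<lambda>x. \<phi> x * cnj (\<psi> x))" if "\<phi> \<in> S" for \<phi>
          using c\<phi>[OF that] characterD(1)[OF \<psi>] by (intro continuous_intros)
        then show ?thesis unfolding fourier_def
          by (subst mean_sum) (auto intro!: continuous_on_mult_left sum.cong mean_cmult)
      qed
      also have "\<dots> = (\<Sum>\<phi>\<in>S. if \<phi> = \<psi> then of_real (a \<phi>) else 0)"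
        using S \<psi> character_orthogonal by (intro sum.cong refl) (auto simp: subset_iff)
      also have "\<dots> = of_real (a \<psi>)" using S by simp
      finally show "fourier (F S) \<psi> = of_real (a \<psi>)" .
    qed
    then have "((\<lambda>S. fourier (F S) \<psi>) \<longlongrightarrow> of_real (a \<psi>)) (finite_subsets_at_top ?C)"
      by (rule tendsto_eventually)
    then show ?thesis
      using tendsto_unique[OF finite_subsets_at_top_neq_bot lim1[unfolded cc[OF cF] cc[OF cW]]] by blast
  qed
  define R where "R = (\<lambda>x. conv f f x - W x)"
  have cR: "cont R" unfolding R_def by (intro continuous_intros cont_conv f cW)
  have hR: "hermitian R" unfolding R_def by (intro hermitian_diff hermitian_conv f hW)
  have "fourier R \<psi> = 0" if \<psi>: "\<psi> \<in> ?C" for \<psi>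
  proof -
    have "conv (conv f f) \<psi> 0 = (fourier f \<psi>)\<^sup>2"
      unfolding conv_assoc[OF f(1) f(1) characterD(1)[OF \<psi>]] conv_character[OF f(1) \<psi>]
        conv_cmult_right[OF f(1) characterD(1)[OF \<psi>]]
      by (simp add: characterD[OF \<psi>] power2_eq_square)
    \<comment> \<open>For hermitian \<open>f\<close> the coefficient is real, so its square is the
      square of its modulus.\<close>
    also have "\<dots> = of_real (a \<psi>)"
      using fourier_hermitian[OF f \<psi>] by (metis a_def norm_of_real of_real_power power2_abs)
    finally have "fourier (conv f f) \<psi> = of_real (a \<psi>)"
      using conv_character[OF cont_conv[OF f(1) f(1)] \<psi>] by (simp add: characterD[OF \<psi>])
    moreover have "fourier R \<psi> = fourier (conv f f) \<psi> - fourier W \<psi>"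
      unfolding fourier_def R_def left_diff_distrib
      by (intro mean_diff continuous_intros cont_conv f cW characterD[OF \<psi>])
    ultimately show ?thesis using fW[OF \<psi>] by simp
  qed
  then have "R 0 = 0" using exists_character[OF cR hR, of 0] by blast
  then have "complex_of_real (nrm2 f) = W 0" using conv_self_0[OF f] by (simp add: R_def)
  also have "W 0 = (\<Sum>\<^sub>\<infinity>\<phi>\<in>?C. of_real (a \<phi>))"
    unfolding W_def by (intro infsum_cong) (simp add: characterD)
  finally have tot: "nrm2 f = infsum a ?C"
    unfolding infsumI[OF has_sum_bounded_linear[OF bounded_linear_of_real has_sum_infsum[OF summ]]]
    using of_real_eq_iff by blast
  have "(sum a \<longlongrightarrow> nrm2 f) (finite_subsets_at_top ?C)"
    unfolding tot using summ has_sum_infsum by (auto simp: has_sum_def)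
  from eventually_conj[OF tendstoD[OF this e] ev]
  obtain S where S: "dist (sum a S) (nrm2 f) < e" "finite S" "S \<subseteq> ?C"
    using eventually_happens'[OF finite_subsets_at_top_neq_bot] by blast
  then have "nrm2 (\<lambda>x. f x - (\<Sum>\<phi>\<in>S. fourier f \<phi> * \<phi> x)) < e"
    using nrm2_diff_trig[OF f(1) S(2,3)] by (simp add: a_def dist_real_def)
  then show ?thesis using that S by blast
qed

end

section \<open>Arithmetic of complex scalars and the star; Cauchy sequences in a star
  subalgebra\<close>

section \<open>Automatic continuity of C*-seminorms\<close>

lemma scaleC_one [simp]: "1 *\<^sub>C x = x" for x :: "'a::unital_cstar_algebra"
  using scaleC_complex_of_real[of 1 x] by simp

lemma scaleC_zero_left [simp]: "0 *\<^sub>C x = 0" for x :: "'a::unital_cstar_algebra"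
  using scaleC_complex_of_real[of 0 x] by simp

lemma scaleC_minus_one: "(- 1) *\<^sub>C x = - x" for x :: "'a::unital_cstar_algebra"
  using scaleC_complex_of_real[of "- 1" x] by simp

lemma scaleC_zero_right [simp]: "c *\<^sub>C (0 :: 'a::unital_cstar_algebra) = 0"
  using scaleC_add_right[of c "0::'a" 0] by simp

lemma scaleC_minus_right: "c *\<^sub>C (- x) = - (c *\<^sub>C x)" for x :: "'a::unital_cstar_algebra"
  using scaleC_add_right[of c x "- x"] by (simp add: eq_neg_iff_add_eq_0 add.commute)

lemma scaleC_diff_right: "c *\<^sub>C (x - y) = c *\<^sub>C x - c *\<^sub>C y" for x :: "'a::unital_cstar_algebra"
  using scaleC_add_right[of c x "- y"] by (simp add: scaleC_minus_right)

lemma scaleC_sum_right: "c *\<^sub>C (\<Sum>i\<in>I. f i) = (\<Sum>i\<in>I. c *\<^sub>C f i)"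
  for f :: "'i \<Rightarrow> 'a::unital_cstar_algebra"
  by (induction I rule: infinite_finite_induct) (auto simp: scaleC_add_right)

lemma scaleR_eq_scaleC: "r *\<^sub>R x = complex_of_real r *\<^sub>C x" for x :: "'a::unital_cstar_algebra"
  by (simp add: scaleC_complex_of_real)

lemma bounded_linear_scaleC_right: "bounded_linear (\<lambda>x::'a::unital_cstar_algebra. c *\<^sub>C x)"
proof (rule bounded_linear_intro[where K = "cmod c"])
  show "c *\<^sub>C (r *\<^sub>R x) = r *\<^sub>R (c *\<^sub>C x)" for r and x :: 'a
    by (simp add: scaleR_eq_scaleC scaleC_scaleC mult.commute)
qed (auto simp: scaleC_add_right norm_scaleC mult.commute)

lemma bounded_linear_scaleC_left: "bounded_linear (\<lambda>c. c *\<^sub>C (x::'a::unital_cstar_algebra))"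
proof (rule bounded_linear_intro[where K = "norm x"])
  show "(r *\<^sub>R c) *\<^sub>C x = r *\<^sub>R (c *\<^sub>C x)" for r and c
    by (simp add: scaleR_eq_scaleC scaleC_scaleC scaleR_conv_of_real)
qed (auto simp: scaleC_add_left norm_scaleC)

lemma continuous_on_scaleC [continuous_intros]:
  fixes a :: "'t::topological_space \<Rightarrow> 'a::unital_cstar_algebra"
  assumes c: "continuous_on S c" and a: "continuous_on S a"
  shows "continuous_on S (\<lambda>x. c x *\<^sub>C a x)"
proof -
  have "bounded_bilinear (\<lambda>c (x::'a). c *\<^sub>C x)"
  proof (unfold_locales)
    show "\<exists>K. \<forall>c (x::'a). norm (c *\<^sub>C x) \<le> norm c * norm x * K"
      by (intro exI[of _ 1]) (simp add: norm_scaleC)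
  qed (auto simp: scaleC_add_left scaleC_add_right scaleR_eq_scaleC scaleC_scaleC scaleR_conv_of_real mult.commute)
  from bounded_bilinear.continuous_on[OF this c a] show ?thesis .
qed

lemma star_zero [simp]: "star (0::'a::unital_cstar_algebra) = 0"
  using star_add[of "0::'a" 0] by simp

lemma star_one [simp]: "star (1::'a::unital_cstar_algebra) = 1"
proof -
  have "star (1::'a) = star 1 * star (star 1)" by (simp add: star_star)
  also have "\<dots> = star (star 1 * 1)" by (simp only: star_mult)
  finally show ?thesis by (simp add: star_star)
qed

lemma star_minus: "star (- x) = - star x" for x :: "'a::unital_cstar_algebra"
  using star_scaleC[of "- 1" x] by (simp add: scaleC_minus_one)

lemma star_diff: "star (x - y) = star x - star y" for x :: "'a::unital_cstar_algebra"
  using star_add[of x "- y"] by (simp add: star_minus)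

lemma star_sum: "star (\<Sum>i\<in>I. f i) = (\<Sum>i\<in>I. star (f i))"
  for f :: "'i \<Rightarrow> 'a::unital_cstar_algebra"
  by (induction I rule: infinite_finite_induct) (auto simp: star_add)

lemma norm_star [simp]: "norm (star x) = norm x" for x :: "'a::unital_cstar_algebra"
proof -
  have *: "norm y \<le> norm (star y)" for y :: 'a
  proof (cases "y = 0")
    case False
    have "(norm y)\<^sup>2 \<le> norm (star y) * norm y"
      unfolding norm_star_mult_self[symmetric] by (rule norm_mult_ineq)
    then show ?thesis using False by (simp add: power2_eq_square)
  qed simp
  show ?thesis using *[of x] *[of "star x"] by (simp add: star_star)
qed

lemma bounded_linear_star: "bounded_linear (star :: 'a::unital_cstar_algebra \<Rightarrow> 'a)"
  by (rule bounded_linear_intro[where K = 1]) (auto simp: star_add scaleR_eq_scaleC star_scaleC)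

text \<open>No C*-identity is demanded of \<open>N\<close>, because the l1-norm violates it in
  general. The instances are the span of the components with the l1-norm, the image of the
  l1-completion with the norm of the algebra, and a whole C*-algebra.\<close>

locale normed_star_subalgebra =
  fixes D :: "'a::unital_cstar_algebra set" and N :: "'a \<Rightarrow> real"
  assumes one_mem: "1 \<in> D"
    and add_mem: "x \<in> D \<Longrightarrow> y \<in> D \<Longrightarrow> x + y \<in> D"
    and mult_mem: "x \<in> D \<Longrightarrow> y \<in> D \<Longrightarrow> x * y \<in> D"
    and scaleC_mem: "x \<in> D \<Longrightarrow> c *\<^sub>C x \<in> D"
    and star_mem: "x \<in> D \<Longrightarrow> star x \<in> D"
    and N_add: "x \<in> D \<Longrightarrow> y \<in> D \<Longrightarrow> N (x + y) \<le> N x + N y"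
    and N_mult: "x \<in> D \<Longrightarrow> y \<in> D \<Longrightarrow> N (x * y) \<le> N x * N y"
    and N_scaleC: "x \<in> D \<Longrightarrow> N (c *\<^sub>C x) = cmod c * N x"
    and N_star: "x \<in> D \<Longrightarrow> N (star x) = N x"
begin

lemma zero_mem: "0 \<in> D" using scaleC_mem[OF one_mem, of 0] by simp

lemma minus_mem: "x \<in> D \<Longrightarrow> - x \<in> D" using scaleC_mem[of x "- 1"] by (simp add: scaleC_minus_one)

lemma diff_mem: "x \<in> D \<Longrightarrow> y \<in> D \<Longrightarrow> x - y \<in> D"
  using add_mem[of x "- y"] minus_mem[of y] by simp

lemma scaleR_mem: "x \<in> D \<Longrightarrow> r *\<^sub>R x \<in> D" by (simp add: scaleR_eq_scaleC scaleC_mem)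

lemma N_scaleR: "x \<in> D \<Longrightarrow> N (r *\<^sub>R x) = \<bar>r\<bar> * N x"
  by (simp add: scaleR_eq_scaleC N_scaleC)

lemma N_zero [simp]: "N 0 = 0" using N_scaleC[OF one_mem, of 0] by simp

lemma N_minus: "x \<in> D \<Longrightarrow> N (- x) = N x"
  using N_scaleC[of x "- 1"] by (simp add: scaleC_minus_one)

lemma N_minus_commute: "x \<in> D \<Longrightarrow> y \<in> D \<Longrightarrow> N (x - y) = N (y - x)"
  using N_minus[of "x - y"] diff_mem[of x y] by simp

lemma N_diff: "x \<in> D \<Longrightarrow> y \<in> D \<Longrightarrow> N (x - y) \<le> N x + N y"
  using N_add[of x "- y"] minus_mem[of y] N_minus[of y] by simp

lemma N_triangle: "x \<in> D \<Longrightarrow> y \<in> D \<Longrightarrow> z \<in> D \<Longrightarrow> N (x - z) \<le> N (x - y) + N (y - z)"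
  using N_add[of "x - y" "y - z"] diff_mem by simp

lemma N_nonneg: "x \<in> D \<Longrightarrow> 0 \<le> N x"
  using N_diff[of x x] by simp

lemma N_abs_diff: "x \<in> D \<Longrightarrow> y \<in> D \<Longrightarrow> \<bar>N x - N y\<bar> \<le> N (x - y)"
  using N_add[of "x - y" y] N_add[of "y - x" x] N_minus_commute[of x y] diff_mem[of x y] diff_mem[of y x]
  by (simp add: abs_le_iff)

lemma N_mult_diff:
  assumes "x \<in> D" "y \<in> D" "x' \<in> D" "y' \<in> D"
  shows "N (x * y - x' * y') \<le> N (x - x') * N y + N x' * N (y - y')"
proof -
  have "x * y - x' * y' = (x - x') * y + x' * (y - y')" by (simp add: algebra_simps)
  also have "N \<dots> \<le> N ((x - x') * y) + N (x' * (y - y'))"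
    using assms by (intro N_add mult_mem diff_mem)
  also have "\<dots> \<le> N (x - x') * N y + N x' * N (y - y')"
    using assms by (intro add_mono N_mult diff_mem)
  finally show ?thesis .
qed

text \<open>Cauchy sequences stand for elements of the completion of \<open>D\<close>, so that
  limits such as square roots can be formed without naming that completion.\<close>

definition cauchy :: "(nat \<Rightarrow> 'a) set" where
  "cauchy = {x. (\<forall>n. x n \<in> D) \<and> (\<forall>e>0. \<exists>M. \<forall>m\<ge>M. \<forall>n\<ge>M. N (x m - x n) < e)}"

lemma cauchy_mem: "x \<in> cauchy \<Longrightarrow> x n \<in> D" by (simp add: cauchy_def)

lemma cauchyD: "x \<in> cauchy \<Longrightarrow> e > 0 \<Longrightarrow> \<exists>M. \<forall>m\<ge>M. \<forall>n\<ge>M. N (x m - x n) < e"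
  by (simp add: cauchy_def)

lemma cauchyI:
  assumes "\<And>n. x n \<in> D" "\<And>e. e > 0 \<Longrightarrow> \<exists>M. \<forall>m\<ge>M. \<forall>n\<ge>M. N (x m - x n) < e"
  shows "x \<in> cauchy"
  using assms by (simp add: cauchy_def)

lemma cauchy_convergent_N:
  assumes "x \<in> cauchy"
  obtains r where "(\<lambda>n. N (x n)) \<longlonglongrightarrow> r"
proof -
  have "Cauchy (\<lambda>n. N (x n))"
  proof (rule metric_CauchyI)
    fix e :: real assume "e > 0"
    then obtain M where M: "\<forall>m\<ge>M. \<forall>n\<ge>M. N (x m - x n) < e" using cauchyD[OF assms] by blast
    have "dist (N (x m)) (N (x n)) < e" if "m \<ge> M" "n \<ge> M" for m n
      using N_abs_diff[OF cauchy_mem[OF assms] cauchy_mem[OF assms], of m n] M that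
      unfolding dist_real_def by (meson le_less_trans)
    then show "\<exists>M. \<forall>m\<ge>M. \<forall>n\<ge>M. dist (N (x m)) (N (x n)) < e" by blast
  qed
  then show ?thesis using that Cauchy_convergent convergent_def by metis
qed

lemma cauchy_bounded:
  assumes "x \<in> cauchy"
  obtains C where "C > 0" "\<And>n. N (x n) \<le> C"
proof -
  obtain r where "(\<lambda>n. N (x n)) \<longlonglongrightarrow> r" using cauchy_convergent_N[OF assms] by blast
  then have "Bseq (\<lambda>n. N (x n))" by (rule convergent_imp_Bseq[OF convergentI])
  then obtain C where "C > 0" "\<And>n. norm (N (x n)) \<le> C" by (auto simp: Bseq_def)
  then show ?thesis using that[of C] by (metis abs_le_D1 real_norm_def)
qed

lemma cauchy_const: "a \<in> D \<Longrightarrow> (\<lambda>n. a) \<in> cauchy"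
  by (rule cauchyI) auto

lemma cauchy_add:
  assumes "x \<in> cauchy" "y \<in> cauchy"
  shows "(\<lambda>n. x n + y n) \<in> cauchy"
proof (rule cauchyI)
  note d = cauchy_mem[OF assms(1)] cauchy_mem[OF assms(2)]
  show "x n + y n \<in> D" for n by (intro add_mem d)
  fix e :: real assume "e > 0"
  then obtain M1 M2 where M: "\<forall>m\<ge>M1. \<forall>n\<ge>M1. N (x m - x n) < e/2" "\<forall>m\<ge>M2. \<forall>n\<ge>M2. N (y m - y n) < e/2"
    using cauchyD[OF assms(1), of "e/2"] cauchyD[OF assms(2), of "e/2"] by auto
  have "N ((x m + y m) - (x n + y n)) < e" if mn: "m \<ge> max M1 M2" "n \<ge> max M1 M2" for m n
  proof -
    have "N ((x m + y m) - (x n + y n)) \<le> N (x m - x n) + N (y m - y n)"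
      unfolding add_diff_add by (intro N_add diff_mem d)
    moreover have "N (x m - x n) < e/2" "N (y m - y n) < e/2" using M mn by auto
    ultimately show ?thesis by linarith
  qed
  then show "\<exists>M. \<forall>m\<ge>M. \<forall>n\<ge>M. N ((x m + y m) - (x n + y n)) < e" by blast
qed

lemma cauchy_mult:
  assumes "x \<in> cauchy" "y \<in> cauchy"
  shows "(\<lambda>n. x n * y n) \<in> cauchy"
proof (rule cauchyI)
  note d = cauchy_mem[OF assms(1)] cauchy_mem[OF assms(2)]
  show "x n * y n \<in> D" for n by (intro mult_mem d)
  fix e :: real assume e: "e > 0"
  obtain C where C: "C > 0" "\<And>n. N (x n) \<le> C" using cauchy_bounded[OF assms(1)] by blast
  obtain C' where C': "C' > 0" "\<And>n. N (y n) \<le> C'" using cauchy_bounded[OF assms(2)] by blast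
  have pos: "e / (2 * C') > 0" "e / (2 * C) > 0" using e C C' by auto
  obtain M1 M2 where M: "\<forall>m\<ge>M1. \<forall>n\<ge>M1. N (x m - x n) < e / (2 * C')"
      "\<forall>m\<ge>M2. \<forall>n\<ge>M2. N (y m - y n) < e / (2 * C)"
    using cauchyD[OF assms(1) pos(1)] cauchyD[OF assms(2) pos(2)] by blast
  have "N (x m * y m - x n * y n) < e" if mn: "m \<ge> max M1 M2" "n \<ge> max M1 M2" for m n
  proof -
    have 1: "N (x m - x n) < e / (2 * C')" "N (y m - y n) < e / (2 * C)" using M mn by auto
    have "N (x m * y m - x n * y n) \<le> N (x m - x n) * N (y m) + N (x n) * N (y m - y n)"
      by (intro N_mult_diff d)
    also have "\<dots> \<le> N (x m - x n) * C' + C * N (y m - y n)"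
      by (intro add_mono mult_left_mono mult_right_mono C C' N_nonneg diff_mem d)
    also have "\<dots> < e / (2 * C') * C' + C * (e / (2 * C))"
      using 1 C(1) C'(1) by (intro add_strict_mono mult_strict_left_mono mult_strict_right_mono)
    also have "\<dots> = e" using C(1) C'(1) by simp
    finally show ?thesis .
  qed
  then show "\<exists>M. \<forall>m\<ge>M. \<forall>n\<ge>M. N (x m * y m - x n * y n) < e" by blast
qed

lemma cauchy_star: "x \<in> cauchy \<Longrightarrow> (\<lambda>n. star (x n)) \<in> cauchy"
  unfolding cauchy_def by (auto simp: star_mem diff_mem N_star simp flip: star_diff)

lemma cauchy_scaleC: "x \<in> cauchy \<Longrightarrow> (\<lambda>n. c *\<^sub>C x n) \<in> cauchy"
  using cauchy_mult[OF cauchy_const[OF scaleC_mem[OF one_mem]], of x c] by (simp add: mult_scaleC_left)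

lemma cauchy_shift:
  assumes "x \<in> cauchy"
  shows "(\<lambda>n. x (n + k)) \<in> cauchy" "(\<lambda>n. N (x (n + k) - x n)) \<longlonglongrightarrow> 0"
proof -
  show "(\<lambda>n. x (n + k)) \<in> cauchy"
  proof (rule cauchyI[OF cauchy_mem[OF assms]])
    fix e :: real assume "e > 0"
    then obtain M where "\<forall>m\<ge>M. \<forall>n\<ge>M. N (x m - x n) < e" using cauchyD[OF assms] by blast
    then show "\<exists>M. \<forall>m\<ge>M. \<forall>n\<ge>M. N (x (m + k) - x (n + k)) < e" by (intro exI[of _ M]) simp
  qed
  show "(\<lambda>n. N (x (n + k) - x n)) \<longlonglongrightarrow> 0"
  proof (rule LIMSEQ_I)
    fix e :: real assume "e > 0"
    then obtain M where "\<forall>m\<ge>M. \<forall>n\<ge>M. N (x m - x n) < e" using cauchyD[OF assms] by blast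
    then show "\<exists>M. \<forall>n\<ge>M. norm (N (x (n + k) - x n) - 0) < e"
      using N_nonneg[OF diff_mem[OF cauchy_mem[OF assms] cauchy_mem[OF assms]]]
      by (intro exI[of _ M]) simp
  qed
qed

section \<open>Square roots in the completion and contractivity of C*-seminorms\<close>

text \<open>The iteration converges to \<open>1 - sqrt (1 - a\<^sup>2)\<close> for self-adjoint \<open>a\<close> with \<open>N a < 1\<close>.\<close>

primrec root_iter :: "nat \<Rightarrow> 'a \<Rightarrow> 'a" where
  "root_iter 0 a = 0"
| "root_iter (Suc k) a = (1/2) *\<^sub>R (a * a + root_iter k a * root_iter k a)"

lemma root_iter_mem: "a \<in> D \<Longrightarrow> root_iter k a \<in> D"
  by (induction k) (auto intro!: zero_mem scaleR_mem add_mem mult_mem)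

lemma root_iter_commute: "a * root_iter k a = root_iter k a * a"
proof (induction k)
  case (Suc k)
  then have "a * (root_iter k a * root_iter k a) = (root_iter k a * root_iter k a) * a"
    by (metis mult.assoc)
  then show ?case by (simp add: algebra_simps)
qed simp

lemma root_iter_star: "star a = a \<Longrightarrow> star (root_iter k a) = root_iter k a"
  by (induction k) (auto simp: scaleR_eq_scaleC star_scaleC star_add star_mult)

text \<open>\<open>r\<close> is the fixed point of the iteration for the scalar \<open>s\<close>,
  namely \<open>1 - sqrt (1 - s\<^sup>2)\<close>. It bounds all iterates and is at the same time the
  contraction factor.\<close>

context
  fixes s r :: real
  assumes s: "0 \<le> s" "s < 1" and r: "0 \<le> r" "r < 1" "s\<^sup>2 + r\<^sup>2 = 2 * r"
begin

lemma root_iter_bound: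
  assumes "a \<in> D" "N a \<le> s"
  shows "N (root_iter k a) \<le> r"
proof (induction k)
  case (Suc k)
  have "N (root_iter (Suc k) a) = (1/2) * N (a * a + root_iter k a * root_iter k a)"
    by (simp add: N_scaleR add_mem mult_mem root_iter_mem assms del: scaleR_half_double)
  also have "\<dots> \<le> (1/2) * (N a * N a + N (root_iter k a) * N (root_iter k a))"
    by (intro mult_left_mono order_trans[OF N_add] add_mono N_mult mult_mem root_iter_mem assms) auto
  also have "\<dots> \<le> (1/2) * (s * s + r * r)"
    using assms Suc s r N_nonneg[OF assms(1)] N_nonneg[OF root_iter_mem[OF assms(1)], of k]
    by (intro mult_left_mono add_mono mult_mono) auto
  also have "\<dots> = r" using r by (simp add: power2_eq_square)
  finally show ?case .
qed (use r in simp)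

lemma root_iter_step:
  assumes "a \<in> D" "N a \<le> s"
  shows "N (root_iter (Suc k) a - root_iter k a) \<le> r ^ Suc k"
proof (induction k)
  case 0
  then show ?case using root_iter_bound[OF assms, of 1] by simp
next
  case (Suc k)
  let ?z = "root_iter (Suc k) a" and ?z' = "root_iter k a"
  have m: "?z \<in> D" "?z' \<in> D" by (intro root_iter_mem assms)+
  have "root_iter (Suc (Suc k)) a - ?z = (1/2) *\<^sub>R (?z * ?z - ?z' * ?z')"
    by (subst (2) root_iter.simps, subst root_iter.simps) (simp only: scaleR_diff_right[symmetric] add_diff_cancel_left)
  then have "N (root_iter (Suc (Suc k)) a - ?z) = (1/2) * N (?z * ?z - ?z' * ?z')"
    using m by (simp add: N_scaleR diff_mem mult_mem del: root_iter.simps)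
  also have "\<dots> \<le> (1/2) * (N (?z - ?z') * N ?z + N ?z' * N (?z - ?z'))"
    using m by (intro mult_left_mono N_mult_diff) auto
  also have "\<dots> \<le> (1/2) * (r ^ Suc k * r + r * r ^ Suc k)"
    using m r by (intro mult_left_mono add_mono mult_mono Suc root_iter_bound assms N_nonneg diff_mem) auto
  finally show ?case by simp
qed

lemma root_iter_tail:
  assumes "a \<in> D" "N a \<le> s"
  shows "N (root_iter (k + j) a - root_iter k a) \<le> r ^ k / (1 - r)"
proof -
  have "N (root_iter (k + j) a - root_iter k a) \<le> (\<Sum>i<j. r ^ (k + i))"
  proof (induction j)
    case (Suc j)
    have m: "root_iter i a \<in> D" for i by (rule root_iter_mem[OF assms(1)])
    have "N (root_iter (k + Suc j) a - root_iter k a)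
        \<le> N (root_iter (Suc (k + j)) a - root_iter (k + j) a) + N (root_iter (k + j) a - root_iter k a)"
      using N_triangle[OF m[of "Suc (k + j)"] m[of "k + j"] m[of k]] by simp
    also have "\<dots> \<le> r ^ (k + j) + (\<Sum>i<j. r ^ (k + i))"
    proof (intro add_mono Suc)
      have "r ^ Suc (k + j) \<le> r ^ (k + j)" using r by (intro power_decreasing) auto
      with root_iter_step[OF assms, of "k + j"]
      show "N (root_iter (Suc (k + j)) a - root_iter (k + j) a) \<le> r ^ (k + j)" by simp
    qed
    finally show ?case by simp
  qed simp
  also have "\<dots> = r ^ k * (\<Sum>i<j. r ^ i)" by (simp add: power_add sum_distrib_left)
  also have "\<dots> \<le> r ^ k * (1 / (1 - r))"
  proof (intro mult_left_mono)
    have "(1 - r) * (\<Sum>i<j. r ^ i) = 1 - r ^ j" by (simp add: sum_gp_strict)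
    also have "\<dots> \<le> 1" using r by simp
    finally show "(\<Sum>i<j. r ^ i) \<le> 1 / (1 - r)" using r by (simp add: field_simps)
  qed (use r in auto)
  finally show ?thesis by simp
qed

text \<open>The constant solves \<open>y = N (a - b) + r * y\<close>, the estimate for one step of
  the iteration. Its independence of \<open>k\<close> is what the diagonal sequence in
  \<open>root_iter_cauchy\<close> requires.\<close>

lemma root_iter_lipschitz:
  assumes "a \<in> D" "N a \<le> s" "b \<in> D" "N b \<le> s"
  shows "N (root_iter k a - root_iter k b) \<le> N (a - b) / (1 - r)"
proof (induction k)
  case 0
  then show ?case using r N_nonneg[OF diff_mem[OF assms(1,3)]] by simp
next
  case (Suc k)
  let ?z = "root_iter k a" and ?z' = "root_iter k b"
  have m: "?z \<in> D" "?z' \<in> D" by (intro root_iter_mem assms)+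
  have "root_iter (Suc k) a - root_iter (Suc k) b = (1/2) *\<^sub>R ((a * a - b * b) + (?z * ?z - ?z' * ?z'))"
    by (simp only: root_iter.simps scaleR_diff_right[symmetric] add_diff_add)
  then have "N (root_iter (Suc k) a - root_iter (Suc k) b) = (1/2) * N ((a * a - b * b) + (?z * ?z - ?z' * ?z'))"
    using m assms by (simp add: N_scaleR add_mem diff_mem mult_mem del: root_iter.simps)
  also have "\<dots> \<le> (1/2) * (N (a * a - b * b) + N (?z * ?z - ?z' * ?z'))"
    using m assms by (intro mult_left_mono N_add diff_mem mult_mem) auto
  also have "\<dots> \<le> (1/2) * ((N (a - b) * N a + N b * N (a - b)) + (N (?z - ?z') * N ?z + N ?z' * N (?z - ?z')))"
    using m assms by (intro mult_left_mono add_mono N_mult_diff) auto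
  also have "\<dots> \<le> (1/2) * ((N (a - b) * 1 + 1 * N (a - b))
      + ((N (a - b) / (1 - r)) * r + r * (N (a - b) / (1 - r))))"
    using m r s N_nonneg[OF diff_mem[OF assms(1,3)]] assms
    by (intro mult_left_mono add_mono mult_mono Suc root_iter_bound assms N_nonneg diff_mem) auto
  also have "\<dots> = N (a - b) / (1 - r)"
  proof -
    define y where "y = N (a - b) / (1 - r)"
    have "N (a - b) = y * (1 - r)" using r by (simp add: y_def)
    then show ?thesis unfolding y_def[symmetric] by (simp add: algebra_simps)
  qed
  finally show ?case .
qed

text \<open>The number of iterations grows along with the index of the sequence, so this diagonal
  represents the limit of the iteration in the completion.\<close>

lemma root_iter_cauchy:
  assumes h: "h \<in> cauchy" "\<And>n. N (h n) \<le> s"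
  shows "(\<lambda>n. root_iter n (h n)) \<in> cauchy"
proof (rule cauchyI)
  note d = cauchy_mem[OF h(1)]
  show "root_iter n (h n) \<in> D" for n by (intro root_iter_mem d)
  have main: "N (root_iter m (h m) - root_iter n (h n)) \<le> N (h m - h n) / (1 - r) + r ^ n / (1 - r)"
    if "n \<le> m" for m n
  proof -
    have "N (root_iter m (h m) - root_iter n (h n))
        \<le> N (root_iter m (h m) - root_iter m (h n)) + N (root_iter m (h n) - root_iter n (h n))"
      by (intro N_triangle root_iter_mem d)
    also have "\<dots> \<le> N (h m - h n) / (1 - r) + r ^ n / (1 - r)"
      using root_iter_tail[OF d h(2), of n "m - n" n] that
      by (intro add_mono root_iter_lipschitz d h) auto
    finally show ?thesis .
  qed
  fix e :: real assume e: "e > 0"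
  have pos: "e * (1 - r) / 2 > 0" using e r by simp
  obtain M1 where M1: "\<forall>m\<ge>M1. \<forall>n\<ge>M1. N (h m - h n) < e * (1 - r) / 2" using cauchyD[OF h(1) pos] by blast
  have "(\<lambda>n. r ^ n) \<longlonglongrightarrow> 0" using r by (intro LIMSEQ_power_zero) auto
  from LIMSEQ_D[OF this pos] obtain M2 where M2: "\<forall>n\<ge>M2. \<bar>r ^ n\<bar> < e * (1 - r) / 2" by auto
  have half: "N (root_iter m (h m) - root_iter n (h n)) < e" if "n \<le> m" "n \<ge> max M1 M2" for m n
  proof -
    have "N (h m - h n) < e * (1 - r) / 2" "r ^ n < e * (1 - r) / 2" using M1 M2 that by auto
    then have "N (h m - h n) / (1 - r) + r ^ n / (1 - r) < e"
      using r by (simp add: add_divide_distrib[symmetric] field_simps)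
    then show ?thesis using main[OF that(1)] by linarith
  qed
  have "N (root_iter m (h m) - root_iter n (h n)) < e" if "m \<ge> max M1 M2" "n \<ge> max M1 M2" for m n
    using half[of n m] half[of m n] that N_minus_commute[OF root_iter_mem[OF d] root_iter_mem[OF d], of m m n n]
    by (cases "n \<le> m") auto
  then show "\<exists>M. \<forall>m\<ge>M. \<forall>n\<ge>M. N (root_iter m (h m) - root_iter n (h n)) < e" by blast
qed

end

text \<open>A self-adjoint \<open>h\<close> of norm less than \<open>1\<close> is the real part of the unitary
  \<open>h + \<i> sqrt (1 - h\<^sup>2)\<close>, on which every C*-seminorm is at most \<open>1\<close>.\<close>

theorem cstar_seminorm_contractive:
  fixes P :: "(nat \<Rightarrow> 'a) \<Rightarrow> real"
  assumes P_nonneg: "\<And>x. x \<in> cauchy \<Longrightarrow> 0 \<le> P x"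
    and P_scale: "\<And>c x. x \<in> cauchy \<Longrightarrow> P (\<lambda>n. c *\<^sub>C x n) = cmod c * P x"
    and P_add: "\<And>x y. x \<in> cauchy \<Longrightarrow> y \<in> cauchy \<Longrightarrow> P (\<lambda>n. x n + y n) \<le> P x + P y"
    and P_mult: "\<And>x y. x \<in> cauchy \<Longrightarrow> y \<in> cauchy \<Longrightarrow> P (\<lambda>n. x n * y n) \<le> P x * P y"
    and P_star: "\<And>x. x \<in> cauchy \<Longrightarrow> P (\<lambda>n. star (x n) * x n) = (P x)\<^sup>2"
    and P_cong: "\<And>x y. x \<in> cauchy \<Longrightarrow> y \<in> cauchy \<Longrightarrow> (\<lambda>n. N (x n - y n)) \<longlonglongrightarrow> 0 \<Longrightarrow> P x = P y"
    and x: "x \<in> cauchy" and lim: "(\<lambda>n. N (x n)) \<longlonglongrightarrow> l"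
  shows "P x \<le> l"
proof -
  \<comment> \<open>By the C*-identity this value equals its own square, so it is 0 or 1.\<close>
  have P1: "P (\<lambda>n. 1) \<le> 1"
  proof -
    have "P (\<lambda>n. 1) = (P (\<lambda>n. 1))\<^sup>2" using P_star[OF cauchy_const[OF one_mem]] by simp
    then show ?thesis by (metis order_refl power2_eq_square mult_cancel_left2 zero_le_one)
  qed
  \<comment> \<open>The C*-identity for the adjoint bounds its squared value by the product of the
    two values of \<open>P\<close>; one factor cancels.\<close>
  have P_inv: "P (\<lambda>n. star (y n)) \<le> P y" if y: "y \<in> cauchy" for y
  proof (cases "P (\<lambda>n. star (y n)) = 0")
    case True
    then show ?thesis using P_nonneg[OF y] by simp
  next
    case False
    have s: "(\<lambda>n. star (y n)) \<in> cauchy" by (rule cauchy_star[OF y])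
    have "(P (\<lambda>n. star (y n)))\<^sup>2 \<le> P y * P (\<lambda>n. star (y n))"
      using P_star[OF s] P_mult[OF y s] by (simp add: star_star)
    then show ?thesis using False P_nonneg[OF s] by (simp add: power2_eq_square)
  qed
  have small: "P h \<le> 1" if h: "h \<in> cauchy" and sa: "\<And>n. star (h n) = h n"
    and s: "0 \<le> s" "s < 1" "\<And>n. N (h n) \<le> s" for h s
  proof -
    define r where "r = 1 - sqrt (1 - s\<^sup>2)"
    have s2: "0 \<le> s\<^sup>2" "s\<^sup>2 < 1" using s by (auto simp: power_less_one_iff)
    then have r: "0 \<le> r" "r < 1" "s\<^sup>2 + r\<^sup>2 = 2 * r"
      by (auto simp: r_def power2_diff)
    note d = cauchy_mem[OF h]
    define y where "y n = root_iter n (h n)" for n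
    have y: "y \<in> cauchy" unfolding y_def using root_iter_cauchy[OF s(1,2) r h s(3)] .
    have ys: "star (y n) = y n" for n unfolding y_def by (rule root_iter_star[OF sa])
    have hy: "h n * y n = y n * h n" for n unfolding y_def by (rule root_iter_commute)
    define w where "w n = h n + \<i> *\<^sub>C (1 - y n)" for n
    have my: "(\<lambda>n. 1 - y n) \<in> cauchy"
      using cauchy_add[OF cauchy_const[OF one_mem] cauchy_scaleC[OF y, of "- 1"]] by (simp add: scaleC_minus_one)
    have w: "w \<in> cauchy" unfolding w_def by (intro cauchy_add cauchy_scaleC h my)
    have sw: "star (w n) = h n - \<i> *\<^sub>C (1 - y n)" for n
      using scaleC_scaleC[of "- 1" \<i> "1 - y n"]
      by (simp add: w_def star_add star_scaleC star_diff sa ys scaleC_minus_one)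
    \<comment> \<open>With the exact limit in place of \<open>y\<close>, the squares of
      \<open>h\<close> and \<open>1 - y\<close> would add up to 1 and \<open>w\<close> would be
      unitary; at stage \<open>n\<close> the defect is twice the next increment of the
      iteration.\<close>
    have ww: "star (w n) * w n = 1 + 2 *\<^sub>R (root_iter (Suc n) (h n) - root_iter n (h n))" for n
    proof -
      let ?t = "1 - y n"
      have "star (w n) * w n = h n * h n + \<i> *\<^sub>C (h n * ?t - ?t * h n) - \<i> *\<^sub>C (\<i> *\<^sub>C (?t * ?t))"
        by (subst sw) (simp add: w_def algebra_simps mult_scaleC_left mult_scaleC_right scaleC_diff_right scaleC_add_right)
      also have "h n * ?t - ?t * h n = 0" by (simp add: algebra_simps hy)
      also have "\<i> *\<^sub>C (\<i> *\<^sub>C (?t * ?t)) = - (?t * ?t)" by (simp add: scaleC_scaleC scaleC_minus_one)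
      also have "h n * h n + \<i> *\<^sub>C 0 - - (?t * ?t) = 1 + 2 *\<^sub>R ((1/2) *\<^sub>R (h n * h n + y n * y n) - y n)"
        by (simp add: algebra_simps scaleR_2)
      finally show ?thesis by (simp add: y_def)
    qed
    have "P (\<lambda>n. star (w n) * w n) = P (\<lambda>n. 1)"
    proof (rule P_cong[OF cauchy_mult[OF cauchy_star[OF w] w] cauchy_const[OF one_mem]])
      have le: "N (star (w n) * w n - 1) \<le> 2 * r ^ Suc n" for n
      proof -
        have "N (star (w n) * w n - 1) = 2 * N (root_iter (Suc n) (h n) - root_iter n (h n))"
          unfolding ww add_diff_cancel_left' using N_scaleR[OF diff_mem[OF root_iter_mem[OF d] root_iter_mem[OF d]], of 2]
          by (simp del: root_iter.simps)
        then show ?thesis using root_iter_step[OF s(1,2) r d s(3), of n n] by simp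
      qed
      have lim2: "(\<lambda>n. 2 * r ^ Suc n) \<longlonglongrightarrow> 0"
        using tendsto_mult_right_zero[OF LIMSEQ_Suc[OF LIMSEQ_power_zero[of r]]] r by simp
      have ge: "0 \<le> N (star (w n) * w n - 1)" for n
        by (intro N_nonneg diff_mem mult_mem star_mem cauchy_mem[OF w] one_mem)
      have "\<forall>n. norm (N (star (w n) * w n - 1)) \<le> 2 * r ^ Suc n" using le ge by (simp only: real_norm_def abs_of_nonneg) blast
      then show "(\<lambda>n. N (star (w n) * w n - 1)) \<longlonglongrightarrow> 0"
        by (rule Lim_null_comparison[OF always_eventually lim2])
    qed
    then have "(P w)\<^sup>2 \<le> 1" using P1 P_star[OF w] by simp
    then have Pw: "P w \<le> 1" using power2_le_imp_le[of "P w" 1] by simp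
    have "h = (\<lambda>n. (1/2) *\<^sub>C (w n + star (w n)))"
    proof
      fix n
      have "w n + star (w n) = 2 *\<^sub>C h n"
        using scaleC_add_left[of 1 1 "h n"] by (subst sw) (simp add: w_def)
      then show "h n = (1/2) *\<^sub>C (w n + star (w n))" by (simp add: scaleC_scaleC)
    qed
    then have "P h = (1/2) * P (\<lambda>n. w n + star (w n))"
      using P_scale[OF cauchy_add[OF w cauchy_star[OF w]], of "1/2"] by (simp add: norm_divide)
    also have "\<dots> \<le> (1/2) * (P w + P (\<lambda>n. star (w n)))" using P_add[OF w cauchy_star[OF w]] by simp
    also have "\<dots> \<le> 1" using Pw P_inv[OF w] by simp
    finally show ?thesis .
  qed
  have selfadj: "P h \<le> l" if h: "h \<in> cauchy" and sa: "\<And>n. star (h n) = h n" and l: "(\<lambda>n. N (h n)) \<longlonglongrightarrow> l" for h l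
  proof (rule field_le_epsilon)
    fix e :: real assume e: "e > 0"
    note d = cauchy_mem[OF h]
    have l0: "l \<ge> 0" by (rule LIMSEQ_le_const[OF l]) (use N_nonneg[OF d] in auto)
    define c where "c = l + e"
    have c: "c > 0" using l0 e by (simp add: c_def)
    \<comment> \<open>The bound may fail for early terms; shifting by \<open>M\<close> makes it hold
      for all indices without changing \<open>P\<close>. Half of \<open>e\<close> keeps the quotient
      by \<open>c\<close> strictly below 1.\<close>
    obtain M where M: "\<And>n. n \<ge> M \<Longrightarrow> N (h n) < l + e/2"
      using order_tendstoD(2)[OF l, of "l + e/2"] e by (auto simp: eventually_sequentially)
    define h' where "h' n = complex_of_real (1 / c) *\<^sub>C h (n + M)" for n
    have h': "h' \<in> cauchy" unfolding h'_def by (intro cauchy_scaleC cauchy_shift(1)[OF h])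
    have "P h' \<le> 1"
    proof (rule small[OF h', of "(l + e/2) / c"])
      show "star (h' n) = h' n" for n by (simp add: h'_def star_scaleC sa)
      show "0 \<le> (l + e/2) / c" "(l + e/2) / c < 1" using c l0 e by (auto simp: c_def)
      show "N (h' n) \<le> (l + e/2) / c" for n
        using M[of "n + M"] c N_scaleC[OF d, of "complex_of_real (1 / c)" "n + M"]
        by (simp add: h'_def norm_divide divide_right_mono less_imp_le)
    qed
    moreover have "P h' = (1 / c) * P (\<lambda>n. h (n + M))"
      unfolding h'_def P_scale[OF cauchy_shift(1)[OF h]] using c by (simp add: norm_divide)
    moreover have "P (\<lambda>n. h (n + M)) = P h" by (rule P_cong[OF cauchy_shift(1)[OF h] h cauchy_shift(2)[OF h]])
    ultimately show "P h \<le> l + e" using c by (simp add: c_def field_simps)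
  qed
  \<comment> \<open>The C*-identity reduces the general case to the self-adjoint one, at the price
    of squaring both sides.\<close>
  have xx: "(\<lambda>n. star (x n) * x n) \<in> cauchy" by (intro cauchy_mult cauchy_star x)
  obtain l' where l': "(\<lambda>n. N (star (x n) * x n)) \<longlonglongrightarrow> l'" using cauchy_convergent_N[OF xx] by blast
  have "(P x)\<^sup>2 \<le> l'"
    unfolding P_star[OF x, symmetric] by (rule selfadj[OF xx _ l']) (simp add: star_mult star_star)
  also have "l' \<le> l\<^sup>2"
  proof (rule LIMSEQ_le[OF l'])
    show "(\<lambda>n. (N (x n))\<^sup>2) \<longlonglongrightarrow> l\<^sup>2" by (intro tendsto_intros lim)
    have "N (star (x n) * x n) \<le> (N (x n))\<^sup>2" for n
      using N_mult[OF star_mem[OF cauchy_mem[OF x]] cauchy_mem[OF x], of n n] N_star[OF cauchy_mem[OF x]]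
      by (simp add: power2_eq_square)
    then show "\<exists>M. \<forall>n\<ge>M. N (star (x n) * x n) \<le> (N (x n))\<^sup>2" by blast
  qed
  finally have "(P x)\<^sup>2 \<le> l\<^sup>2" .
  moreover have "l \<ge> 0" by (rule LIMSEQ_le_const[OF lim]) (use N_nonneg[OF cauchy_mem[OF x]] in auto)
  ultimately show ?thesis by (rule power2_le_imp_le)
qed

end

text \<open>\<open>norm (h a)\<close> is a C*-seminorm in \<open>a\<close>, and every Cauchy
  sequence in the algebra converges, so \<open>cstar_seminorm_contractive\<close> applies to the
  value of \<open>h\<close> at the limit.\<close>

lemma star_automorphism_norm_le:
  assumes "star_automorphism h"
  shows "norm (h a) \<le> norm a"
proof -
  have h: "h (x + y) = h x + h y" "h (c *\<^sub>C x) = c *\<^sub>C h x" "h (x * y) = h x * h y"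
      "h (star x) = star (h x)" for x y c
    using assms by (auto simp: star_automorphism_def)
  interpret normed_star_subalgebra UNIV "norm :: 'a \<Rightarrow> real"
    by unfold_locales (auto simp: norm_triangle_ineq norm_mult_ineq norm_scaleC)
  have c: "x \<in> cauchy \<longleftrightarrow> convergent x" for x
    unfolding Cauchy_convergent_iff[symmetric] cauchy_def Cauchy_def by (simp add: dist_norm)
  have lim: "x \<longlonglongrightarrow> lim x" if "x \<in> cauchy" for x using that c convergent_LIMSEQ_iff by blast
  have "norm (h (lim (\<lambda>n. a))) \<le> norm a"
  proof (rule cstar_seminorm_contractive[where P = "\<lambda>x. norm (h (lim x))"])
    fix x y c assume x: "x \<in> cauchy" and y: "y \<in> cauchy"
    note lx = lim[OF x] and ly = lim[OF y]
    show "norm (h (lim (\<lambda>n. x n + y n))) \<le> norm (h (lim x)) + norm (h (lim y))"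
      using limI[OF tendsto_add[OF lx ly]] by (simp add: h norm_triangle_ineq)
    show "norm (h (lim (\<lambda>n. x n * y n))) \<le> norm (h (lim x)) * norm (h (lim y))"
      using limI[OF tendsto_mult[OF lx ly]] by (simp add: h norm_mult_ineq)
    assume "(\<lambda>n. norm (x n - y n)) \<longlonglongrightarrow> 0"
    then have "(\<lambda>n. x n - y n) \<longlonglongrightarrow> 0" by (rule tendsto_norm_zero_cancel)
    then have "lim x - lim y = 0" using tendsto_diff[OF lx ly] LIMSEQ_unique by blast
    then show "norm (h (lim x)) = norm (h (lim y))" by simp
  next
    fix x c assume x: "x \<in> cauchy"
    note lx = lim[OF x]
    show "norm (h (lim (\<lambda>n. c *\<^sub>C x n))) = cmod c * norm (h (lim x))"
      using limI[OF bounded_linear.tendsto[OF bounded_linear_scaleC_right lx]] by (simp add: h norm_scaleC)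
    show "norm (h (lim (\<lambda>n. star (x n) * x n))) = (norm (h (lim x)))\<^sup>2"
      using limI[OF tendsto_mult[OF bounded_linear.tendsto[OF bounded_linear_star lx] lx]]
      by (simp add: h norm_star_mult_self)
  qed (auto intro: cauchy_const)
  then show ?thesis by simp
qed

lemma star_automorphism_norm:
  assumes "star_automorphism h"
  shows "norm (h a) = norm a"
proof (rule antisym[OF star_automorphism_norm_le[OF assms]])
  have bij: "bij h" using assms by (simp add: star_automorphism_def)
  have 1: "inv_into UNIV h (h x) = x" "h (inv_into UNIV h x) = x" for x
    using bij by (auto simp: bij_is_inj bij_is_surj surj_f_inv_f)
  have inj: "h x = h y \<Longrightarrow> x = y" for x y using bij by (auto simp: bij_def inj_def)
  have h: "h (x + y) = h x + h y" "h (c *\<^sub>C x) = c *\<^sub>C h x" "h (x * y) = h x * h y"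
      "h (star x) = star (h x)" for x y c
    using assms by (auto simp: star_automorphism_def)
  have "star_automorphism (inv_into UNIV h)"
    unfolding star_automorphism_def
    by (intro conjI allI bij_imp_bij_inv[OF bij]; rule inj; simp add: 1 h)
  from star_automorphism_norm_le[OF this, of "h a"] show "norm a \<le> norm (h a)" by (simp add: 1)
qed

section \<open>Cauchy classes and their operations, computed through a representation\<close>

section \<open>Completions of represented algebras\<close>

text \<open>The locale covers both the factor system algebra and its l1-completion under the
  greatest C*-seminorm; for the latter, injectivity of \<open>\<pi>\<close> is not at hand.
  Subtraction in \<open>X\<close> is defined through a unique-choice inverse, hence it has
  assumptions of its own.\<close>

locale represented_algebra = normed_star_subalgebra D N
  for D :: "'a::unital_cstar_algebra set" and N :: "'a \<Rightarrow> real" +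
  fixes X :: "'x seminormed_star_algebra" and \<pi> :: "'x \<Rightarrow> 'a"
  assumes image: "\<pi> ` carrier X = D"
    and seminorm: "x \<in> carrier X \<Longrightarrow> seminorm X x = N (\<pi> x)"
    and one_closed: "\<one>\<^bsub>X\<^esub> \<in> carrier X" and \<pi>_one: "\<pi> \<one>\<^bsub>X\<^esub> = 1"
    and zero_closed: "\<zero>\<^bsub>X\<^esub> \<in> carrier X" and \<pi>_zero: "\<pi> \<zero>\<^bsub>X\<^esub> = 0"
    and add_closed: "x \<in> carrier X \<Longrightarrow> y \<in> carrier X \<Longrightarrow> x \<oplus>\<^bsub>X\<^esub> y \<in> carrier X"
    and \<pi>_add: "x \<in> carrier X \<Longrightarrow> y \<in> carrier X \<Longrightarrow> \<pi> (x \<oplus>\<^bsub>X\<^esub> y) = \<pi> x + \<pi> y"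
    and minus_closed: "x \<in> carrier X \<Longrightarrow> y \<in> carrier X \<Longrightarrow> x \<ominus>\<^bsub>X\<^esub> y \<in> carrier X"
    and \<pi>_minus: "x \<in> carrier X \<Longrightarrow> y \<in> carrier X \<Longrightarrow> \<pi> (x \<ominus>\<^bsub>X\<^esub> y) = \<pi> x - \<pi> y"
    and mult_closed: "x \<in> carrier X \<Longrightarrow> y \<in> carrier X \<Longrightarrow> x \<otimes>\<^bsub>X\<^esub> y \<in> carrier X"
    and \<pi>_mult: "x \<in> carrier X \<Longrightarrow> y \<in> carrier X \<Longrightarrow> \<pi> (x \<otimes>\<^bsub>X\<^esub> y) = \<pi> x * \<pi> y"
    and cscale_closed: "x \<in> carrier X \<Longrightarrow> cscale X c x \<in> carrier X"
    and \<pi>_cscale: "x \<in> carrier X \<Longrightarrow> \<pi> (cscale X c x) = c *\<^sub>C \<pi> x"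
    and involution_closed: "x \<in> carrier X \<Longrightarrow> involution X x \<in> carrier X"
    and \<pi>_involution: "x \<in> carrier X \<Longrightarrow> \<pi> (involution X x) = star (\<pi> x)"
begin

lemma \<pi>_mem: "x \<in> carrier X \<Longrightarrow> \<pi> x \<in> D" using image by blast

abbreviation CS :: "(nat \<Rightarrow> 'x) set" where "CS \<equiv> cauchy_sequences X"

definition cls :: "(nat \<Rightarrow> 'x) \<Rightarrow> (nat \<Rightarrow> 'x) set" where
  "cls x = cauchy_equiv X `` {x}"

lemma CS_iff: "x \<in> CS \<longleftrightarrow> (\<forall>n. x n \<in> carrier X) \<and> (\<lambda>n. \<pi> (x n)) \<in> cauchy"
proof (cases "\<forall>n. x n \<in> carrier X")
  case True
  then have "seminorm X (x m \<ominus>\<^bsub>X\<^esub> x n) = N (\<pi> (x m) - \<pi> (x n))" for m n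
    by (simp add: seminorm minus_closed \<pi>_minus)
  then show ?thesis using True by (simp add: cauchy_sequences_def cauchy_def \<pi>_mem)
qed (auto simp: cauchy_sequences_def)

lemma CS_carrier: "x \<in> CS \<Longrightarrow> x n \<in> carrier X" by (simp add: CS_iff)

lemma CS_cauchy: "x \<in> CS \<Longrightarrow> (\<lambda>n. \<pi> (x n)) \<in> cauchy" by (simp add: CS_iff)

lemma cauchy_equiv_iff:
  "(x, y) \<in> cauchy_equiv X \<longleftrightarrow> x \<in> CS \<and> y \<in> CS \<and> (\<lambda>n. N (\<pi> (x n) - \<pi> (y n))) \<longlonglongrightarrow> 0"
proof (cases "x \<in> CS \<and> y \<in> CS")
  case True
  then have c: "\<And>n. x n \<in> carrier X" "\<And>n. y n \<in> carrier X" by (simp_all add: CS_iff)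
  then have "seminorm X (x n \<ominus>\<^bsub>X\<^esub> y n) = N (\<pi> (x n) - \<pi> (y n))" for n
    by (simp add: seminorm minus_closed \<pi>_minus)
  then show ?thesis using True by (simp add: cauchy_equiv_def)
qed (auto simp: cauchy_equiv_def)

lemma equiv_cauchy_equiv: "equiv CS (cauchy_equiv X)"
proof (rule equivI)
  show "cauchy_equiv X \<subseteq> CS \<times> CS" by (auto simp: cauchy_equiv_iff)
  show "refl_on CS (cauchy_equiv X)" by (rule refl_onI) (simp add: cauchy_equiv_iff)
  show "sym (cauchy_equiv X)"
  proof (rule symI)
    fix x y assume "(x, y) \<in> cauchy_equiv X"
    then have C: "x \<in> CS" "y \<in> CS" and l: "(\<lambda>n. N (\<pi> (x n) - \<pi> (y n))) \<longlonglongrightarrow> 0"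
      by (auto simp: cauchy_equiv_iff)
    have "N (\<pi> (x n) - \<pi> (y n)) = N (\<pi> (y n) - \<pi> (x n))" for n
      by (rule N_minus_commute[OF \<pi>_mem[OF CS_carrier[OF C(1)]] \<pi>_mem[OF CS_carrier[OF C(2)]]])
    then show "(y, x) \<in> cauchy_equiv X" using C l by (simp add: cauchy_equiv_iff)
  qed
  show "trans (cauchy_equiv X)"
  proof (rule transI)
    fix x y z assume "(x, y) \<in> cauchy_equiv X" "(y, z) \<in> cauchy_equiv X"
    then have C: "x \<in> CS" "y \<in> CS" "z \<in> CS"
      and l: "(\<lambda>n. N (\<pi> (x n) - \<pi> (y n))) \<longlonglongrightarrow> 0" "(\<lambda>n. N (\<pi> (y n) - \<pi> (z n))) \<longlonglongrightarrow> 0"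
      by (auto simp: cauchy_equiv_iff)
    note m = \<pi>_mem[OF CS_carrier[OF C(1)]] \<pi>_mem[OF CS_carrier[OF C(2)]] \<pi>_mem[OF CS_carrier[OF C(3)]]
    have "\<forall>n. norm (N (\<pi> (x n) - \<pi> (z n))) \<le> N (\<pi> (x n) - \<pi> (y n)) + N (\<pi> (y n) - \<pi> (z n))"
      using N_triangle[OF m] N_nonneg[OF diff_mem[OF m(1,3)]] by simp
    moreover have "(\<lambda>n. N (\<pi> (x n) - \<pi> (y n)) + N (\<pi> (y n) - \<pi> (z n))) \<longlonglongrightarrow> 0"
      using tendsto_add[OF l] by simp
    ultimately have "(\<lambda>n. N (\<pi> (x n) - \<pi> (z n))) \<longlonglongrightarrow> 0"
      by (rule Lim_null_comparison[OF always_eventually])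
    then show "(x, z) \<in> cauchy_equiv X" using C by (simp add: cauchy_equiv_iff)
  qed
qed

lemma cls_eq_iff:
  "x \<in> CS \<Longrightarrow> y \<in> CS \<Longrightarrow> cls x = cls y \<longleftrightarrow> (\<lambda>n. N (\<pi> (x n) - \<pi> (y n))) \<longlonglongrightarrow> 0"
  unfolding cls_def by (simp add: eq_equiv_class_iff[OF equiv_cauchy_equiv] cauchy_equiv_iff)

lemma cls_eqI: "x \<in> CS \<Longrightarrow> y \<in> CS \<Longrightarrow> (\<And>n. \<pi> (x n) = \<pi> (y n)) \<Longrightarrow> cls x = cls y"
  by (simp add: cls_eq_iff)

lemma mem_cls_iff: "y \<in> cls x \<longleftrightarrow> x \<in> CS \<and> y \<in> CS \<and> cls y = cls x"
  using cls_eq_iff[of x y] by (auto simp: cls_def cauchy_equiv_iff)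

lemma mem_clsD:
  assumes "y \<in> cls x"
  shows "y \<in> CS" "(\<lambda>n. N (\<pi> (y n) - \<pi> (x n))) \<longlonglongrightarrow> 0"
proof -
  have "x \<in> CS" "y \<in> CS" "cls y = cls x" using assms mem_cls_iff by blast+
  then show "y \<in> CS" "(\<lambda>n. N (\<pi> (y n) - \<pi> (x n))) \<longlonglongrightarrow> 0" using cls_eq_iff[of y x] by simp_all
qed

lemma cls_self: "x \<in> CS \<Longrightarrow> x \<in> cls x" by (simp add: mem_cls_iff)

lemma carrier_completion: "carrier (completion X) = cls ` CS"
  by (auto simp: completion_def quotient_def cls_def)

lemma completionE:
  assumes "P \<in> carrier (completion X)"
  obtains x where "x \<in> CS" "P = cls x"
  using assms by (auto simp: carrier_completion)

lemma CS_const: "a \<in> carrier X \<Longrightarrow> (\<lambda>n. a) \<in> CS"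
  by (simp add: CS_iff cauchy_const \<pi>_mem)

lemma CS_add:
  assumes x: "x \<in> CS" and y: "y \<in> CS"
  shows "(\<lambda>n. x n \<oplus>\<^bsub>X\<^esub> y n) \<in> CS"
  using cauchy_add[OF CS_cauchy[OF x] CS_cauchy[OF y]]
  by (simp add: CS_iff add_closed \<pi>_add CS_carrier[OF x] CS_carrier[OF y])

lemma CS_mult:
  assumes x: "x \<in> CS" and y: "y \<in> CS"
  shows "(\<lambda>n. x n \<otimes>\<^bsub>X\<^esub> y n) \<in> CS"
  using cauchy_mult[OF CS_cauchy[OF x] CS_cauchy[OF y]]
  by (simp add: CS_iff mult_closed \<pi>_mult CS_carrier[OF x] CS_carrier[OF y])

lemma CS_cscale:
  assumes x: "x \<in> CS"
  shows "(\<lambda>n. cscale X c (x n)) \<in> CS"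
  using cauchy_scaleC[OF CS_cauchy[OF x]]
  by (simp add: CS_iff cscale_closed \<pi>_cscale CS_carrier[OF x])

lemma CS_involution:
  assumes x: "x \<in> CS"
  shows "(\<lambda>n. involution X (x n)) \<in> CS"
  using cauchy_star[OF CS_cauchy[OF x]]
  by (simp add: CS_iff involution_closed \<pi>_involution CS_carrier[OF x])

lemma CS_minus:
  assumes x: "x \<in> CS" and y: "y \<in> CS"
  shows "(\<lambda>n. x n \<ominus>\<^bsub>X\<^esub> y n) \<in> CS"
  using cauchy_add[OF CS_cauchy[OF x] cauchy_scaleC[OF CS_cauchy[OF y], of "- 1"]]
  by (simp add: CS_iff minus_closed \<pi>_minus scaleC_minus_one CS_carrier[OF x] CS_carrier[OF y])

lemma null_bound:
  assumes "\<And>n. a n \<in> D" "\<And>n. N (a n) \<le> f n" "f \<longlonglongrightarrow> 0"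
  shows "(\<lambda>n. N (a n)) \<longlonglongrightarrow> 0"
proof -
  have "\<forall>n. norm (N (a n)) \<le> f n" by (simp add: abs_of_nonneg N_nonneg assms(1,2))
  then show ?thesis by (rule Lim_null_comparison[OF always_eventually assms(3)])
qed

lemma completion_mult:
  assumes x: "x \<in> CS" and y: "y \<in> CS"
  shows "cls x \<otimes>\<^bsub>completion X\<^esub> cls y = cls (\<lambda>n. x n \<otimes>\<^bsub>X\<^esub> y n)"
proof -
  have "cls (\<lambda>n. x' n \<otimes>\<^bsub>X\<^esub> y' n) = cls (\<lambda>n. x n \<otimes>\<^bsub>X\<^esub> y n)" if "x' \<in> cls x" "y' \<in> cls y" for x' y'
  proof -
    note x' = mem_clsD[OF that(1)]
    note y' = mem_clsD[OF that(2)]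
    note c = CS_carrier[OF x'(1)] CS_carrier[OF y'(1)] CS_carrier[OF x] CS_carrier[OF y]
    note m = c[THEN \<pi>_mem]
    obtain C where C: "\<And>n. N (\<pi> (y' n)) \<le> C" using cauchy_bounded[OF CS_cauchy[OF y'(1)]] by blast
    obtain C' where C': "\<And>n. N (\<pi> (x n)) \<le> C'" using cauchy_bounded[OF CS_cauchy[OF x]] by blast
    have "(\<lambda>n. N (\<pi> (x' n) * \<pi> (y' n) - \<pi> (x n) * \<pi> (y n))) \<longlonglongrightarrow> 0"
    proof (rule null_bound)
      show "\<pi> (x' n) * \<pi> (y' n) - \<pi> (x n) * \<pi> (y n) \<in> D" for n by (intro diff_mem mult_mem m)
      show "N (\<pi> (x' n) * \<pi> (y' n) - \<pi> (x n) * \<pi> (y n))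
          \<le> N (\<pi> (x' n) - \<pi> (x n)) * C + C' * N (\<pi> (y' n) - \<pi> (y n))" for n
        by (intro order_trans[OF N_mult_diff] add_mono mult_left_mono mult_right_mono C C' N_nonneg diff_mem m)
      show "(\<lambda>n. N (\<pi> (x' n) - \<pi> (x n)) * C + C' * N (\<pi> (y' n) - \<pi> (y n))) \<longlonglongrightarrow> 0"
        using tendsto_add[OF tendsto_mult_left_zero[OF x'(2)] tendsto_mult_right_zero[OF y'(2)]] by simp
    qed
    then show ?thesis
      by (simp add: cls_eq_iff[OF CS_mult[OF x'(1) y'(1)] CS_mult[OF x y]] \<pi>_mult c)
  qed
  then have "(\<Union>x'\<in>cls x. \<Union>y'\<in>cls y. cls (\<lambda>n. x' n \<otimes>\<^bsub>X\<^esub> y' n)) = cls (\<lambda>n. x n \<otimes>\<^bsub>X\<^esub> y n)"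
    using cls_self[OF x] cls_self[OF y] by blast
  then show ?thesis by (simp add: completion_def cls_def)
qed

lemma completion_add:
  assumes x: "x \<in> CS" and y: "y \<in> CS"
  shows "cls x \<oplus>\<^bsub>completion X\<^esub> cls y = cls (\<lambda>n. x n \<oplus>\<^bsub>X\<^esub> y n)"
proof -
  have "cls (\<lambda>n. x' n \<oplus>\<^bsub>X\<^esub> y' n) = cls (\<lambda>n. x n \<oplus>\<^bsub>X\<^esub> y n)" if "x' \<in> cls x" "y' \<in> cls y" for x' y'
  proof -
    note x' = mem_clsD[OF that(1)]
    note y' = mem_clsD[OF that(2)]
    note c = CS_carrier[OF x'(1)] CS_carrier[OF y'(1)] CS_carrier[OF x] CS_carrier[OF y]
    note m = c[THEN \<pi>_mem]
    have "(\<lambda>n. N ((\<pi> (x' n) + \<pi> (y' n)) - (\<pi> (x n) + \<pi> (y n)))) \<longlonglongrightarrow> 0"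
    proof (rule null_bound)
      show "(\<pi> (x' n) + \<pi> (y' n)) - (\<pi> (x n) + \<pi> (y n)) \<in> D" for n by (intro diff_mem add_mem m)
      show "N ((\<pi> (x' n) + \<pi> (y' n)) - (\<pi> (x n) + \<pi> (y n))) \<le> N (\<pi> (x' n) - \<pi> (x n)) + N (\<pi> (y' n) - \<pi> (y n))" for n
        unfolding add_diff_add by (intro N_add diff_mem m)
      show "(\<lambda>n. N (\<pi> (x' n) - \<pi> (x n)) + N (\<pi> (y' n) - \<pi> (y n))) \<longlonglongrightarrow> 0"
        using tendsto_add[OF x'(2) y'(2)] by simp
    qed
    then show ?thesis
      by (simp add: cls_eq_iff[OF CS_add[OF x'(1) y'(1)] CS_add[OF x y]] \<pi>_add c)
  qed
  then have "(\<Union>x'\<in>cls x. \<Union>y'\<in>cls y. cls (\<lambda>n. x' n \<oplus>\<^bsub>X\<^esub> y' n)) = cls (\<lambda>n. x n \<oplus>\<^bsub>X\<^esub> y n)"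
    using cls_self[OF x] cls_self[OF y] by blast
  then show ?thesis by (simp add: completion_def cls_def)
qed

lemma completion_cscale:
  assumes x: "x \<in> CS"
  shows "cscale (completion X) c (cls x) = cls (\<lambda>n. cscale X c (x n))"
proof -
  have "cls (\<lambda>n. cscale X c (x' n)) = cls (\<lambda>n. cscale X c (x n))" if "x' \<in> cls x" for x'
  proof -
    note x' = mem_clsD[OF that(1)]
    note c = CS_carrier[OF x'(1)] CS_carrier[OF x]
    note m = c[THEN \<pi>_mem]
    have "(\<lambda>n. N (c *\<^sub>C \<pi> (x' n) - c *\<^sub>C \<pi> (x n))) \<longlonglongrightarrow> 0"
      using tendsto_mult_right_zero[OF x'(2), of "cmod c"]
      by (simp add: scaleC_diff_right[symmetric] N_scaleC diff_mem m)
    then show ?thesis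
      by (simp add: cls_eq_iff[OF CS_cscale[OF x'(1)] CS_cscale[OF x]] \<pi>_cscale c)
  qed
  then have "(\<Union>x'\<in>cls x. cls (\<lambda>n. cscale X c (x' n))) = cls (\<lambda>n. cscale X c (x n))"
    using cls_self[OF x] by blast
  then show ?thesis by (simp add: completion_def cls_def)
qed

lemma completion_involution:
  assumes x: "x \<in> CS"
  shows "involution (completion X) (cls x) = cls (\<lambda>n. involution X (x n))"
proof -
  have "cls (\<lambda>n. involution X (x' n)) = cls (\<lambda>n. involution X (x n))" if "x' \<in> cls x" for x'
  proof -
    note x' = mem_clsD[OF that(1)]
    note c = CS_carrier[OF x'(1)] CS_carrier[OF x]
    note m = c[THEN \<pi>_mem]
    have "(\<lambda>n. N (star (\<pi> (x' n)) - star (\<pi> (x n)))) \<longlonglongrightarrow> 0"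
      using x'(2) by (simp add: star_diff[symmetric] N_star diff_mem m)
    then show ?thesis
      by (simp add: cls_eq_iff[OF CS_involution[OF x'(1)] CS_involution[OF x]] \<pi>_involution c)
  qed
  then have "(\<Union>x'\<in>cls x. cls (\<lambda>n. involution X (x' n))) = cls (\<lambda>n. involution X (x n))"
    using cls_self[OF x] by blast
  then show ?thesis by (simp add: completion_def cls_def)
qed

lemma completion_one: "\<one>\<^bsub>completion X\<^esub> = cls (\<lambda>n. \<one>\<^bsub>X\<^esub>)"
  by (simp add: completion_def cls_def)

lemma completion_zero: "\<zero>\<^bsub>completion X\<^esub> = cls (\<lambda>n. \<zero>\<^bsub>X\<^esub>)"
  by (simp add: completion_def cls_def)

lemma completion_seminorm:
  assumes x: "x \<in> CS" and l: "(\<lambda>n. N (\<pi> (x n))) \<longlonglongrightarrow> l"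
  shows "seminorm (completion X) (cls x) = l"
proof -
  have lim: "(\<lambda>n. seminorm X (y n)) \<longlonglongrightarrow> l" if "y \<in> cls x" for y
  proof -
    note y = mem_clsD[OF that]
    have "\<forall>n. norm (N (\<pi> (y n)) - N (\<pi> (x n))) \<le> N (\<pi> (y n) - \<pi> (x n))"
      using N_abs_diff[OF \<pi>_mem[OF CS_carrier[OF y(1)]] \<pi>_mem[OF CS_carrier[OF x]]] by simp
    then have "(\<lambda>n. N (\<pi> (y n)) - N (\<pi> (x n))) \<longlonglongrightarrow> 0"
      by (rule Lim_null_comparison[OF always_eventually y(2)])
    from tendsto_add[OF this l] show ?thesis by (simp add: seminorm CS_carrier[OF y(1)])
  qed
  have "(THE r. \<forall>y\<in>cls x. (\<lambda>n. seminorm X (y n)) \<longlonglongrightarrow> r) = l"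
  proof (rule the_equality)
    fix r assume "\<forall>y\<in>cls x. (\<lambda>n. seminorm X (y n)) \<longlonglongrightarrow> r"
    then show "r = l" using lim cls_self[OF x] LIMSEQ_unique by blast
  qed (use lim in blast)
  then show ?thesis by (simp add: completion_def)
qed

text \<open>Subtraction in the completion is defined through additive inverses, so the group laws
  are required to compute it on representatives.\<close>

lemma abelian_group_completion: "abelian_group (completion X)"
proof (rule abelian_groupI)
  note z0 = CS_const[OF zero_closed]
  show "\<zero>\<^bsub>completion X\<^esub> \<in> carrier (completion X)"
    unfolding carrier_completion completion_zero by (rule imageI[OF z0])
  fix P assume "P \<in> carrier (completion X)"
  then obtain x where x: "x \<in> CS" "P = cls x" by (rule completionE)
  note cx = CS_carrier[OF x(1)]
  show "\<zero>\<^bsub>completion X\<^esub> \<oplus>\<^bsub>completion X\<^esub> P = P"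
    unfolding x(2) completion_zero completion_add[OF z0 x(1)]
    by (rule cls_eqI[OF CS_add[OF z0 x(1)] x(1)]) (simp add: \<pi>_add \<pi>_zero zero_closed cx)
  \<comment> \<open>The inverse is represented termwise as zero minus \<open>x\<close>; its image
    under \<open>\<pi>\<close> decides the class.\<close>
  have m: "(\<lambda>n. \<zero>\<^bsub>X\<^esub> \<ominus>\<^bsub>X\<^esub> x n) \<in> CS" by (rule CS_minus[OF z0 x(1)])
  have "cls (\<lambda>n. \<zero>\<^bsub>X\<^esub> \<ominus>\<^bsub>X\<^esub> x n) \<oplus>\<^bsub>completion X\<^esub> P = \<zero>\<^bsub>completion X\<^esub>"
    unfolding x(2) completion_zero completion_add[OF m x(1)]
    by (rule cls_eqI[OF CS_add[OF m x(1)] z0]) (simp add: \<pi>_add \<pi>_zero \<pi>_minus minus_closed zero_closed cx)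
  then show "\<exists>Q\<in>carrier (completion X). Q \<oplus>\<^bsub>completion X\<^esub> P = \<zero>\<^bsub>completion X\<^esub>"
    unfolding carrier_completion using imageI[OF m, of cls] by (rule bexI)
  fix Q assume "Q \<in> carrier (completion X)"
  then obtain y where y: "y \<in> CS" "Q = cls y" by (rule completionE)
  note cy = CS_carrier[OF y(1)]
  show "P \<oplus>\<^bsub>completion X\<^esub> Q \<in> carrier (completion X)"
    unfolding x(2) y(2) completion_add[OF x(1) y(1)] carrier_completion
    by (rule imageI[OF CS_add[OF x(1) y(1)]])
  show "P \<oplus>\<^bsub>completion X\<^esub> Q = Q \<oplus>\<^bsub>completion X\<^esub> P"
    unfolding x(2) y(2) completion_add[OF x(1) y(1)] completion_add[OF y(1) x(1)]
    by (rule cls_eqI[OF CS_add[OF x(1) y(1)] CS_add[OF y(1) x(1)]]) (simp add: \<pi>_add cx cy)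
  fix R assume "R \<in> carrier (completion X)"
  then obtain z where z: "z \<in> CS" "R = cls z" by (rule completionE)
  note cz = CS_carrier[OF z(1)]
  note xy = CS_add[OF x(1) y(1)] and yz = CS_add[OF y(1) z(1)]
  show "(P \<oplus>\<^bsub>completion X\<^esub> Q) \<oplus>\<^bsub>completion X\<^esub> R = P \<oplus>\<^bsub>completion X\<^esub> (Q \<oplus>\<^bsub>completion X\<^esub> R)"
    unfolding x(2) y(2) z(2) completion_add[OF x(1) y(1)] completion_add[OF y(1) z(1)]
      completion_add[OF xy z(1)] completion_add[OF x(1) yz]
    by (rule cls_eqI[OF CS_add[OF xy z(1)] CS_add[OF x(1) yz]]) (simp add: \<pi>_add add_closed cx cy cz add.assoc)
qed

lemma completion_minus:
  assumes x: "x \<in> CS" and y: "y \<in> CS"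
  shows "cls x \<ominus>\<^bsub>completion X\<^esub> cls y = cls (\<lambda>n. x n \<ominus>\<^bsub>X\<^esub> y n)"
proof -
  interpret C: abelian_group "completion X" by (rule abelian_group_completion)
  have c: "cls x \<in> carrier (completion X)" "cls y \<in> carrier (completion X)"
      "cls (\<lambda>n. x n \<ominus>\<^bsub>X\<^esub> y n) \<in> carrier (completion X)"
    using x y CS_minus by (auto simp: carrier_completion)
  have eq: "cls (\<lambda>n. x n \<ominus>\<^bsub>X\<^esub> y n) \<oplus>\<^bsub>completion X\<^esub> cls y = cls x"
    unfolding completion_add[OF CS_minus[OF x y] y]
    by (rule cls_eqI[OF CS_add[OF CS_minus[OF x y] y] x])
      (simp add: \<pi>_add \<pi>_minus minus_closed CS_carrier[OF x] CS_carrier[OF y])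
  show ?thesis
    unfolding a_minus_def[of "completion X"] eq[symmetric] C.a_assoc[OF c(3) c(2) C.a_inv_closed[OF c(2)]] C.r_neg[OF c(2)]
    by (rule C.r_zero[OF c(3)])
qed

text \<open>Only representatives matter, so a C*-seminorm on the completion is a C*-seminorm on the
  Cauchy sequences in \<open>D\<close>.\<close>

lemma completion_seminorm_contractive:
  assumes p: "cstar_seminorm (completion X) p" and x: "x \<in> CS" and l: "(\<lambda>n. N (\<pi> (x n))) \<longlonglongrightarrow> l"
  shows "p (cls x) \<le> l"
proof -
  \<comment> \<open>An arbitrary section of \<open>\<pi>\<close>: the class of a sequence depends
    only on its image, so the choice does not matter.\<close>
  define \<rho> where "\<rho> d = inv_into (carrier X) \<pi> d" for d
  have \<rho>: "\<rho> d \<in> carrier X" "\<pi> (\<rho> d) = d" if "d \<in> D" for d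
    using that image unfolding \<rho>_def by (auto intro: inv_into_into f_inv_into_f)
  define L where "L d = (\<lambda>n::nat. \<rho> (d n))" for d
  have L: "L d \<in> CS" if "d \<in> cauchy" for d
  proof -
    have "L d n \<in> carrier X" "\<pi> (L d n) = d n" for n
      unfolding L_def using \<rho>[OF cauchy_mem[OF that]] by auto
    then show ?thesis using that by (simp add: CS_iff)
  qed
  have \<pi>L: "\<pi> (L d n) = d n" if "d \<in> cauchy" for d n
    unfolding L_def using \<rho>[OF cauchy_mem[OF that]] by auto
  have Lc: "L d n \<in> carrier X" if "d \<in> cauchy" for d n using CS_carrier[OF L[OF that]] .
  have c: "cls (L d) \<in> carrier (completion X)" if "d \<in> cauchy" for d
    using L[OF that] by (auto simp: carrier_completion)
  have pp: "0 \<le> p P" "p (cscale (completion X) c P) = cmod c * p P"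
      "p (P \<oplus>\<^bsub>completion X\<^esub> Q) \<le> p P + p Q" "p (P \<otimes>\<^bsub>completion X\<^esub> Q) \<le> p P * p Q"
      "p (involution (completion X) P \<otimes>\<^bsub>completion X\<^esub> P) = (p P)\<^sup>2"
    if "P \<in> carrier (completion X)" "Q \<in> carrier (completion X)" for P Q c
    using p that by (auto simp: cstar_seminorm_def)
  have d0: "(\<lambda>n. \<pi> (x n)) \<in> cauchy" by (rule CS_cauchy[OF x])
  have "p (cls (L (\<lambda>n. \<pi> (x n)))) \<le> l"
  proof (rule cstar_seminorm_contractive[where P = "\<lambda>d. p (cls (L d))" and x = "\<lambda>n. \<pi> (x n)", OF _ _ _ _ _ _ d0 l])
    fix d :: "nat \<Rightarrow> 'a" assume d: "d \<in> cauchy"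
    show "0 \<le> p (cls (L d))" using pp(1)[OF c[OF d] c[OF d]] .
    show "p (cls (L (\<lambda>n. k *\<^sub>C d n))) = cmod k * p (cls (L d))" for k
    proof -
      have "cls (L (\<lambda>n. k *\<^sub>C d n)) = cscale (completion X) k (cls (L d))"
        unfolding completion_cscale[OF L[OF d]]
        by (intro cls_eqI L CS_cscale cauchy_scaleC d) (simp add: \<pi>L \<pi>_cscale Lc d cauchy_scaleC)
      then show ?thesis using pp(2)[OF c[OF d] c[OF d]] by simp
    qed
    show "p (cls (L (\<lambda>n. star (d n) * d n))) = (p (cls (L d)))\<^sup>2"
    proof -
      have "cls (L (\<lambda>n. star (d n) * d n)) = involution (completion X) (cls (L d)) \<otimes>\<^bsub>completion X\<^esub> cls (L d)"
        unfolding completion_involution[OF L[OF d]] completion_mult[OF CS_involution[OF L[OF d]] L[OF d]]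
        by (intro cls_eqI L CS_mult CS_involution cauchy_mult cauchy_star d)
          (simp add: \<pi>L \<pi>_mult \<pi>_involution involution_closed Lc d cauchy_mult cauchy_star)
      then show ?thesis using pp(5)[OF c[OF d] c[OF d]] by simp
    qed
    fix e :: "nat \<Rightarrow> 'a" assume e: "e \<in> cauchy"
    show "p (cls (L (\<lambda>n. d n + e n))) \<le> p (cls (L d)) + p (cls (L e))"
    proof -
      have "cls (L (\<lambda>n. d n + e n)) = cls (L d) \<oplus>\<^bsub>completion X\<^esub> cls (L e)"
        unfolding completion_add[OF L[OF d] L[OF e]]
        by (intro cls_eqI L CS_add cauchy_add d e) (simp add: \<pi>L \<pi>_add Lc d e cauchy_add)
      then show ?thesis using pp(3)[OF c[OF d] c[OF e]] by simp
    qed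
    show "p (cls (L (\<lambda>n. d n * e n))) \<le> p (cls (L d)) * p (cls (L e))"
    proof -
      have "cls (L (\<lambda>n. d n * e n)) = cls (L d) \<otimes>\<^bsub>completion X\<^esub> cls (L e)"
        unfolding completion_mult[OF L[OF d] L[OF e]]
        by (intro cls_eqI L CS_mult cauchy_mult d e) (simp add: \<pi>L \<pi>_mult Lc d e cauchy_mult)
      then show ?thesis using pp(4)[OF c[OF d] c[OF e]] by simp
    qed
    show "p (cls (L d)) = p (cls (L e))" if "(\<lambda>n. N (d n - e n)) \<longlonglongrightarrow> 0"
      using that cls_eq_iff[OF L[OF d] L[OF e]] by (simp add: \<pi>L d e)
  qed
  moreover have "cls (L (\<lambda>n. \<pi> (x n))) = cls x" by (intro cls_eqI L d0 x) (simp add: \<pi>L d0)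
  ultimately show ?thesis by simp
qed

end

text \<open>When the seminorm is the norm of the image, a class amounts to the limit of its image in
  the complete algebra; density provides a representing sequence \<open>s a\<close> for every
  \<open>a\<close>.\<close>

lemma (in represented_algebra) completion_isomorphic:
  assumes N: "\<And>a. a \<in> D \<Longrightarrow> N a = norm a" and dense: "closure D = UNIV"
  shows "cstar_isomorphic (algebra_of_type :: 'a seminormed_star_algebra) (completion X)"
proof -
  have "\<exists>x. (\<forall>n. x n \<in> carrier X) \<and> (\<lambda>n. \<pi> (x n)) \<longlonglongrightarrow> a" for a
  proof -
    have "a \<in> closure D" using dense by simp
    then obtain d where d: "\<And>n. d n \<in> D" "d \<longlonglongrightarrow> a" unfolding closure_sequential by blast
    have "\<exists>x. x \<in> carrier X \<and> \<pi> x = d n" for n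
      using d(1)[of n] unfolding image[symmetric] by auto
    then obtain x where "\<And>n. x n \<in> carrier X \<and> \<pi> (x n) = d n" by metis
    then show ?thesis using d by (intro exI[of _ x]) auto
  qed
  then obtain s where s: "\<And>a n. s a n \<in> carrier X" "\<And>a. (\<lambda>n. \<pi> (s a n)) \<longlonglongrightarrow> a" by metis
  have CSc: "x \<in> CS \<longleftrightarrow> (\<forall>n. x n \<in> carrier X) \<and> convergent (\<lambda>n. \<pi> (x n))" for x
    unfolding CS_iff Cauchy_convergent_iff[symmetric] cauchy_def Cauchy_def
    by (auto simp: dist_norm \<pi>_mem diff_mem N)
  have sC: "s a \<in> CS" for a using s CSc convergentI by blast
  have eq: "cls x = cls y" if "x \<in> CS" "y \<in> CS" "(\<lambda>n. \<pi> (x n)) \<longlonglongrightarrow> a" "(\<lambda>n. \<pi> (y n)) \<longlonglongrightarrow> a" for x y a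
  proof -
    have "(\<lambda>n. norm (\<pi> (x n) - \<pi> (y n))) \<longlonglongrightarrow> 0"
      using tendsto_norm[OF tendsto_diff[OF that(3,4)]] by simp
    then show ?thesis
      by (simp add: cls_eq_iff[OF that(1,2)] N diff_mem \<pi>_mem CS_carrier[OF that(1)] CS_carrier[OF that(2)])
  qed
  define h where "h a = cls (s a)" for a
  have hc: "h a \<in> carrier (completion X)" for a using sC by (auto simp: h_def carrier_completion)
  have hI: "h a = cls x" if "x \<in> CS" "(\<lambda>n. \<pi> (x n)) \<longlonglongrightarrow> a" for a x
    unfolding h_def by (rule eq[OF sC that(1) s(2) that(2)])
  have hmult: "h (a * b) = h a \<otimes>\<^bsub>completion X\<^esub> h b" for a b
    unfolding h_def[of a] h_def[of b] completion_mult[OF sC sC]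
    by (rule hI[OF CS_mult[OF sC sC]]) (use tendsto_mult[OF s(2) s(2)] in \<open>simp add: \<pi>_mult s\<close>)
  have hadd: "h (a + b) = h a \<oplus>\<^bsub>completion X\<^esub> h b" for a b
    unfolding h_def[of a] h_def[of b] completion_add[OF sC sC]
    by (rule hI[OF CS_add[OF sC sC]]) (use tendsto_add[OF s(2) s(2)] in \<open>simp add: \<pi>_add s\<close>)
  have hone: "h 1 = \<one>\<^bsub>completion X\<^esub>"
    unfolding completion_one by (rule hI[OF CS_const[OF one_closed]]) (simp add: \<pi>_one)
  have hscale: "h (c *\<^sub>C a) = cscale (completion X) c (h a)" for a c
    unfolding h_def[of a] completion_cscale[OF sC]
    by (rule hI[OF CS_cscale[OF sC]])
      (use bounded_linear.tendsto[OF bounded_linear_scaleC_right s(2)] in \<open>simp add: \<pi>_cscale s\<close>)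
  have hstar: "h (star a) = involution (completion X) (h a)" for a
    unfolding h_def[of a] completion_involution[OF sC]
    by (rule hI[OF CS_involution[OF sC]])
      (use bounded_linear.tendsto[OF bounded_linear_star s(2)] in \<open>simp add: \<pi>_involution s\<close>)
  have hnorm: "seminorm (completion X) (h a) = norm a" for a
    unfolding h_def by (rule completion_seminorm[OF sC]) (use tendsto_norm[OF s(2)] in \<open>simp add: N \<pi>_mem s\<close>)
  have inj: "inj h"
  proof (rule injI)
    fix a b assume "h a = h b"
    then have "(\<lambda>n. norm (\<pi> (s a n) - \<pi> (s b n))) \<longlonglongrightarrow> 0"
      using cls_eq_iff[OF sC sC, of a b] by (simp add: h_def N diff_mem \<pi>_mem s)
    then have "(\<lambda>n. \<pi> (s a n) - \<pi> (s b n)) \<longlonglongrightarrow> 0" by (rule tendsto_norm_zero_cancel)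
    then have "a - b = 0" using tendsto_diff[OF s(2)[of a] s(2)[of b]] LIMSEQ_unique by blast
    then show "a = b" by simp
  qed
  have surj: "range h = carrier (completion X)"
  proof (intro equalityI subsetI)
    fix P assume "P \<in> carrier (completion X)"
    then obtain x where x: "x \<in> CS" "P = cls x" by (rule completionE)
    then obtain a where "(\<lambda>n. \<pi> (x n)) \<longlonglongrightarrow> a" using CSc convergent_def by blast
    then have "h a = P" using hI x by blast
    then show "P \<in> range h" by blast
  qed (use hc in auto)
  have "h \<in> ring_iso algebra_of_type (completion X)"
    unfolding ring_iso_def ring_hom_def bij_betw_def
    using inj surj hc hmult hadd hone by (auto simp: algebra_of_type_def)
  then show ?thesis
    unfolding cstar_isomorphic_def
    by (intro bexI[of _ h]) (auto simp: algebra_of_type_def hscale hstar hnorm)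
qed

section \<open>Extension of the representation to the completion, and the enveloping algebra\<close>

locale dominated_algebra = represented_algebra D N X \<pi>
  for D :: "'a::unital_cstar_algebra set" and N :: "'a \<Rightarrow> real"
    and X :: "'x seminormed_star_algebra" and \<pi> :: "'x \<Rightarrow> 'a" +
  assumes norm_le_N: "a \<in> D \<Longrightarrow> norm a \<le> N a"
begin

text \<open>The continuous extension of \<open>\<pi>\<close> to the completion; domination of the
  norm by \<open>N\<close> makes the limit exist and independent of the representative.\<close>

definition lift :: "(nat \<Rightarrow> 'x) set \<Rightarrow> 'a" where
  "lift P = (THE a. \<forall>x\<in>P. (\<lambda>n. \<pi> (x n)) \<longlonglongrightarrow> a)"

lemma CS_convergent:
  assumes "x \<in> CS"
  obtains a where "(\<lambda>n. \<pi> (x n)) \<longlonglongrightarrow> a"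
proof -
  have "Cauchy (\<lambda>n. \<pi> (x n))"
  proof (rule metric_CauchyI)
    fix e :: real assume "e > 0"
    then obtain M where M: "\<forall>m\<ge>M. \<forall>n\<ge>M. N (\<pi> (x m) - \<pi> (x n)) < e"
      using cauchyD[OF CS_cauchy[OF assms]] by blast
    have "dist (\<pi> (x m)) (\<pi> (x n)) < e" if "m \<ge> M" "n \<ge> M" for m n
    proof -
      have "norm (\<pi> (x m) - \<pi> (x n)) \<le> N (\<pi> (x m) - \<pi> (x n))"
        by (intro norm_le_N diff_mem \<pi>_mem CS_carrier[OF assms])
      also have "\<dots> < e" using M that by blast
      finally show ?thesis by (simp add: dist_norm)
    qed
    then show "\<exists>M. \<forall>m\<ge>M. \<forall>n\<ge>M. dist (\<pi> (x m)) (\<pi> (x n)) < e" by blast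
  qed
  then show ?thesis using that Cauchy_convergent convergent_def by metis
qed

lemma lift_eqI:
  assumes x: "x \<in> CS" and a: "(\<lambda>n. \<pi> (x n)) \<longlonglongrightarrow> a"
  shows "lift (cls x) = a"
  unfolding lift_def
proof (rule the_equality)
  show "\<forall>y\<in>cls x. (\<lambda>n. \<pi> (y n)) \<longlonglongrightarrow> a"
  proof
    fix y assume "y \<in> cls x"
    note y = mem_clsD[OF this]
    have "\<forall>n. norm (\<pi> (y n) - \<pi> (x n)) \<le> N (\<pi> (y n) - \<pi> (x n))"
      by (intro allI norm_le_N diff_mem \<pi>_mem CS_carrier[OF x] CS_carrier[OF y(1)])
    then have "(\<lambda>n. \<pi> (y n) - \<pi> (x n)) \<longlonglongrightarrow> 0" by (rule Lim_null_comparison[OF always_eventually y(2)])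
    from tendsto_add[OF this a] show "(\<lambda>n. \<pi> (y n)) \<longlonglongrightarrow> a" by simp
  qed
  fix b assume "\<forall>y\<in>cls x. (\<lambda>n. \<pi> (y n)) \<longlonglongrightarrow> b"
  then show "b = a" using a cls_self[OF x] LIMSEQ_unique by blast
qed

lemma lift_tendsto: "x \<in> CS \<Longrightarrow> (\<lambda>n. \<pi> (x n)) \<longlonglongrightarrow> lift (cls x)"
  using CS_convergent[of x] lift_eqI[of x] by metis

lemma lift_const: "a \<in> carrier X \<Longrightarrow> lift (cls (\<lambda>n. a)) = \<pi> a"
  by (rule lift_eqI[OF CS_const]) auto

lemma lift_hom:
  assumes x: "x \<in> CS" and y: "y \<in> CS"
  shows "lift (cls x \<oplus>\<^bsub>completion X\<^esub> cls y) = lift (cls x) + lift (cls y)"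
    "lift (cls x \<ominus>\<^bsub>completion X\<^esub> cls y) = lift (cls x) - lift (cls y)"
    "lift (cls x \<otimes>\<^bsub>completion X\<^esub> cls y) = lift (cls x) * lift (cls y)"
    "lift (cscale (completion X) c (cls x)) = c *\<^sub>C lift (cls x)"
    "lift (involution (completion X) (cls x)) = star (lift (cls x))"
proof -
  note l = lift_tendsto[OF x] lift_tendsto[OF y] and cx = CS_carrier[OF x] and cy = CS_carrier[OF y]
  show "lift (cls x \<oplus>\<^bsub>completion X\<^esub> cls y) = lift (cls x) + lift (cls y)"
    unfolding completion_add[OF x y]
    by (rule lift_eqI[OF CS_add[OF x y]]) (use tendsto_add[OF l] in \<open>simp add: \<pi>_add cx cy\<close>)
  show "lift (cls x \<ominus>\<^bsub>completion X\<^esub> cls y) = lift (cls x) - lift (cls y)"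
    unfolding completion_minus[OF x y]
    by (rule lift_eqI[OF CS_minus[OF x y]]) (use tendsto_diff[OF l] in \<open>simp add: \<pi>_minus cx cy\<close>)
  show "lift (cls x \<otimes>\<^bsub>completion X\<^esub> cls y) = lift (cls x) * lift (cls y)"
    unfolding completion_mult[OF x y]
    by (rule lift_eqI[OF CS_mult[OF x y]]) (use tendsto_mult[OF l] in \<open>simp add: \<pi>_mult cx cy\<close>)
  show "lift (cscale (completion X) c (cls x)) = c *\<^sub>C lift (cls x)"
    unfolding completion_cscale[OF x]
    by (rule lift_eqI[OF CS_cscale[OF x]])
      (use bounded_linear.tendsto[OF bounded_linear_scaleC_right l(1)] in \<open>simp add: \<pi>_cscale cx\<close>)
  show "lift (involution (completion X) (cls x)) = star (lift (cls x))"
    unfolding completion_involution[OF x]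
    by (rule lift_eqI[OF CS_involution[OF x]])
      (use bounded_linear.tendsto[OF bounded_linear_star l(1)] in \<open>simp add: \<pi>_involution cx\<close>)
qed

lemma completion_closed:
  assumes x: "x \<in> CS" and y: "y \<in> CS"
  shows "cls x \<oplus>\<^bsub>completion X\<^esub> cls y \<in> carrier (completion X)"
    "cls x \<ominus>\<^bsub>completion X\<^esub> cls y \<in> carrier (completion X)"
    "cls x \<otimes>\<^bsub>completion X\<^esub> cls y \<in> carrier (completion X)"
    "cscale (completion X) c (cls x) \<in> carrier (completion X)"
    "involution (completion X) (cls x) \<in> carrier (completion X)"
  unfolding completion_add[OF x y] completion_minus[OF x y] completion_mult[OF x y]
    completion_cscale[OF x] completion_involution[OF x] carrier_completion
  by (intro imageI CS_add CS_minus CS_mult CS_cscale CS_involution x y)+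

text \<open>This seminorm takes part in the supremum and, under the bound of
  \<open>enveloping_isomorphic\<close>, attains it.\<close>

lemma cstar_seminorm_lift: "cstar_seminorm (completion X) (\<lambda>P. norm (lift P))"
proof -
  have "lift (involution (completion X) (cls x) \<otimes>\<^bsub>completion X\<^esub> cls x) = star (lift (cls x)) * lift (cls x)"
    if x: "x \<in> CS" for x
    using lift_hom(3)[OF CS_involution[OF x] x] lift_hom(5)[OF x x] by (simp add: completion_involution[OF x])
  then show ?thesis
    unfolding cstar_seminorm_def carrier_completion
    by (auto simp: lift_hom norm_scaleC norm_triangle_ineq norm_mult_ineq norm_star_mult_self)
qed

text \<open>A bound on \<open>X\<close> suffices: a class is a constant sequence plus a tail that is
  small for \<open>N\<close>, and automatic contractivity controls any C*-seminorm on the tail. So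
  the greatest C*-seminorm is \<open>norm (lift P)\<close>, and the outer completion falls under
  \<open>completion_isomorphic\<close>.\<close>

theorem enveloping_isomorphic:
  assumes dense: "closure D = UNIV"
    and bound: "\<And>p a. cstar_seminorm (completion X) p \<Longrightarrow> a \<in> carrier X \<Longrightarrow> p (cls (\<lambda>n. a)) \<le> norm (\<pi> a)"
  shows "cstar_isomorphic (algebra_of_type :: 'a seminormed_star_algebra) (enveloping_cstar_algebra (completion X))"
proof -
  have p_le: "p (cls x) \<le> norm (lift (cls x))" if p: "cstar_seminorm (completion X) p" and x: "x \<in> CS" for p x
  proof (rule field_le_epsilon)
    fix e :: real assume e: "e > 0"
    note cx = CS_carrier[OF x]
    obtain M1 where M1: "\<forall>m\<ge>M1. \<forall>n\<ge>M1. N (\<pi> (x m) - \<pi> (x n)) < e/2"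
      using cauchyD[OF CS_cauchy[OF x], of "e/2"] e by auto
    obtain M2 where M2: "\<forall>n\<ge>M2. norm (\<pi> (x n) - lift (cls x)) < e/2"
      using LIMSEQ_D[OF lift_tendsto[OF x], of "e/2"] e by auto
    define m where "m = max M1 M2"
    let ?c = "\<lambda>n::nat. x m"
    have c: "?c \<in> CS" by (rule CS_const[OF cx])
    have d: "(\<lambda>n. x n \<ominus>\<^bsub>X\<^esub> x m) \<in> CS" by (rule CS_minus[OF x c])
    have tail: "p (cls (\<lambda>n. x n \<ominus>\<^bsub>X\<^esub> x m)) \<le> e/2"
    proof -
      obtain l where l: "(\<lambda>n. N (\<pi> (x n \<ominus>\<^bsub>X\<^esub> x m))) \<longlonglongrightarrow> l" using cauchy_convergent_N[OF CS_cauchy[OF d]] by blast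
      have "\<forall>n\<ge>m. N (\<pi> (x n \<ominus>\<^bsub>X\<^esub> x m)) \<le> e/2" using M1 by (auto simp: \<pi>_minus cx m_def less_imp_le)
      then have "l \<le> e/2" using LIMSEQ_le_const2[OF l] by blast
      then show ?thesis using completion_seminorm_contractive[OF p d l] by linarith
    qed
    have "cls x = cls ?c \<oplus>\<^bsub>completion X\<^esub> cls (\<lambda>n. x n \<ominus>\<^bsub>X\<^esub> x m)"
      unfolding completion_add[OF c d]
      by (rule cls_eqI[OF x CS_add[OF c d]]) (simp add: \<pi>_add \<pi>_minus minus_closed cx)
    then have "p (cls x) \<le> p (cls ?c) + p (cls (\<lambda>n. x n \<ominus>\<^bsub>X\<^esub> x m))"
      using p c d unfolding cstar_seminorm_def carrier_completion by (metis imageI)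
    also have "\<dots> \<le> norm (\<pi> (x m)) + e/2" using bound[OF p cx] tail by (intro add_mono) auto
    also have "\<dots> \<le> norm (lift (cls x)) + e"
    proof -
      have "norm (\<pi> (x m) - lift (cls x)) < e/2" using M2 by (simp add: m_def)
      then show ?thesis using norm_triangle_ineq2[of "\<pi> (x m)" "lift (cls x)"] by simp
    qed
    finally show "p (cls x) \<le> norm (lift (cls x)) + e" .
  qed
  have greatest: "greatest_cstar_seminorm (completion X) P = norm (lift P)" if "P \<in> carrier (completion X)" for P
  proof -
    obtain x where x: "x \<in> CS" "P = cls x" using completionE[OF \<open>P \<in> _\<close>] by blast
    show ?thesis
      unfolding greatest_cstar_seminorm_def
    proof (rule cSup_eq_maximum)
      show "norm (lift P) \<in> (\<lambda>p. p P) ` {p. cstar_seminorm (completion X) p}"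
        by (rule image_eqI[of _ _ "\<lambda>P. norm (lift P)"]) (simp_all add: cstar_seminorm_lift)
    qed (use p_le[OF _ x(1)] x(2) in auto)
  qed
  define Y where "Y = completion X\<lparr>seminorm := greatest_cstar_seminorm (completion X)\<rparr>"
  have Y: "carrier Y = carrier (completion X)" "\<And>P. seminorm Y P = greatest_cstar_seminorm (completion X) P"
    "\<one>\<^bsub>Y\<^esub> = \<one>\<^bsub>completion X\<^esub>" "\<zero>\<^bsub>Y\<^esub> = \<zero>\<^bsub>completion X\<^esub>"
    "\<And>P Q. P \<oplus>\<^bsub>Y\<^esub> Q = P \<oplus>\<^bsub>completion X\<^esub> Q" "\<And>P Q. P \<otimes>\<^bsub>Y\<^esub> Q = P \<otimes>\<^bsub>completion X\<^esub> Q"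
    "\<And>P Q. P \<ominus>\<^bsub>Y\<^esub> Q = P \<ominus>\<^bsub>completion X\<^esub> Q"
    "\<And>c P. cscale Y c P = cscale (completion X) c P" "\<And>P. involution Y P = involution (completion X) P"
    by (simp_all add: Y_def a_minus_def a_inv_def)
  \<comment> \<open>The outer completion starts from the image of the whole l1-completion; it
    contains \<open>D\<close>, whence its density.\<close>
  define E where "E = lift ` carrier (completion X)"
  have DE: "D \<subseteq> E"
    unfolding E_def image[symmetric] carrier_completion using lift_const CS_const by force
  have E_cases: "\<exists>x\<in>CS. a = lift (cls x)" if "a \<in> E" for a
    using that by (auto simp: E_def carrier_completion)
  have E_I: "lift P \<in> E" if "P \<in> carrier (completion X)" for P using that by (simp add: E_def)
  have sub: "normed_star_subalgebra E norm"
  proof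
    show "1 \<in> E" using DE one_mem by blast
    fix a b c assume a: "a \<in> E" and b: "b \<in> E"
    obtain x where x: "x \<in> CS" "a = lift (cls x)" using E_cases[OF a] by blast
    obtain y where y: "y \<in> CS" "b = lift (cls y)" using E_cases[OF b] by blast
    show "a + b \<in> E" "a * b \<in> E"
      using E_I[OF completion_closed(1)[OF x(1) y(1)]] E_I[OF completion_closed(3)[OF x(1) y(1)]]
        lift_hom[OF x(1) y(1)] x y by auto
  next
    fix a c assume a: "a \<in> E"
    obtain x where x: "x \<in> CS" "a = lift (cls x)" using E_cases[OF a] by blast
    show "c *\<^sub>C a \<in> E" "star a \<in> E"
      using E_I[OF completion_closed(4)[OF x(1) x(1)]] E_I[OF completion_closed(5)[OF x(1) x(1)]]
        lift_hom[OF x(1) x(1)] x by auto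
  qed (auto simp: norm_triangle_ineq norm_mult_ineq norm_scaleC)
  have "represented_algebra E norm Y lift"
  proof (rule represented_algebra.intro[OF sub], unfold_locales)
    show "lift ` carrier Y = E" by (simp add: Y E_def)
    show "seminorm Y P = norm (lift P)" if "P \<in> carrier Y" for P using that greatest by (simp add: Y)
    show "\<one>\<^bsub>Y\<^esub> \<in> carrier Y" "\<zero>\<^bsub>Y\<^esub> \<in> carrier Y"
      using CS_const one_closed zero_closed by (auto simp: Y completion_one completion_zero carrier_completion)
    show "lift \<one>\<^bsub>Y\<^esub> = 1" "lift \<zero>\<^bsub>Y\<^esub> = 0"
      by (simp_all add: Y completion_one completion_zero lift_const one_closed zero_closed \<pi>_one \<pi>_zero)
  qed (auto simp: Y lift_hom completion_closed elim!: completionE)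
  then interpret Y: represented_algebra E norm Y lift .
  have "closure E = UNIV" using closure_mono[OF DE] dense by auto
  from Y.completion_isomorphic[OF refl this] show ?thesis
    by (simp add: enveloping_cstar_algebra_def Y_def)
qed

end

section \<open>From subexponential growth to domination by the norm\<close>

section \<open>Isotypic components\<close>

text \<open>The \<open>2 ^ n\<close>-th root of a polynomial factor tends to 1; in logarithms,
  \<open>n / 2 ^ n\<close> tends to 0.\<close>

lemma le_of_subexponential:
  fixes u v :: real
  assumes u: "u \<ge> 0" and v: "v \<ge> 0" and le: "\<And>n. u ^ (2 ^ n) \<le> (2 ^ n + 1) ^ d * v ^ (2 ^ n)"
  shows "u \<le> v"
proof (rule ccontr)
  assume "\<not> u \<le> v"
  then have uv: "v < u" by simp
  \<comment> \<open>At \<open>n = 0\<close> a vanishing \<open>v\<close> would give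
    \<open>u <= 0\<close>.\<close>
  have "v \<noteq> 0" using le[of 0] uv by (auto simp: power_0_left)
  then have vp: "v > 0" using v by simp
  define c where "c = ln (u / v)"
  have c: "c > 0" using uv vp by (simp add: c_def)
  have main: "c \<le> real d * (real (n + 1) * (1/2) ^ n)" for n
  proof -
    have "(u / v) ^ (2 ^ n) \<le> (2 ^ n + 1) ^ d" using le[of n] vp by (simp add: power_divide field_simps)
    also have "\<dots> \<le> (2 ^ (n + 1)) ^ d" by (intro power_mono) auto
    finally have "ln ((u / v) ^ (2 ^ n)) \<le> ln (((2::real) ^ (n + 1)) ^ d)"
      using uv vp by (subst ln_le_cancel_iff) auto
    moreover have "ln ((u / v) ^ (2 ^ n)) = 2 ^ n * c"
      using uv vp by (simp add: ln_realpow c_def)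
    moreover have "ln (((2::real) ^ (n + 1)) ^ d) = real d * ln (2 ^ (n + 1))" by (rule ln_realpow)
    moreover have "ln ((2::real) ^ (n + 1)) = real (n + 1) * ln 2" by (rule ln_realpow)
    ultimately have "2 ^ n * c \<le> real d * (real (n + 1) * ln 2)" by simp
    also have "\<dots> \<le> real d * (real (n + 1) * 1)"
      using ln_2_less_1 by (intro mult_left_mono) auto
    finally show ?thesis by (simp add: field_simps power_divide)
  qed
  have "(\<lambda>n. real n * (1/2) ^ n) \<longlonglongrightarrow> (0::real)" by (rule powser_times_n_limit_0) simp
  moreover have "(\<lambda>n. (1/2) ^ n) \<longlonglongrightarrow> (0::real)" by (rule LIMSEQ_power_zero) simp
  ultimately have "(\<lambda>n. real n * (1/2) ^ n + (1/2) ^ n) \<longlonglongrightarrow> (0::real)"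
    using tendsto_add by fastforce
  then have "(\<lambda>n. real (n + 1) * (1/2) ^ n) \<longlonglongrightarrow> (0::real)" by (simp add: algebra_simps)
  from tendsto_mult_right_zero[OF this, of "real d"]
  have "c \<le> 0" by (rule LIMSEQ_le_const) (use main in auto)
  then show False using c by simp
qed

lemma (in dominated_algebra) seminorm_le_norm_of_polynomial_growth:
  assumes growth: "\<And>y. y \<in> D \<Longrightarrow> \<exists>d. \<forall>k. N (y ^ k) \<le> (real k + 1) ^ d * norm y ^ k"
    and p: "cstar_seminorm (completion X) p" and x: "x \<in> carrier X"
  shows "p (cls (\<lambda>n. x)) \<le> norm (\<pi> x)"
proof -
  let ?K = "\<lambda>x. cls (\<lambda>n::nat. x)"
  have K: "?K x \<in> carrier (completion X)" if "x \<in> carrier X" for x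
    using CS_const[OF that] by (auto simp: carrier_completion)
  have eq: "?K x = ?K y" if "x \<in> carrier X" "y \<in> carrier X" "\<pi> x = \<pi> y" for x y
    using that by (intro cls_eqI CS_const) auto
  have p_nonneg: "0 \<le> p (?K x)" if "x \<in> carrier X" for x
    using p K[OF that] by (auto simp: cstar_seminorm_def)
  have p_star: "p (?K (involution X x \<otimes>\<^bsub>X\<^esub> x)) = (p (?K x))\<^sup>2" if x: "x \<in> carrier X" for x
  proof -
    have "?K (involution X x \<otimes>\<^bsub>X\<^esub> x) = involution (completion X) (?K x) \<otimes>\<^bsub>completion X\<^esub> ?K x"
      by (simp add: completion_involution completion_mult CS_const x involution_closed)
    then show ?thesis using p K[OF x] by (simp add: cstar_seminorm_def)
  qed
  have p_N: "p (?K x) \<le> N (\<pi> x)" if "x \<in> carrier X" for x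
    by (rule completion_seminorm_contractive[OF p CS_const[OF that]]) simp
  \<comment> \<open>Only \<open>2 ^ n\<close>-th powers: the C*-identity gives equality for an
    adjoint times its element, which is squaring when the image is self-adjoint. Powers are recorded
    through \<open>\<pi>\<close>, as the locale assumes no associativity of
    \<open>X\<close>.\<close>
  have selfadj: "\<exists>z\<in>carrier X. \<pi> z = \<pi> y ^ (2 ^ n) \<and> p (?K z) = p (?K y) ^ (2 ^ n)"
    if y: "y \<in> carrier X" "star (\<pi> y) = \<pi> y" for y n
  proof (induction n)
    case (Suc n)
    then obtain z where z: "z \<in> carrier X" "\<pi> z = \<pi> y ^ (2 ^ n)" "p (?K z) = p (?K y) ^ (2 ^ n)" by blast
    have "star (\<pi> y ^ k) = \<pi> y ^ k" for k
      by (induction k) (simp_all add: star_mult y(2) power_commutes)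
    then have "\<pi> (involution X z \<otimes>\<^bsub>X\<^esub> z) = \<pi> y ^ (2 ^ Suc n)"
      using z by (simp add: \<pi>_mult \<pi>_involution involution_closed power_add[symmetric] mult_2)
    moreover have "p (?K (involution X z \<otimes>\<^bsub>X\<^esub> z)) = p (?K y) ^ (2 ^ Suc n)"
      using p_star[OF z(1)] z(3) by (simp add: power_mult[symmetric] mult.commute)
    ultimately show ?case using z(1) by (meson involution_closed mult_closed)
  qed (use y in auto)
  define y where "y = involution X x \<otimes>\<^bsub>X\<^esub> x"
  have y: "y \<in> carrier X" "\<pi> y = star (\<pi> x) * \<pi> x"
    using x by (simp_all add: y_def mult_closed involution_closed \<pi>_mult \<pi>_involution)
  obtain d where d: "\<And>k. N (\<pi> y ^ k) \<le> (real k + 1) ^ d * norm (\<pi> y) ^ k"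
    using growth[OF \<pi>_mem[OF y(1)]] by blast
  have "(p (?K x))\<^sup>2 \<le> (norm (\<pi> x))\<^sup>2"
  proof (rule le_of_subexponential)
    fix n
    obtain z where z: "z \<in> carrier X" "\<pi> z = \<pi> y ^ (2 ^ n)" "p (?K z) = p (?K y) ^ (2 ^ n)"
      using selfadj[OF y(1), of n] by (auto simp: y(2) star_mult star_star)
    have "((p (?K x))\<^sup>2) ^ (2 ^ n) = p (?K z)" using z(3) p_star[OF x] by (simp add: y_def)
    also have "\<dots> \<le> N (\<pi> y ^ (2 ^ n))" using p_N[OF z(1)] z(2) by simp
    also have "\<dots> \<le> (2 ^ n + 1) ^ d * norm (\<pi> y) ^ (2 ^ n)" using d[of "2 ^ n"] by simp
    also have "norm (\<pi> y) = (norm (\<pi> x))\<^sup>2" by (simp add: y(2) norm_star_mult_self)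
    finally show "((p (?K x))\<^sup>2) ^ (2 ^ n) \<le> (2 ^ n + 1) ^ d * ((norm (\<pi> x))\<^sup>2) ^ (2 ^ n)" .
  qed auto
  then show ?thesis by (rule power2_le_imp_le) simp
qed

lemma dual_group_simps [simp]:
  "\<phi> \<otimes>\<^bsub>dual_group\<^esub> \<psi> = (\<lambda>g. \<phi> g * \<psi> g)" "\<one>\<^bsub>dual_group\<^esub> = (\<lambda>g. 1)"
  by (simp_all add: dual_group_def)

section \<open>Fourier projections and the span of the isotypic components\<close>

locale compact_cstar_system = compact_group ty
  for ty :: "'g::topological_ab_group_add itself" +
  fixes \<alpha> :: "'g \<Rightarrow> 'a::unital_cstar_algebra \<Rightarrow> 'a"
  assumes system: "cstar_dynamical_system \<alpha>"
begin

abbreviation Ghat :: "('g \<Rightarrow> complex) set" where "Ghat \<equiv> carrier dual_group"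

lemma Ghat_mult: "\<phi> \<in> Ghat \<Longrightarrow> \<psi> \<in> Ghat \<Longrightarrow> (\<lambda>g. \<phi> g * \<psi> g) \<in> Ghat"
  by (auto simp: dual_group_def norm_mult intro!: continuous_intros)

lemma Ghat_one: "(\<lambda>g. 1) \<in> Ghat"
  by (auto simp: dual_group_def)

lemma Ghat_cnj: "\<phi> \<in> Ghat \<Longrightarrow> (\<lambda>g. cnj (\<phi> g)) \<in> Ghat"
  by (auto simp: dual_group_def intro!: continuous_intros)

lemma group_dual_group: "group (dual_group :: ('g \<Rightarrow> complex) monoid)"
proof (rule groupI)
  fix \<phi> :: "'g \<Rightarrow> complex" assume "\<phi> \<in> Ghat"
  then show "\<exists>\<psi>\<in>Ghat. \<psi> \<otimes>\<^bsub>dual_group\<^esub> \<phi> = \<one>\<^bsub>dual_group\<^esub>"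
    by (intro bexI[of _ "\<lambda>g. cnj (\<phi> g)"]) (auto simp: Ghat_cnj mult.commute characterD(6))
qed (auto simp: Ghat_mult Ghat_one mult.assoc)

lemma inv_dual_group: "\<phi> \<in> Ghat \<Longrightarrow> inv\<^bsub>dual_group\<^esub> \<phi> = (\<lambda>g. cnj (\<phi> g))"
  by (rule group.inv_equality[OF group_dual_group]) (auto simp: Ghat_cnj mult.commute characterD(6))

lemma \<alpha>_hom: "\<alpha> g (x + y) = \<alpha> g x + \<alpha> g y" "\<alpha> g (c *\<^sub>C x) = c *\<^sub>C \<alpha> g x"
    "\<alpha> g (x * y) = \<alpha> g x * \<alpha> g y" "\<alpha> g (star x) = star (\<alpha> g x)"
    "\<alpha> (g + h) x = \<alpha> g (\<alpha> h x)"
  using system by (auto simp: cstar_dynamical_system_def star_automorphism_def)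

lemma \<alpha>_norm: "norm (\<alpha> g x) = norm x"
  using system by (intro star_automorphism_norm) (simp add: cstar_dynamical_system_def)

lemma cont_\<alpha>: "cont (\<lambda>g. \<alpha> g x)"
  using system by (simp add: cstar_dynamical_system_def)

lemma \<alpha>_zero: "\<alpha> 0 x = x"
proof -
  have "inj (\<alpha> 0)" using system by (simp add: cstar_dynamical_system_def star_automorphism_def bij_is_inj)
  moreover have "\<alpha> 0 (\<alpha> 0 x) = \<alpha> 0 x" using \<alpha>_hom(5)[of 0 0 x] by simp
  ultimately show ?thesis by (simp add: inj_eq)
qed

lemma bounded_linear_\<alpha>: "bounded_linear (\<alpha> g)"
  by (rule bounded_linear_intro[where K = 1]) (auto simp: \<alpha>_hom scaleR_eq_scaleC \<alpha>_norm)

lemma \<alpha>_one: "\<alpha> g 1 = 1"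
  using \<alpha>_hom(3)[of g "\<alpha> (- g) 1" 1] \<alpha>_hom(5)[of g "- g" 1] by (simp add: \<alpha>_zero)

definition comp :: "('g \<Rightarrow> complex) \<Rightarrow> 'a set" where
  "comp \<phi> = isotypic_component \<alpha> \<phi>"

lemma comp_iff: "a \<in> comp \<phi> \<longleftrightarrow> (\<forall>g. \<alpha> g a = \<phi> g *\<^sub>C a)"
  by (simp add: comp_def isotypic_component_def)

lemma comp_mult: "a \<in> comp \<phi> \<Longrightarrow> b \<in> comp \<psi> \<Longrightarrow> a * b \<in> comp (\<lambda>g. \<phi> g * \<psi> g)"
  by (simp add: comp_iff \<alpha>_hom mult_scaleC_left mult_scaleC_right scaleC_scaleC mult.commute)

lemma comp_star: "a \<in> comp \<phi> \<Longrightarrow> star a \<in> comp (\<lambda>g. cnj (\<phi> g))"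
  by (simp add: comp_iff \<alpha>_hom star_scaleC)

lemma comp_scaleC: "a \<in> comp \<phi> \<Longrightarrow> c *\<^sub>C a \<in> comp \<phi>"
  by (simp add: comp_iff \<alpha>_hom scaleC_scaleC mult.commute)

lemma comp_add: "a \<in> comp \<phi> \<Longrightarrow> b \<in> comp \<phi> \<Longrightarrow> a + b \<in> comp \<phi>"
  by (simp add: comp_iff \<alpha>_hom scaleC_add_right)

lemma comp_one: "1 \<in> comp (\<lambda>g. 1)"
  by (simp add: comp_iff \<alpha>_one)

text \<open>The Fourier coefficient at \<open>\<phi>\<close> of the orbit map of \<open>a\<close>,
  with values in the algebra; for a character it projects onto the component.\<close>

definition proj :: "('g \<Rightarrow> complex) \<Rightarrow> 'a \<Rightarrow> 'a" where
  "proj \<phi> a = mean (\<lambda>g. cnj (\<phi> g) *\<^sub>C \<alpha> g a)"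

context
  fixes \<phi> :: "'g \<Rightarrow> complex"
  assumes \<phi>: "\<phi> \<in> Ghat"
begin

lemma cont_proj: "cont (\<lambda>g. cnj (\<phi> g) *\<^sub>C \<alpha> g a)"
  by (intro continuous_intros characterD[OF \<phi>] cont_\<alpha>)

lemma proj_comp: "proj \<phi> a \<in> comp \<phi>"
  unfolding comp_iff
proof
  fix h
  let ?F = "\<lambda>g. cnj (\<phi> g) *\<^sub>C \<alpha> g a"
  note c = characterD[OF \<phi>]
  have F: "\<alpha> h (?F g) = \<phi> h *\<^sub>C ?F (g + h)" for g
  proof -
    have e: "\<phi> h * (cnj (\<phi> g) * cnj (\<phi> h)) = cnj (\<phi> g)"
      using c(6)[of h] by (simp add: mult.left_commute[of _ "cnj (\<phi> g)"])
    have "\<alpha> h (\<alpha> g a) = \<alpha> (g + h) a" by (simp add: \<alpha>_hom(5)[symmetric] add.commute)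
    then show ?thesis by (simp add: \<alpha>_hom(2) scaleC_scaleC c(3) e)
  qed
  have "\<alpha> h (proj \<phi> a) = mean (\<lambda>g. \<alpha> h (?F g))"
    unfolding proj_def by (rule mean_bounded_linear[OF bounded_linear_\<alpha> cont_proj, symmetric])
  also have "\<dots> = mean (\<lambda>g. \<phi> h *\<^sub>C ?F (g + h))" by (simp only: F)
  also have "\<dots> = mean (\<lambda>g. \<phi> h *\<^sub>C ?F g)"
    by (rule mean_translate) (intro continuous_intros c cont_\<alpha>)
  also have "\<dots> = \<phi> h *\<^sub>C proj \<phi> a"
    unfolding proj_def by (rule mean_bounded_linear[OF bounded_linear_scaleC_right cont_proj])
  finally show "\<alpha> h (proj \<phi> a) = \<phi> h *\<^sub>C proj \<phi> a" .
qed

lemma norm_proj_le: "norm (proj \<phi> a) \<le> norm a"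
  unfolding proj_def by (intro norm_mean_le cont_proj) (simp add: norm_scaleC \<alpha>_norm characterD[OF \<phi>])

lemma proj_sum: "proj \<phi> (\<Sum>i\<in>I. f i) = (\<Sum>i\<in>I. proj \<phi> (f i))"
proof -
  have "\<alpha> g (\<Sum>i\<in>I. f i) = (\<Sum>i\<in>I. \<alpha> g (f i))" for g
    using linear_sum[OF bounded_linear.linear[OF bounded_linear_\<alpha>]] .
  then show ?thesis unfolding proj_def
    by (simp add: scaleC_sum_right mean_sum cont_proj)
qed

lemma proj_on_comp:
  assumes \<psi>: "\<psi> \<in> Ghat" and a: "a \<in> comp \<psi>"
  shows "proj \<phi> a = (if \<psi> = \<phi> then a else 0)"
proof -
  have "proj \<phi> a = mean (\<lambda>g. (\<psi> g * cnj (\<phi> g)) *\<^sub>C a)"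
    using a unfolding proj_def comp_iff by (simp add: scaleC_scaleC mult.commute)
  also have "\<dots> = fourier \<psi> \<phi> *\<^sub>C a"
    unfolding fourier_def
    by (intro mean_bounded_linear[OF bounded_linear_scaleC_left] continuous_intros characterD[OF \<phi>] characterD[OF \<psi>])
  finally show ?thesis using character_orthogonal[OF \<psi> \<phi>] by simp
qed

end

definition spec :: "'a \<Rightarrow> ('g \<Rightarrow> complex) set" where
  "spec a = {\<phi> \<in> Ghat. proj \<phi> a \<noteq> 0}"

text \<open>The linear span of the components, phrased so that each element carries its canonical
  decomposition and membership is tested by projections.\<close>

definition alg :: "'a set" where
  "alg = {a. finite (spec a) \<and> a = (\<Sum>\<phi>\<in>spec a. proj \<phi> a)}"

definition ell1 :: "'a \<Rightarrow> real" where
  "ell1 a = (\<Sum>\<phi>\<in>spec a. norm (proj \<phi> a))"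

text \<open>The closure properties of \<open>alg\<close> and the l1-estimates come from here.
  Characters may repeat among the \<open>\<kappa> i\<close>; collecting equal ones can only shrink
  the spectrum and, by the triangle inequality, the l1-norm.\<close>

lemma sum_comp:
  assumes I: "finite I" and \<kappa>: "\<And>i. i \<in> I \<Longrightarrow> \<kappa> i \<in> Ghat" and f: "\<And>i. i \<in> I \<Longrightarrow> f i \<in> comp (\<kappa> i)"
  shows "(\<Sum>i\<in>I. f i) \<in> alg" "ell1 (\<Sum>i\<in>I. f i) \<le> (\<Sum>i\<in>I. norm (f i))"
    "spec (\<Sum>i\<in>I. f i) \<subseteq> \<kappa> ` I"
proof -
  define a where "a = (\<Sum>i\<in>I. f i)"
  have pr: "proj \<phi> a = (\<Sum>i | i \<in> I \<and> \<kappa> i = \<phi>. f i)" if "\<phi> \<in> Ghat" for \<phi>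
  proof -
    have "proj \<phi> a = (\<Sum>i\<in>I. if \<kappa> i = \<phi> then f i else 0)"
      unfolding a_def proj_sum[OF that] using proj_on_comp[OF that \<kappa> f] by (intro sum.cong) auto
    also have "\<dots> = (\<Sum>i | i \<in> I \<and> \<kappa> i = \<phi>. f i)" using I by (rule sum.inter_filter[symmetric])
    finally show ?thesis .
  qed
  have sub: "spec a \<subseteq> \<kappa> ` I"
  proof
    fix \<phi> assume "\<phi> \<in> spec a"
    then have "\<phi> \<in> Ghat" "(\<Sum>i | i \<in> I \<and> \<kappa> i = \<phi>. f i) \<noteq> 0" using pr by (auto simp: spec_def)
    then have "{i. i \<in> I \<and> \<kappa> i = \<phi>} \<noteq> {}" by (metis sum.empty)
    then show "\<phi> \<in> \<kappa> ` I" by blast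
  qed
  have fin: "finite (spec a)" using finite_subset[OF sub] I by simp
  have out: "proj \<phi> a = 0" if "\<phi> \<in> \<kappa> ` I - spec a" for \<phi> using that \<kappa> by (auto simp: spec_def)
  have im: "\<phi> \<in> Ghat" if "\<phi> \<in> \<kappa> ` I" for \<phi> using that \<kappa> by auto
  have "(\<Sum>\<phi>\<in>spec a. proj \<phi> a) = (\<Sum>\<phi>\<in>\<kappa> ` I. proj \<phi> a)"
    by (rule sum.mono_neutral_left) (use I sub out in auto)
  also have "\<dots> = (\<Sum>\<phi>\<in>\<kappa> ` I. \<Sum>i | i \<in> I \<and> \<kappa> i = \<phi>. f i)" by (intro sum.cong refl pr im)
  also have "\<dots> = a" unfolding a_def by (rule sum.image_gen[OF I, symmetric])
  finally show "(\<Sum>i\<in>I. f i) \<in> alg" using fin by (simp add: alg_def a_def)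
  have "ell1 a = (\<Sum>\<phi>\<in>\<kappa> ` I. norm (proj \<phi> a))"
    unfolding ell1_def by (rule sum.mono_neutral_left) (use I sub out in auto)
  also have "\<dots> \<le> (\<Sum>\<phi>\<in>\<kappa> ` I. \<Sum>i | i \<in> I \<and> \<kappa> i = \<phi>. norm (f i))"
    by (intro sum_mono) (simp add: pr im norm_sum)
  also have "\<dots> = (\<Sum>i\<in>I. norm (f i))" by (rule sum.image_gen[OF I, symmetric])
  finally show "ell1 (\<Sum>i\<in>I. f i) \<le> (\<Sum>i\<in>I. norm (f i))" by (simp add: a_def)
  show "spec (\<Sum>i\<in>I. f i) \<subseteq> \<kappa> ` I" using sub by (simp add: a_def)
qed

lemma alg_finite: "a \<in> alg \<Longrightarrow> finite (spec a)" by (simp add: alg_def)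

lemma alg_decomp: "a \<in> alg \<Longrightarrow> a = (\<Sum>\<phi>\<in>spec a. proj \<phi> a)" by (simp add: alg_def)

lemma spec_Ghat: "\<phi> \<in> spec a \<Longrightarrow> \<phi> \<in> Ghat" by (simp add: spec_def)

lemma alg_mult:
  assumes a: "a \<in> alg" and b: "b \<in> alg"
  shows "a * b \<in> alg" "ell1 (a * b) \<le> ell1 a * ell1 b"
    "spec (a * b) \<subseteq> (\<lambda>(\<phi>, \<psi>) g. \<phi> g * \<psi> g) ` (spec a \<times> spec b)"
proof -
  let ?f = "\<lambda>(\<phi>, \<psi>). proj \<phi> a * proj \<psi> b" and ?\<kappa> = "\<lambda>(\<phi>, \<psi>) g. \<phi> g * \<psi> g :: complex"
  have ab: "a * b = (\<Sum>i\<in>spec a \<times> spec b. ?f i)"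
    by (subst alg_decomp[OF a], subst alg_decomp[OF b]) (simp add: sum_product sum.cartesian_product)
  have 1: "?\<kappa> i \<in> Ghat" "?f i \<in> comp (?\<kappa> i)" if "i \<in> spec a \<times> spec b" for i
    using that by (auto intro!: Ghat_mult comp_mult proj_comp dest: spec_Ghat)
  have fin: "finite (spec a \<times> spec b)" using alg_finite a b by simp
  note s = sum_comp[OF fin, of ?\<kappa> ?f, OF 1]
  show "a * b \<in> alg" "spec (a * b) \<subseteq> ?\<kappa> ` (spec a \<times> spec b)" unfolding ab using s(1,3) by blast+
  have "ell1 (a * b) \<le> (\<Sum>i\<in>spec a \<times> spec b. norm (?f i))" unfolding ab using s(2) by blast
  also have "\<dots> \<le> (\<Sum>(\<phi>, \<psi>)\<in>spec a \<times> spec b. norm (proj \<phi> a) * norm (proj \<psi> b))"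
    by (intro sum_mono) (auto simp: norm_mult_ineq)
  also have "\<dots> = ell1 a * ell1 b" by (simp add: ell1_def sum_product sum.cartesian_product)
  finally show "ell1 (a * b) \<le> ell1 a * ell1 b" .
qed

lemma alg_star:
  assumes a: "a \<in> alg"
  shows "star a \<in> alg" "ell1 (star a) \<le> ell1 a"
proof -
  have eq: "star a = (\<Sum>\<phi>\<in>spec a. star (proj \<phi> a))" by (subst alg_decomp[OF a]) (rule star_sum)
  note s = sum_comp[OF alg_finite[OF a], of "\<lambda>\<phi> g. cnj (\<phi> g)" "\<lambda>\<phi>. star (proj \<phi> a)",
      OF Ghat_cnj[OF spec_Ghat] comp_star[OF proj_comp[OF spec_Ghat]], simplified]
  show "star a \<in> alg" unfolding eq by (rule s(1))
  show "ell1 (star a) \<le> ell1 a" unfolding eq using s(2) by (simp add: ell1_def[of a])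
qed

lemma alg_scaleC:
  assumes a: "a \<in> alg"
  shows "c *\<^sub>C a \<in> alg" "ell1 (c *\<^sub>C a) \<le> cmod c * ell1 a"
proof -
  have eq: "c *\<^sub>C a = (\<Sum>\<phi>\<in>spec a. c *\<^sub>C proj \<phi> a)" by (subst alg_decomp[OF a]) (rule scaleC_sum_right)
  note s = sum_comp[OF alg_finite[OF a], of "\<lambda>\<phi>. \<phi>" "\<lambda>\<phi>. c *\<^sub>C proj \<phi> a",
      OF spec_Ghat comp_scaleC[OF proj_comp[OF spec_Ghat]], simplified]
  show "c *\<^sub>C a \<in> alg" unfolding eq by (rule s(1))
  show "ell1 (c *\<^sub>C a) \<le> cmod c * ell1 a"
    unfolding eq using s(2) by (simp add: ell1_def[of a] norm_scaleC sum_distrib_left)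
qed

lemma alg_add:
  assumes a: "a \<in> alg" and b: "b \<in> alg"
  shows "a + b \<in> alg" "ell1 (a + b) \<le> ell1 a + ell1 b"
proof -
  \<comment> \<open>A disjoint union, as a character in both spectra has to be counted twice before
    \<open>sum_comp\<close> merges the terms.\<close>
  let ?I = "spec a <+> spec b" and ?f = "case_sum (\<lambda>\<phi>. proj \<phi> a) (\<lambda>\<phi>. proj \<phi> b)"
  have fin: "finite (spec a)" "finite (spec b)" using alg_finite a b by auto
  have eq: "a + b = (\<Sum>i\<in>?I. ?f i)"
    by (subst alg_decomp[OF a], subst alg_decomp[OF b]) (simp add: sum.Plus[OF fin])
  have 1: "case_sum (\<lambda>\<phi>. \<phi>) (\<lambda>\<phi>. \<phi>) i \<in> Ghat" "?f i \<in> comp (case_sum (\<lambda>\<phi>. \<phi>) (\<lambda>\<phi>. \<phi>) i)" if "i \<in> ?I" for i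
    using that by (auto intro!: proj_comp dest: spec_Ghat)
  note s = sum_comp[OF finite_Plus[OF fin], of "case_sum (\<lambda>\<phi>. \<phi>) (\<lambda>\<phi>. \<phi>)" ?f, OF 1]
  show "a + b \<in> alg" unfolding eq using s(1) by blast
  have "ell1 (a + b) \<le> (\<Sum>i\<in>?I. norm (?f i))" unfolding eq using s(2) by blast
  then show "ell1 (a + b) \<le> ell1 a + ell1 b" by (simp add: sum.Plus[OF fin] ell1_def)
qed

lemma norm_le_ell1: "a \<in> alg \<Longrightarrow> norm a \<le> ell1 a"
  unfolding ell1_def using norm_sum[of "\<lambda>\<phi>. proj \<phi> a" "spec a"] alg_decomp[of a] by simp

sublocale normed_star_subalgebra alg ell1
proof
  show "1 \<in> alg"
    using sum_comp(1)[of "{()}" "\<lambda>_ g. 1" "\<lambda>_. 1"] Ghat_one comp_one by simp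
  show "ell1 (c *\<^sub>C x) = cmod c * ell1 x" if x: "x \<in> alg" for x c
  proof (cases "c = 0")
    case True
    have "spec 0 = {}" by (auto simp: spec_def proj_def mean_const linear_0[OF bounded_linear.linear[OF bounded_linear_\<alpha>]])
    then show ?thesis using True by (simp add: ell1_def)
  next
    case False
    \<comment> \<open>The reverse inequality is the scaling estimate for
      \<open>inverse c\<close>.\<close>
    have "ell1 x \<le> cmod (inverse c) * ell1 (c *\<^sub>C x)"
      using alg_scaleC(2)[OF alg_scaleC(1)[OF x], of "inverse c" c] False by (simp add: scaleC_scaleC)
    then have "cmod c * ell1 x \<le> ell1 (c *\<^sub>C x)" using False by (simp add: norm_inverse norm_divide field_simps)
    then show ?thesis using alg_scaleC(2)[OF x, of c] by simp
  qed
  show "ell1 (star x) = ell1 x" if "x \<in> alg" for x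
    using alg_star(2)[OF that] alg_star(2)[OF alg_star(1)[OF that]] by (simp add: star_star)
qed (auto intro: alg_add alg_mult alg_scaleC alg_star)

text \<open>Since the dual group is abelian, the number of \<open>k\<close>-fold products of elements of a finite set
  grows polynomially in \<open>k\<close>.\<close>

lemma polynomial_growth:
  assumes y: "y \<in> alg"
  shows "\<exists>d. \<forall>k. ell1 (y ^ k) \<le> (real k + 1) ^ d * norm y ^ k"
proof (intro exI allI)
  fix k :: nat
  define F where "F = spec y"
  have fin: "finite F" unfolding F_def by (rule alg_finite[OF y])
  \<comment> \<open>The product of the characters in \<open>F\<close> with multiplicities
    \<open>c\<close>. Bounding each multiplicity by \<open>k\<close>, instead of their total,
    already leaves at most \<open>(k + 1) ^ card F\<close> monomials.\<close>
  define mon where "mon c = (\<lambda>g. \<Prod>\<phi>\<in>F. \<phi> g ^ c \<phi>)" for c :: "('g \<Rightarrow> complex) \<Rightarrow> nat"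
  have "y ^ k \<in> alg \<and> spec (y ^ k) \<subseteq> mon ` (F \<rightarrow>\<^sub>E {..k})" for k
  proof (induction k)
    case 0
    have "spec 1 \<subseteq> {\<lambda>g. 1}"
      using sum_comp(3)[of "{()}" "\<lambda>_ g. 1" "\<lambda>_. 1"] Ghat_one comp_one by simp
    moreover have "(\<lambda>g. 1) \<in> mon ` (F \<rightarrow>\<^sub>E {..0})"
      by (rule image_eqI[of _ _ "\<lambda>\<phi>\<in>F. 0"]) (simp_all add: mon_def fun_eq_iff)
    ultimately have "spec 1 \<subseteq> mon ` (F \<rightarrow>\<^sub>E {..0})" by blast
    then show ?case using one_mem by (simp only: power_0 simp_thms)
  next
    case (Suc k)
    have "spec (y * y ^ k) \<subseteq> mon ` (F \<rightarrow>\<^sub>E {..Suc k})"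
    proof
      fix \<kappa> assume "\<kappa> \<in> spec (y * y ^ k)"
      then have "\<kappa> \<in> (\<lambda>(\<phi>, \<psi>) g. \<phi> g * \<psi> g) ` (F \<times> spec (y ^ k))"
        using alg_mult(3)[OF y, of "y ^ k"] Suc unfolding F_def by blast
      then obtain \<phi> \<psi> where *: "\<phi> \<in> F" "\<psi> \<in> spec (y ^ k)" "\<kappa> = (\<lambda>g. \<phi> g * \<psi> g)" by auto
      then obtain c where c: "c \<in> F \<rightarrow>\<^sub>E {..k}" "\<psi> = mon c" using Suc by blast
      have "c(\<phi> := Suc (c \<phi>)) \<in> F \<rightarrow>\<^sub>E {..Suc k}"
        using c(1) *(1) by (auto simp: PiE_def extensional_def Pi_def le_SucI)
      moreover have "\<kappa> = mon (c(\<phi> := Suc (c \<phi>)))"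
      proof -
        have "(\<Prod>\<eta>\<in>F - {\<phi>}. \<eta> g ^ (c(\<phi> := Suc (c \<phi>))) \<eta>) = (\<Prod>\<eta>\<in>F - {\<phi>}. \<eta> g ^ c \<eta>)" for g
          by (intro prod.cong) auto
        then show ?thesis
          unfolding *(3) c(2) mon_def fun_eq_iff prod.remove[OF fin *(1)] by (simp add: mult.assoc)
      qed
      ultimately show "\<kappa> \<in> mon ` (F \<rightarrow>\<^sub>E {..Suc k})" by blast
    qed
    then show ?case using alg_mult(1)[OF y] Suc by simp
  qed
  then have yk: "y ^ k \<in> alg" and sub: "spec (y ^ k) \<subseteq> mon ` (F \<rightarrow>\<^sub>E {..k})" by auto
  have "card (spec (y ^ k)) \<le> card (mon ` (F \<rightarrow>\<^sub>E {..k}))"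
    by (intro card_mono finite_imageI finite_PiE sub fin) auto
  also have "\<dots> \<le> card (F \<rightarrow>\<^sub>E {..k})" by (intro card_image_le finite_PiE fin) auto
  also have "\<dots> = (k + 1) ^ card F" by (simp add: card_PiE fin)
  finally have "real (card (spec (y ^ k))) \<le> real ((k + 1) ^ card F)" by (rule of_nat_mono)
  then have card: "real (card (spec (y ^ k))) \<le> (real k + 1) ^ card F" by (simp add: add.commute)
  have "ell1 (y ^ k) \<le> (\<Sum>\<phi>\<in>spec (y ^ k). norm (y ^ k))"
    unfolding ell1_def by (intro sum_mono norm_proj_le spec_Ghat)
  also have "\<dots> \<le> (real k + 1) ^ card F * norm y ^ k"
    using card by (simp add: mult_mono norm_power_ineq)
  finally show "ell1 (y ^ k) \<le> (real k + 1) ^ card (spec y) * norm y ^ k" by (simp add: F_def)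
qed

text \<open>The bump function \<open>f\<close> is built from the orbit of \<open>a\<close> itself, so that averaging against it
  moves \<open>a\<close> by at most \<open>e\<close>.\<close>

lemma alg_dense: "closure alg = UNIV"
proof -
  \<comment> \<open>Two errors of at most \<open>e\<close>; the third \<open>e\<close> makes the
    inequality strict.\<close>
  have "\<exists>b\<in>alg. dist b a < 3 * e" if e: "e > 0" for a e
  proof -
    define f where "f g = max 0 (e - norm (\<alpha> g a - a))" for g
    have cf: "cont f" unfolding f_def by (intro continuous_intros cont_\<alpha>)
    have f0: "f g \<ge> 0" for g by (simp add: f_def)
    define K where "K = mean f"
    have K: "K > 0" unfolding K_def
      by (rule mean_pos[OF cf f0, of 0]) (use e in \<open>simp add: f_def \<alpha>_zero\<close>)
    define fc where "fc g = complex_of_real (f g)" for g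
    have cfc: "cont fc" unfolding fc_def by (intro continuous_intros cf)
    \<comment> \<open>\<open>f\<close> is even because the automorphisms are isometric, and a real
      even function is hermitian, as \<open>L2_approx\<close> requires.\<close>
    have hf: "hermitian fc"
    proof -
      have "norm (\<alpha> (- g) a - a) = norm (\<alpha> g a - a)" for g
      proof -
        have "\<alpha> g (\<alpha> (- g) a - a) = a - \<alpha> g a"
          using \<alpha>_hom(5)[of g "- g" a] by (simp add: \<alpha>_zero linear_diff[OF bounded_linear.linear[OF bounded_linear_\<alpha>]])
        then show ?thesis using \<alpha>_norm[of g "\<alpha> (- g) a - a"] by (simp add: norm_minus_commute)
      qed
      then show ?thesis by (simp add: hermitian_def fc_def f_def)
    qed
    \<comment> \<open>Chosen so that \<open>norm a * sqrt d\<close> is at most \<open>e * K\<close>;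
      the summand 1 permits \<open>a = 0\<close>.\<close>
    define d where "d = (e * K / (norm a + 1))\<^sup>2"
    have "norm a + 1 > 0" using norm_ge_zero[of a] by linarith
    then have d: "d > 0" using e K by (simp add: d_def)
    obtain S where S: "finite S" "S \<subseteq> Ghat" "nrm2 (\<lambda>x. fc x - (\<Sum>\<phi>\<in>S. fourier fc \<phi> * \<phi> x)) < d"
      using L2_approx[OF cfc hf d] by blast
    define k where "k x = (\<Sum>\<phi>\<in>S. fourier fc \<phi> * \<phi> x)" for x
    have c\<phi>: "cont \<phi>" if "\<phi> \<in> S" for \<phi> using that S characterD(1) by blast
    have ck: "cont k" unfolding k_def by (intro continuous_intros c\<phi>)
    define b where "b = mean (\<lambda>g. k g *\<^sub>C \<alpha> g a)"
    have "b \<in> alg"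
    proof -
      have sc: "(\<Sum>\<phi>\<in>S. z \<phi>) *\<^sub>C x = (\<Sum>\<phi>\<in>S. z \<phi> *\<^sub>C x)" for z and x :: 'a
        by (rule linear_sum[OF bounded_linear.linear[OF bounded_linear_scaleC_left]])
      have "b = mean (\<lambda>g. \<Sum>\<phi>\<in>S. fourier fc \<phi> *\<^sub>C (\<phi> g *\<^sub>C \<alpha> g a))"
        unfolding b_def k_def sc by (simp add: scaleC_scaleC)
      also have "\<dots> = (\<Sum>\<phi>\<in>S. mean (\<lambda>g. fourier fc \<phi> *\<^sub>C (\<phi> g *\<^sub>C \<alpha> g a)))"
        by (intro mean_sum continuous_intros c\<phi> cont_\<alpha>)
      \<comment> \<open>A mean against \<open>\<phi>\<close> is the projection for the conjugate
        character, since \<open>proj\<close> conjugates its argument.\<close>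
      also have "\<dots> = (\<Sum>\<phi>\<in>S. fourier fc \<phi> *\<^sub>C proj (\<lambda>g. cnj (\<phi> g)) a)"
      proof (intro sum.cong refl)
        fix \<phi> assume "\<phi> \<in> S"
        then have "cont (\<lambda>g. \<phi> g *\<^sub>C \<alpha> g a)" by (intro continuous_intros c\<phi> cont_\<alpha>)
        from mean_bounded_linear[OF bounded_linear_scaleC_right this]
        show "mean (\<lambda>g. fourier fc \<phi> *\<^sub>C (\<phi> g *\<^sub>C \<alpha> g a)) = fourier fc \<phi> *\<^sub>C proj (\<lambda>g. cnj (\<phi> g)) a"
          by (simp add: proj_def)
      qed
      also have "\<dots> \<in> alg"
        by (rule sum_comp(1)[OF S(1), of "\<lambda>\<phi> g. cnj (\<phi> g)"]) (use S(2) in \<open>auto intro!: Ghat_cnj comp_scaleC proj_comp\<close>)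
      finally show ?thesis .
    qed
    define m where "m = mean (\<lambda>g. fc g *\<^sub>C \<alpha> g a)"
    have 1: "norm (m - b) \<le> e * K"
    proof -
      have cd: "cont (\<lambda>g. fc g - k g)" by (intro continuous_intros cfc ck)
      have "m - b = mean (\<lambda>g. fc g *\<^sub>C \<alpha> g a - k g *\<^sub>C \<alpha> g a)"
        unfolding m_def b_def by (intro mean_diff[symmetric] continuous_intros cfc ck cont_\<alpha>)
      also have "(\<lambda>g. fc g *\<^sub>C \<alpha> g a - k g *\<^sub>C \<alpha> g a) = (\<lambda>g. (fc g - k g) *\<^sub>C \<alpha> g a)"
        by (simp add: linear_diff[OF bounded_linear.linear[OF bounded_linear_scaleC_left]])
      finally have "norm (m - b) \<le> mean (\<lambda>g. norm ((fc g - k g) *\<^sub>C \<alpha> g a))"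
        using norm_mean_le_mean_norm[of "\<lambda>g. (fc g - k g) *\<^sub>C \<alpha> g a"] cd cont_\<alpha> by (simp add: continuous_on_scaleC)
      \<comment> \<open>The factor \<open>cmod 1\<close> prepares Cauchy-Schwarz against the
        constant 1, which bounds the L1-norm by the L2-norm.\<close>
      also have "\<dots> = mean (\<lambda>g. norm a * (cmod (fc g - k g) * cmod 1))"
        by (simp add: norm_scaleC \<alpha>_norm mult.commute)
      also have "\<dots> = norm a * mean (\<lambda>g. cmod (fc g - k g) * cmod 1)"
        by (intro mean_mult_real continuous_intros cfc ck)
      also have "\<dots> \<le> norm a * sqrt (nrm2 (\<lambda>g. fc g - k g) * nrm2 (\<lambda>g::'g. 1))"
        by (intro mult_left_mono mean_Cauchy_Schwarz cd continuous_intros) auto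
      also have "\<dots> \<le> norm a * sqrt d"
        using S(3) by (intro mult_left_mono) (auto simp: nrm2_def[of "\<lambda>g::'g. 1"] mean_const k_def)
      also have "\<dots> = norm a * (e * K / (norm a + 1))"
        using e K \<open>norm a + 1 > 0\<close> by (simp add: d_def real_sqrt_abs)
      also have "\<dots> \<le> e * K"
        using e K \<open>norm a + 1 > 0\<close> by (simp add: field_simps)
      finally show ?thesis .
    qed
    have 2: "norm (m - K *\<^sub>R a) \<le> e * K"
    proof -
      have "mean (\<lambda>g. fc g *\<^sub>C a) = mean fc *\<^sub>C a"
        by (rule mean_bounded_linear[OF bounded_linear_scaleC_left cfc])
      also have "mean fc = of_real K" unfolding fc_def K_def by (rule mean_of_real[OF cf])
      finally have Ka: "K *\<^sub>R a = mean (\<lambda>g. fc g *\<^sub>C a)" by (simp add: scaleR_eq_scaleC)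
      have "m - K *\<^sub>R a = mean (\<lambda>g. fc g *\<^sub>C \<alpha> g a - fc g *\<^sub>C a)"
        unfolding m_def Ka by (intro mean_diff[symmetric] continuous_intros cfc cont_\<alpha>)
      also have "\<dots> = mean (\<lambda>g. fc g *\<^sub>C (\<alpha> g a - a))" by (simp add: scaleC_diff_right)
      also have "norm \<dots> \<le> mean (\<lambda>g. norm (fc g *\<^sub>C (\<alpha> g a - a)))"
        by (intro norm_mean_le_mean_norm continuous_intros cfc cont_\<alpha>)
      also have "\<dots> \<le> mean (\<lambda>g. e * f g)"
      proof (intro mean_mono continuous_intros cfc cont_\<alpha> cf)
        fix g
        show "norm (fc g *\<^sub>C (\<alpha> g a - a)) \<le> e * f g"
        proof (cases "f g = 0")
          case True
          then show ?thesis by (simp add: fc_def)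
        next
          case False
          then have "norm (\<alpha> g a - a) \<le> e" by (auto simp: f_def max_def split: if_splits)
          then have "f g * norm (\<alpha> g a - a) \<le> f g * e" by (rule mult_left_mono[OF _ f0])
          then show ?thesis using f0[of g] by (simp add: norm_scaleC fc_def mult.commute)
        qed
      qed
      also have "\<dots> = e * K" unfolding K_def by (rule mean_mult_real[OF cf])
      finally show ?thesis .
    qed
    \<comment> \<open>The bump has mass \<open>K\<close>, not 1; normalising afterwards turns both
      errors \<open>e * K\<close> into \<open>e\<close>.\<close>
    define b' where "b' = inverse K *\<^sub>R b"
    have "b' \<in> alg" unfolding b'_def by (rule scaleR_mem[OF \<open>b \<in> alg\<close>])
    moreover have "norm (b' - a) \<le> 2 * e"
    proof -
      have "norm (b - K *\<^sub>R a) \<le> 2 * (e * K)"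
        using 1 2 norm_triangle_ineq4[of "m - K *\<^sub>R a" "m - b"] by (simp add: algebra_simps)
      moreover have "b' - a = inverse K *\<^sub>R (b - K *\<^sub>R a)" using K by (simp add: b'_def scaleR_diff_right)
      ultimately have "norm (b' - a) = norm (b - K *\<^sub>R a) / K" using K by (simp add: divide_inverse mult.commute)
      also have "\<dots> \<le> 2 * (e * K) / K" using \<open>norm (b - K *\<^sub>R a) \<le> _\<close> K by (intro divide_right_mono) auto
      finally show ?thesis using K by simp
    qed
    ultimately show ?thesis using e by (intro bexI[of _ b']) (auto simp: dist_norm)
  qed
  then have "\<exists>b\<in>alg. dist b a < e" if "e > 0" for a e
    using that by (metis times_divide_eq_right nonzero_mult_div_cancel_left zero_neq_numeral zero_less_divide_iff zero_less_numeral)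
  then show ?thesis by (auto simp: closure_approachable)
qed

end

section \<open>Unitaries, and the representation of the factor system algebra on the span\<close>

section \<open>The algebra of the factor system\<close>

lemma unitary_elementD:
  assumes "unitary_element w"
  shows "w * star w = 1" "star w * w = 1"
  using assms by (auto simp: unitary_element_def is_inverse_def)

lemma alg_inverse_unitary:
  assumes "unitary_element w"
  shows "alg_inverse w = star w"
  unfolding alg_inverse_def
proof (rule the_equality)
  show "is_inverse w (star w)" using assms by (simp add: unitary_element_def)
  fix b assume "is_inverse w b"
  then show "b = star w" using unitary_elementD[OF assms] unfolding is_inverse_def
    by (metis mult.assoc mult_1_left mult_1_right)
qed

text \<open>The C*-identity is used for the adjoint, because the unitary cancels when
  \<open>b * w\<close> stands to the left of its adjoint.\<close>

lemma norm_mult_unitary: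
  assumes "unitary_element w"
  shows "norm (b * w) = norm b"
proof -
  have "(norm (star (b * w)))\<^sup>2 = norm (star (star (b * w)) * star (b * w))" by (rule norm_star_mult_self[symmetric])
  also have "star (star (b * w)) * star (b * w) = star (star b) * star b"
    using unitary_elementD(1)[OF assms] by (simp add: star_star star_mult mult.assoc[symmetric]) (metis mult.assoc mult_1_right)
  also have "norm \<dots> = (norm (star b))\<^sup>2" by (rule norm_star_mult_self)
  finally show ?thesis by simp
qed

locale factor_system = compact_cstar_system ty \<alpha>
  for ty :: "'g::topological_ab_group_add itself" and \<alpha> :: "'g \<Rightarrow> 'a::unital_cstar_algebra \<Rightarrow> 'a" +
  fixes u :: "('g \<Rightarrow> complex) \<Rightarrow> 'a"
  assumes u_comp: "\<phi> \<in> Ghat \<Longrightarrow> u \<phi> \<in> comp \<phi>"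
    and u_unitary: "\<phi> \<in> Ghat \<Longrightarrow> unitary_element (u \<phi>)"
    and u_one: "u (\<lambda>g. 1) = 1"
begin

definition "S = (\<lambda>\<phi> b. u \<phi> * b * star (u \<phi>))"
definition "\<omega> = (\<lambda>\<phi> \<psi>. u \<phi> * u \<psi> * star (u (\<phi> \<otimes>\<^bsub>dual_group\<^esub> \<psi>)))"

abbreviation "B \<equiv> fixed_point_algebra \<alpha>"
abbreviation "X \<equiv> factor_system_algebra dual_group B S \<omega>"

definition \<pi> :: "(('g \<Rightarrow> complex) \<Rightarrow> 'a) \<Rightarrow> 'a" where
  "\<pi> f = (\<Sum>\<phi>\<in>supp f. f \<phi> * u \<phi>)"

lemma B_eq: "B = comp (\<lambda>g. 1)"
  by (auto simp: fixed_point_algebra_def comp_iff)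

lemma uu: "\<phi> \<in> Ghat \<Longrightarrow> u \<phi> * star (u \<phi>) = 1" "\<phi> \<in> Ghat \<Longrightarrow> star (u \<phi>) * u \<phi> = 1"
  using unitary_elementD[OF u_unitary] by auto

lemma B_mult: "a \<in> B \<Longrightarrow> b \<in> B \<Longrightarrow> a * b \<in> B"
  using comp_mult[of a "\<lambda>g. 1" b "\<lambda>g. 1"] by (simp add: B_eq)

lemma B_star: "a \<in> B \<Longrightarrow> star a \<in> B"
  using comp_star[of a "\<lambda>g. 1"] by (simp add: B_eq)

lemma B_zero: "0 \<in> B"
  using comp_scaleC[OF comp_one, of 0] by (simp add: B_eq)

lemma B_u: "b \<in> B \<Longrightarrow> \<phi> \<in> Ghat \<Longrightarrow> b * u \<phi> \<in> comp \<phi>"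
  using comp_mult[of b "\<lambda>g. 1" "u \<phi>" \<phi>] u_comp by (simp add: B_eq)

text \<open>Together with \<open>B_u\<close> this identifies each component with \<open>B\<close>
  times \<open>u \<phi>\<close>, a free left module of rank one.\<close>

lemma comp_u_star:
  assumes "a \<in> comp \<phi>" "\<phi> \<in> Ghat"
  shows "a * star (u \<phi>) \<in> B"
  using comp_mult[OF assms(1) comp_star[OF u_comp[OF assms(2)]]] characterD(6)[OF assms(2)]
  by (simp add: B_eq)

lemma S_B: "b \<in> B \<Longrightarrow> \<phi> \<in> Ghat \<Longrightarrow> S \<phi> b \<in> B"
  unfolding S_def
  using comp_mult[OF u_comp, of \<phi> b "\<lambda>g. 1"] by (intro comp_u_star) (auto simp: B_eq)

lemma \<omega>_B: "\<phi> \<in> Ghat \<Longrightarrow> \<psi> \<in> Ghat \<Longrightarrow> \<omega> \<phi> \<psi> \<in> B"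
  unfolding \<omega>_def by (intro comp_u_star) (auto intro!: comp_mult u_comp Ghat_mult)

lemma \<omega>_unitary: "\<phi> \<in> Ghat \<Longrightarrow> \<psi> \<in> Ghat \<Longrightarrow> unitary_element (\<omega> \<phi> \<psi>)"
proof -
  assume a: "\<phi> \<in> Ghat" "\<psi> \<in> Ghat"
  have l: "star (u \<kappa>) * (u \<kappa> * x) = x" "u \<kappa> * (star (u \<kappa>) * x) = x" if "\<kappa> \<in> Ghat" for \<kappa> x
    using uu[OF that] by (simp_all add: mult.assoc[symmetric])
  note m = Ghat_mult[OF a]
  show "unitary_element (\<omega> \<phi> \<psi>)"
    unfolding unitary_element_def is_inverse_def \<omega>_def
    by (simp add: star_mult star_star mult.assoc l a m uu)
qed

lemma carrier_X: "f \<in> carrier X \<longleftrightarrow> finite (supp f) \<and> supp f \<subseteq> Ghat \<and> (\<forall>\<phi>\<in>Ghat. f \<phi> \<in> B)"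
  by (simp add: factor_system_algebra_def)

lemma \<pi>_superset:
  assumes "finite T" "supp f \<subseteq> T"
  shows "\<pi> f = (\<Sum>\<phi>\<in>T. f \<phi> * u \<phi>)"
  unfolding \<pi>_def by (rule sum.mono_neutral_left) (use assms in \<open>auto simp: supp_def\<close>)

lemma proj_\<pi>:
  assumes f: "f \<in> carrier X" and \<phi>: "\<phi> \<in> Ghat"
  shows "proj \<phi> (\<pi> f) = f \<phi> * u \<phi>"
proof -
  have "proj \<phi> (\<pi> f) = (\<Sum>\<psi>\<in>supp f. if \<psi> = \<phi> then f \<psi> * u \<psi> else 0)"
    unfolding \<pi>_def proj_sum[OF \<phi>]
    using f by (intro sum.cong refl proj_on_comp[OF \<phi>] B_u) (auto simp: carrier_X)
  also have "\<dots> = f \<phi> * u \<phi>" using f by (auto simp: carrier_X supp_def)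
  finally show ?thesis .
qed

text \<open>Right multiplication by a unitary is isometric and therefore cannot annihilate a
  coefficient.\<close>

lemma spec_\<pi>:
  assumes f: "f \<in> carrier X"
  shows "spec (\<pi> f) = supp f"
proof -
  have "f \<phi> * u \<phi> = 0 \<longleftrightarrow> f \<phi> = 0" if "\<phi> \<in> Ghat" for \<phi>
    using norm_mult_unitary[OF u_unitary[OF that], of "f \<phi>"] by (metis norm_eq_zero)
  then show ?thesis using f proj_\<pi>[OF f] by (auto simp: spec_def supp_def carrier_X)
qed

lemma \<pi>_alg: "f \<in> carrier X \<Longrightarrow> \<pi> f \<in> alg"
  unfolding \<pi>_def by (rule sum_comp(1)[where \<kappa> = "\<lambda>\<phi>. \<phi>"]) (auto simp: carrier_X intro!: B_u)

lemma seminorm_X: "f \<in> carrier X \<Longrightarrow> seminorm X f = ell1 (\<pi> f)"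
proof -
  assume f: "f \<in> carrier X"
  have "ell1 (\<pi> f) = (\<Sum>\<phi>\<in>supp f. norm (f \<phi>))"
    unfolding ell1_def spec_\<pi>[OF f] using f
    by (intro sum.cong refl) (auto simp: proj_\<pi>[OF f] carrier_X norm_mult_unitary[OF u_unitary])
  then show ?thesis by (simp add: factor_system_algebra_def)
qed

lemma image_\<pi>: "\<pi> ` carrier X = alg"
proof (intro equalityI subsetI)
  fix a assume a: "a \<in> alg"
  define f where "f \<phi> = (if \<phi> \<in> spec a then proj \<phi> a * star (u \<phi>) else 0)" for \<phi>
  have sub: "supp f \<subseteq> spec a" by (auto simp: supp_def f_def)
  have "f \<in> carrier X"
    using B_zero finite_subset[OF sub alg_finite[OF a]] sub
    by (auto simp: carrier_X f_def dest: spec_Ghat intro!: comp_u_star proj_comp)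
  moreover have "\<pi> f = a"
  proof -
    have "\<pi> f = (\<Sum>\<phi>\<in>spec a. f \<phi> * u \<phi>)" by (rule \<pi>_superset[OF alg_finite[OF a] sub])
    also have "\<dots> = (\<Sum>\<phi>\<in>spec a. proj \<phi> a)"
      by (intro sum.cong refl) (simp add: f_def mult.assoc uu spec_Ghat)
    finally show ?thesis using alg_decomp[OF a] by simp
  qed
  ultimately show "a \<in> \<pi> ` carrier X" by blast
qed (use \<pi>_alg in auto)

lemma B_add: "a \<in> B \<Longrightarrow> b \<in> B \<Longrightarrow> a + b \<in> B"
  by (simp add: B_eq comp_add)

lemma B_scaleC: "a \<in> B \<Longrightarrow> c *\<^sub>C a \<in> B"
  by (simp add: B_eq comp_scaleC)

lemma B_sum: "(\<And>i. i \<in> I \<Longrightarrow> f i \<in> B) \<Longrightarrow> (\<Sum>i\<in>I. f i) \<in> B"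
  by (induction I rule: infinite_finite_induct) (auto simp: B_zero B_add)

text \<open>Multiplication and involution of \<open>X\<close> are finite sums of
  \<open>single\<close> terms with possibly coinciding characters; both are sent through
  \<open>\<pi>\<close> termwise by this lemma.\<close>

lemma sum_single:
  assumes I: "finite I" and \<kappa>: "\<And>i. i \<in> I \<Longrightarrow> \<kappa> i \<in> Ghat" and b: "\<And>i. i \<in> I \<Longrightarrow> b i \<in> B"
  shows "(\<lambda>\<psi>. \<Sum>i\<in>I. single (\<kappa> i) (b i) \<psi>) \<in> carrier X"
    "\<pi> (\<lambda>\<psi>. \<Sum>i\<in>I. single (\<kappa> i) (b i) \<psi>) = (\<Sum>i\<in>I. b i * u (\<kappa> i))"
proof -
  let ?F = "\<lambda>\<psi>. \<Sum>i\<in>I. single (\<kappa> i) (b i) \<psi>"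
  have sub: "supp ?F \<subseteq> \<kappa> ` I"
  proof
    fix \<psi> assume "\<psi> \<in> supp ?F"
    then have "(\<Sum>i\<in>I. single (\<kappa> i) (b i) \<psi>) \<noteq> 0" by (simp add: supp_def)
    then obtain i where "i \<in> I" "single (\<kappa> i) (b i) \<psi> \<noteq> 0" by (meson sum.neutral)
    then show "\<psi> \<in> \<kappa> ` I" by (auto simp: single_def split: if_splits)
  qed
  have "?F \<psi> \<in> B" for \<psi> by (rule B_sum) (use b B_zero in \<open>auto simp: single_def\<close>)
  then show "?F \<in> carrier X" using finite_subset[OF sub] I sub \<kappa> by (auto simp: carrier_X)
  have "\<pi> ?F = (\<Sum>\<psi>\<in>\<kappa> ` I. ?F \<psi> * u \<psi>)" by (rule \<pi>_superset) (use I sub in auto)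
  also have "\<dots> = (\<Sum>\<psi>\<in>\<kappa> ` I. \<Sum>i\<in>I. if \<kappa> i = \<psi> then b i * u (\<kappa> i) else 0)"
    by (intro sum.cong refl) (auto simp: sum_distrib_right single_def intro!: sum.cong)
  also have "\<dots> = (\<Sum>i\<in>I. \<Sum>\<psi>\<in>\<kappa> ` I. if \<kappa> i = \<psi> then b i * u (\<kappa> i) else 0)" by (rule sum.swap)
  also have "\<dots> = (\<Sum>i\<in>I. b i * u (\<kappa> i))" using I by (intro sum.cong refl) simp
  finally show "\<pi> ?F = (\<Sum>i\<in>I. b i * u (\<kappa> i))" .
qed

lemma mult_X:
  assumes f: "f \<in> carrier X" and f': "f' \<in> carrier X"
  shows "f \<otimes>\<^bsub>X\<^esub> f' \<in> carrier X" "\<pi> (f \<otimes>\<^bsub>X\<^esub> f') = \<pi> f * \<pi> f'"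
proof -
  let ?I = "supp f \<times> supp f'" and ?\<kappa> = "\<lambda>(\<phi>, \<psi>). \<phi> \<otimes>\<^bsub>dual_group\<^esub> \<psi>"
  let ?b = "\<lambda>(\<phi>, \<psi>). f \<phi> * S \<phi> (f' \<psi>) * \<omega> \<phi> \<psi>"
  have eq: "f \<otimes>\<^bsub>X\<^esub> f' = (\<lambda>\<eta>. \<Sum>i\<in>?I. single (?\<kappa> i) (?b i) \<eta>)"
    by (simp add: factor_system_algebra_def sum.cartesian_product case_prod_beta)
  have fin: "finite ?I" using f f' by (simp add: carrier_X)
  have mem: "\<phi> \<in> Ghat" "f \<phi> \<in> B" if "\<phi> \<in> supp f" for \<phi> using f that by (auto simp: carrier_X)
  have mem': "\<phi> \<in> Ghat" "f' \<phi> \<in> B" if "\<phi> \<in> supp f'" for \<phi> using f' that by (auto simp: carrier_X)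
  have 1: "?\<kappa> i \<in> Ghat" "?b i \<in> B" if "i \<in> ?I" for i
    using that mem mem' by (auto intro!: Ghat_mult B_mult S_B \<omega>_B)
  note s = sum_single[OF fin, of ?\<kappa> ?b, OF 1]
  show "f \<otimes>\<^bsub>X\<^esub> f' \<in> carrier X" unfolding eq using s(1) by blast
  have "\<pi> (f \<otimes>\<^bsub>X\<^esub> f') = (\<Sum>i\<in>?I. ?b i * u (?\<kappa> i))" unfolding eq using s(2) by blast
  also have "\<dots> = (\<Sum>i\<in>?I. (\<lambda>(\<phi>, \<psi>). (f \<phi> * u \<phi>) * (f' \<psi> * u \<psi>)) i)"
  proof (intro sum.cong refl)
    fix i assume "i \<in> ?I"
    then obtain \<phi> \<psi> where i: "i = (\<phi>, \<psi>)" "\<phi> \<in> supp f" "\<psi> \<in> supp f'" by auto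
    note G = mem(1)[OF i(2)] mem'(1)[OF i(3)]
    \<comment> \<open>After \<open>S\<close> and \<open>\<omega>\<close> are unfolded, two adjacent
      pairs \<open>star (u \<kappa>) * u \<kappa>\<close> cancel: one for \<open>\<phi>\<close>, one
      for the product character.\<close>
    have l: "star (u \<kappa>) * (u \<kappa> * x) = x" if "\<kappa> \<in> Ghat" for \<kappa> x
      using uu[OF that] by (simp add: mult.assoc[symmetric])
    show "?b i * u (?\<kappa> i) = (\<lambda>(\<phi>, \<psi>). (f \<phi> * u \<phi>) * (f' \<psi> * u \<psi>)) i"
      using G Ghat_mult[OF G] by (simp add: i S_def \<omega>_def mult.assoc l uu)
  qed
  also have "\<dots> = \<pi> f * \<pi> f'" by (simp add: \<pi>_def sum_product sum.cartesian_product case_prod_beta)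
  finally show "\<pi> (f \<otimes>\<^bsub>X\<^esub> f') = \<pi> f * \<pi> f'" .
qed

lemma involution_X:
  assumes f: "f \<in> carrier X"
  shows "involution X f \<in> carrier X" "\<pi> (involution X f) = star (\<pi> f)"
proof -
  let ?\<kappa> = "\<lambda>\<phi>. inv\<^bsub>dual_group\<^esub> \<phi>"
  let ?b = "\<lambda>\<phi>. alg_inverse (\<omega> (inv\<^bsub>dual_group\<^esub> \<phi>) \<phi>) * S (inv\<^bsub>dual_group\<^esub> \<phi>) (star (f \<phi>))"
  have eq: "involution X f = (\<lambda>\<psi>. \<Sum>\<phi>\<in>supp f. single (?\<kappa> \<phi>) (?b \<phi>) \<psi>)"
    by (simp add: factor_system_algebra_def)
  have fin: "finite (supp f)" using f by (simp add: carrier_X)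
  have mem: "\<phi> \<in> Ghat" "f \<phi> \<in> B" if "\<phi> \<in> supp f" for \<phi> using f that by (auto simp: carrier_X)
  have inv: "?\<kappa> \<phi> \<in> Ghat" "?\<kappa> \<phi> \<otimes>\<^bsub>dual_group\<^esub> \<phi> = (\<lambda>g. 1)" if "\<phi> \<in> supp f" for \<phi>
    using mem(1)[OF that] by (auto simp: inv_dual_group Ghat_cnj mult.commute characterD(6))
  have b: "?b \<phi> = star (\<omega> (?\<kappa> \<phi>) \<phi>) * S (?\<kappa> \<phi>) (star (f \<phi>))" if "\<phi> \<in> supp f" for \<phi>
    using alg_inverse_unitary[OF \<omega>_unitary[OF inv(1)[OF that] mem(1)[OF that]]] by simp
  have 1: "?b \<phi> \<in> B" if "\<phi> \<in> supp f" for \<phi>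
    unfolding b[OF that] using inv[OF that] mem[OF that] by (intro B_mult B_star S_B \<omega>_B)
  note s = sum_single[OF fin, of ?\<kappa> ?b, OF inv(1) 1]
  show "involution X f \<in> carrier X" unfolding eq using s(1) by blast
  have "\<pi> (involution X f) = (\<Sum>\<phi>\<in>supp f. ?b \<phi> * u (?\<kappa> \<phi>))" unfolding eq using s(2) by blast
  also have "\<dots> = (\<Sum>\<phi>\<in>supp f. star (f \<phi> * u \<phi>))"
  proof (intro sum.cong refl)
    fix \<phi> assume \<phi>: "\<phi> \<in> supp f"
    note G = inv(1)[OF \<phi>]
    \<comment> \<open>The normalisation \<open>u_one\<close> enters: the product character is
      trivial, so \<open>\<omega>\<close> reduces to two unitaries, whose adjoint cancels the
      leading unitary of \<open>S\<close>.\<close>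
    have "star (\<omega> (?\<kappa> \<phi>) \<phi>) = star (u \<phi>) * star (u (?\<kappa> \<phi>))"
      unfolding \<omega>_def inv(2)[OF \<phi>] by (simp add: u_one star_mult)
    moreover have "star (u (?\<kappa> \<phi>)) * (u (?\<kappa> \<phi>) * x) = x" for x
      using uu[OF G] by (simp add: mult.assoc[symmetric])
    ultimately show "?b \<phi> * u (?\<kappa> \<phi>) = star (f \<phi> * u \<phi>)"
      unfolding b[OF \<phi>] unfolding S_def using uu[OF G] by (simp add: mult.assoc star_mult)
  qed
  also have "\<dots> = star (\<pi> f)" by (simp add: \<pi>_def star_sum)
  finally show "\<pi> (involution X f) = star (\<pi> f)" .
qed

lemma add_X:
  assumes f: "f \<in> carrier X" and f': "f' \<in> carrier X"
  shows "f \<oplus>\<^bsub>X\<^esub> f' = (\<lambda>\<phi>. f \<phi> + f' \<phi>)" "f \<oplus>\<^bsub>X\<^esub> f' \<in> carrier X" "\<pi> (f \<oplus>\<^bsub>X\<^esub> f') = \<pi> f + \<pi> f'"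
proof -
  show eq: "f \<oplus>\<^bsub>X\<^esub> f' = (\<lambda>\<phi>. f \<phi> + f' \<phi>)" by (simp add: factor_system_algebra_def)
  let ?T = "supp f \<union> supp f'"
  have T: "finite ?T" "supp (\<lambda>\<phi>. f \<phi> + f' \<phi>) \<subseteq> ?T" using f f' by (auto simp: carrier_X supp_def)
  show "f \<oplus>\<^bsub>X\<^esub> f' \<in> carrier X"
    unfolding eq using finite_subset[OF T(2,1)] T(2) f f' by (auto simp: carrier_X B_add)
  have "\<pi> (f \<oplus>\<^bsub>X\<^esub> f') = (\<Sum>\<phi>\<in>?T. f \<phi> * u \<phi>) + (\<Sum>\<phi>\<in>?T. f' \<phi> * u \<phi>)"
    unfolding eq \<pi>_superset[OF T] by (simp add: distrib_right sum.distrib)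
  also have "\<dots> = \<pi> f + \<pi> f'" using \<pi>_superset[of ?T f] \<pi>_superset[of ?T f'] T(1) by simp
  finally show "\<pi> (f \<oplus>\<^bsub>X\<^esub> f') = \<pi> f + \<pi> f'" .
qed

lemma cscale_X:
  assumes f: "f \<in> carrier X"
  shows "cscale X c f = (\<lambda>\<phi>. c *\<^sub>C f \<phi>)" "cscale X c f \<in> carrier X" "\<pi> (cscale X c f) = c *\<^sub>C \<pi> f"
proof -
  show eq: "cscale X c f = (\<lambda>\<phi>. c *\<^sub>C f \<phi>)" by (simp add: factor_system_algebra_def)
  have T: "finite (supp f)" "supp (\<lambda>\<phi>. c *\<^sub>C f \<phi>) \<subseteq> supp f" using f by (auto simp: carrier_X supp_def)
  show "cscale X c f \<in> carrier X"
    unfolding eq using finite_subset[OF T(2,1)] T(2) f by (auto simp: carrier_X B_scaleC)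
  show "\<pi> (cscale X c f) = c *\<^sub>C \<pi> f"
    unfolding eq \<pi>_superset[OF T] unfolding \<pi>_def by (simp add: scaleC_sum_right mult_scaleC_left)
qed

lemma zero_X: "\<zero>\<^bsub>X\<^esub> = (\<lambda>\<phi>. 0)" "\<zero>\<^bsub>X\<^esub> \<in> carrier X" "\<pi> \<zero>\<^bsub>X\<^esub> = 0"
  by (simp_all add: carrier_X supp_def \<pi>_def B_zero) (simp_all add: factor_system_algebra_def supp_def B_zero)

lemma one_X: "\<one>\<^bsub>X\<^esub> \<in> carrier X" "\<pi> \<one>\<^bsub>X\<^esub> = 1"
proof -
  have eq: "\<one>\<^bsub>X\<^esub> = (\<lambda>\<psi>. \<Sum>i\<in>{()}. single (\<lambda>g. 1) 1 \<psi>)" by (simp add: factor_system_algebra_def)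
  have "1 \<in> B" by (simp add: B_eq comp_one)
  note s = sum_single[of "{()}" "\<lambda>_ g. 1" "\<lambda>_. 1", OF _ Ghat_one this]
  show "\<one>\<^bsub>X\<^esub> \<in> carrier X" unfolding eq using s(1) by simp
  show "\<pi> \<one>\<^bsub>X\<^esub> = 1" unfolding eq using s(2) by (simp add: u_one)
qed

text \<open>Subtraction is defined through a unique-choice additive inverse, so the additive group
  laws are established first in order to recognise that inverse as scaling by -1.\<close>

lemma minus_X:
  assumes f: "f \<in> carrier X" and f': "f' \<in> carrier X"
  shows "f \<ominus>\<^bsub>X\<^esub> f' \<in> carrier X" "\<pi> (f \<ominus>\<^bsub>X\<^esub> f') = \<pi> f - \<pi> f'"
proof -
  have neg: "cscale X (- 1) h \<oplus>\<^bsub>X\<^esub> h = \<zero>\<^bsub>X\<^esub>" if "h \<in> carrier X" for h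
    unfolding add_X(1)[OF cscale_X(2)[OF that] that] unfolding cscale_X(1)[OF that] zero_X(1)
    by (simp add: scaleC_minus_one)
  interpret X: abelian_group X
  proof (rule abelian_groupI)
    fix x assume x: "x \<in> carrier X"
    show "\<exists>y\<in>carrier X. y \<oplus>\<^bsub>X\<^esub> x = \<zero>\<^bsub>X\<^esub>" using neg[OF x] cscale_X(2)[OF x] by blast
    show "\<zero>\<^bsub>X\<^esub> \<oplus>\<^bsub>X\<^esub> x = x" by (subst add_X(1)[OF zero_X(2) x]) (simp add: zero_X(1))
    fix y assume y: "y \<in> carrier X"
    show "x \<oplus>\<^bsub>X\<^esub> y = y \<oplus>\<^bsub>X\<^esub> x" by (simp add: add_X(1) x y add.commute)
    fix z assume z: "z \<in> carrier X"
    show "(x \<oplus>\<^bsub>X\<^esub> y) \<oplus>\<^bsub>X\<^esub> z = x \<oplus>\<^bsub>X\<^esub> (y \<oplus>\<^bsub>X\<^esub> z)"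
      unfolding add_X(1)[OF add_X(2)[OF x y] z] add_X(1)[OF x add_X(2)[OF y z]]
      unfolding add_X(1)[OF x y] add_X(1)[OF y z]
      by (simp add: add.assoc)
  qed (auto simp: zero_X(2) add_X(2))
  have "\<ominus>\<^bsub>X\<^esub> f' = cscale X (- 1) f'"
    by (rule X.minus_equality[OF neg[OF f'] f' cscale_X(2)[OF f']])
  then have eq: "f \<ominus>\<^bsub>X\<^esub> f' = f \<oplus>\<^bsub>X\<^esub> cscale X (- 1) f'" by (simp add: a_minus_def)
  show "f \<ominus>\<^bsub>X\<^esub> f' \<in> carrier X" "\<pi> (f \<ominus>\<^bsub>X\<^esub> f') = \<pi> f - \<pi> f'"
    unfolding eq using add_X(2,3)[OF f cscale_X(2)[OF f']] cscale_X(3)[OF f', of "- 1"]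
    by (simp_all add: scaleC_minus_one)
qed

sublocale dominated_algebra alg ell1 X \<pi>
  by unfold_locales
    (auto simp: image_\<pi> seminorm_X one_X zero_X(2,3) add_X(2,3) minus_X mult_X cscale_X(2,3) involution_X norm_le_ell1)

theorem isomorphic:
  "cstar_isomorphic (algebra_of_type :: 'a seminormed_star_algebra)
     (factor_system_cstar_algebra dual_group B S \<omega>)"
  unfolding factor_system_cstar_algebra_def ell1_algebra_def
proof (rule enveloping_isomorphic[OF alg_dense])
  show "p (cls (\<lambda>n. f)) \<le> norm (\<pi> f)" if "cstar_seminorm (completion X) p" "f \<in> carrier X" for p f
    using polynomial_growth that by (rule seminorm_le_norm_of_polynomial_growth)
qed

end

theorem propositionA26:
  fixes \<alpha> :: "'g::{topological_ab_group_add, t2_space} \<Rightarrow> 'a::unital_cstar_algebra \<Rightarrow> 'a"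
    and u :: "('g \<Rightarrow> complex) \<Rightarrow> 'a"
    and B :: "'a set"
    and S :: "('g \<Rightarrow> complex) \<Rightarrow> 'a \<Rightarrow> 'a"
    and \<omega> :: "('g \<Rightarrow> complex) \<Rightarrow> ('g \<Rightarrow> complex) \<Rightarrow> 'a"
  assumes "compact (UNIV :: 'g set)"
    and "cstar_dynamical_system \<alpha>"
    and "\<And>\<phi>. \<phi> \<in> carrier dual_group \<Longrightarrow> \<exists>a \<in> isotypic_component \<alpha> \<phi>. alg_invertible a"
    and "\<And>\<phi>. \<phi> \<in> carrier dual_group \<Longrightarrow> u \<phi> \<in> isotypic_component \<alpha> \<phi> \<and> unitary_element (u \<phi>)"
    and "u \<one>\<^bsub>dual_group\<^esub> = 1"
  defines "B \<equiv> fixed_point_algebra \<alpha>"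
    and "S \<equiv> \<lambda>\<phi> b. u \<phi> * b * star (u \<phi>)"
    and "\<omega> \<equiv> \<lambda>\<phi> \<phi>'. u \<phi> * u \<phi>' * star (u (\<phi> \<otimes>\<^bsub>dual_group\<^esub> \<phi>'))"
  shows "cstar_isomorphic (algebra_of_type :: 'a seminormed_star_algebra)
           (factor_system_cstar_algebra dual_group B S \<omega>)"
proof -
  interpret compact_cstar_system "TYPE('g)" \<alpha> by unfold_locales (fact assms(1,2))+
  interpret F: factor_system "TYPE('g)" \<alpha> u
    by unfold_locales (use assms(4,5) in \<open>auto simp: comp_def\<close>)
  show ?thesis using F.isomorphic unfolding B_def S_def \<omega>_def F.S_def F.\<omega>_def .
qed

end
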